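(* Let $\alpha>0$, $B_1>1$, $C_1>1$ and $C_2,\beta>0$. Assume that: (i) $1\le N_j\le C_1$ for each $j$; (ii) $N(n)\ge C_1^{-1}n$ for each $n\ge 1$, where $N(n)=\frac12\sum_{j\le n}N_j(N_j-1)$; (iii) $B_1^{-1}(1+|t|)^{-\alpha}\le |f_U^{\mathrm{Ft}}(t)|\le B_1(1+|t|)^{-\alpha}$ for all real $t$; (iv) $\alpha>\frac12$; (v) $\sup|K^{\mathrm{Ft}}|<\infty$ and, for some $c>0$, $K^{\mathrm{Ft}}(t)=0$ for all $|t|>c$; (vi) $h_1(n)\le h\le h_2(n)$, where $0<h_1(n)\le h_2(n)$, $h_2(n)\to0$ as $n\to\infty$ and, for some $\delta>0$, $n^{(1-\delta)/(4\alpha)}h_1(n)$ is bounded away from zero. Suppose in addition that $\beta>\alpha+\frac12$ and that $h\asymp h_0:=n^{-1/\{2(\alpha+\beta)-1\}}$ (i.e. $h/h_0$ is bounded away from zero and infinity), and put $q_n=n^{-2(\beta-1)/\{2(\alpha+\beta)-1\}}$. Then, as $n\to\infty$: (a) If the ridge parameter satisfies $c_1n^{-c_2}\le\rho\le c_3\min\{h_1(n)^{4\alpha+2},n^{-1}\}$ for constants $c_1,c_2,c_3>0$, then $$\sup_{f_X\in\mathcal F(\beta,C_2)}\ \sup_{-\infty<x<\infty}E\{\hat f_X(x)-\tilde f_X(x)\}^2=o(q_n).$$ (b) If the ridge parameter is zero then, with $\hat f_X^0$ denoting the resulting estimator, for each $f_X\in\mathcal F(\beta,C_2)$, each $x\in(-\infty,\infty)$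 and each pair $-\infty<x_1<x_2<\infty$, $$|\hat f_X^0(x)-\tilde f_X(x)|=o_p(q_n^{1/2}),\qquad \int_{x_1}^{x_2}\{\hat f_X^0(x)-\tilde f_X(x)\}^2\,dx=o_p(q_n).$$
   Context: Model. One observes $W_{jk}=X_j+U_{jk}$ for $1\le k\le N_j$, $1\le j\le n$, where the $X_j$ are identically distributed as $X$ (density $f_X$), the $U_{jk}$ are identically distributed as $U$ (density $f_U$), and all the $X_j$'s and $U_{jk}$'s are totally independent. The $N_j$ are deterministic positive integers. For a function $f$, $f^{\mathrm{Ft}}(t)=\int e^{itx}f(x)\,dx$. It is assumed throughout that $f_U^{\mathrm{Ft}}$ is real-valued and does not vanish at any point of the real line. Notation. $M=\sum_{j\le n}N_j$, $N=N(n)=\frac12\sum_{j\le n}N_j(N_j-1)$, and $\mathcal S_j$ is the set of pairs $(k_1,k_2)$ with $1\le k_1<k_2\le N_j$ (empty if $N_j=1$). The estimator of $f_U^{\mathrm{Ft}}$ is $$\hat f_U^{\mathrm{Ft}}(t)=\Bigl|\frac1N\sum_{j=1}^n\sum_{(k_1,k_2)\in\mathcal S_j}\cos\{t(W_{jk_1}-W_{jk_2})\}\Bigr|^{1/2}.$$ $K$ is a symmetric kernel function (real-valued, integrable, $\int K=1$) with compactly supported Fourier transform $K^{\mathrm{Ft}}$, $h=h(n)>0$ is a bandwidth, and $\rho=\rho(n)\ge0$ is a ridge parameter. Define $$\hat L(u)=\frac1{2\pi}\int e^{-itu}\frac{K^{\mathrm{Ft}}(t)}{\hat f_U^{\mathrm{Ft}}(t/h)+\rho}\,dt,\qquad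 L(u)=\frac1{2\pi}\int e^{-itu}\frac{K^{\mathrm{Ft}}(t)}{f_U^{\mathrm{Ft}}(t/h)}\,dt,$$ $$\hat f_X(x)=\frac1{Mh}\sum_{j=1}^n\sum_{k=1}^{N_j}\hat L\Bigl(\frac{x-W_{jk}}h\Bigr),\qquad \tilde f_X(x)=\frac1{Mh}\sum_{j=1}^n\sum_{k=1}^{N_j}L\Bigl(\frac{x-W_{jk}}h\Bigr).$$ $\hat f_X^0$ is the version of $\hat f_X$ with $\rho=0$; on the event that the integral defining $\hat L$ with $\rho=0$ is not absolutely convergent, it is assigned an arbitrary value (say $0$). For $\beta,B>0$, $\mathcal F(\beta,B)$ is the class of probability densities $f_X$ with $\sup_{t\in\mathbb R}(1+|t|)^\beta|f_X^{\mathrm{Ft}}(t)|\le B$. The error density $f_U$ is fixed. *)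

theory Defs
  imports "HOL-Probability.Probability" "HOL-Library.Landau_Symbols"
begin

definition prob_density :: "(real \<Rightarrow> real) \<Rightarrow> bool" where
  "prob_density f \<longleftrightarrow> f \<in> borel_measurable borel \<and> (\<forall>x. 0 \<le> f x) \<and>
     integrable lborel f \<and> (\<integral>x. f x \<partial>lborel) = 1"

definition FT :: "(real \<Rightarrow> real) \<Rightarrow> real \<Rightarrow> complex" where
  "FT f t = (\<integral>x. iexp (t * x) * complex_of_real (f x) \<partial>lborel)"

definition density_class :: "real \<Rightarrow> real \<Rightarrow> (real \<Rightarrow> real) set" where
  "density_class \<beta> B = {f. prob_density f \<and> (\<forall>t. (1 + \<bar>t\<bar>) powr \<beta> * cmod (FT f t) \<le> B)}"

text \<open>All variables (the \<open>X j\<close> and the \<open>U j k\<close> together) form one independent family; the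
  observations are \<open>obs X U \<omega> j k\<close>. Indices \<open>j\<close> and \<open>k\<close> start from 1.\<close>

definition replicated_model ::
  "'w measure \<Rightarrow> (nat \<Rightarrow> nat) \<Rightarrow> (real \<Rightarrow> real) \<Rightarrow> (real \<Rightarrow> real)
    \<Rightarrow> (nat \<Rightarrow> 'w \<Rightarrow> real) \<Rightarrow> (nat \<Rightarrow> nat \<Rightarrow> 'w \<Rightarrow> real) \<Rightarrow> bool" where
  "replicated_model P N fX fU X U \<longleftrightarrow>
     prob_space P \<and>
     (\<forall>j\<ge>1. distributed P lborel (X j) (\<lambda>x. ennreal (fX x))) \<and>
     (\<forall>j\<ge>1. \<forall>k\<in>{1..N j}. distributed P lborel (U j k) (\<lambda>x. ennreal (fU x))) \<and>
     prob_space.indep_vars P (\<lambda>_. borel)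
       (\<lambda>i. case i of Inl j \<Rightarrow> X j | Inr (j, k) \<Rightarrow> U j k)
       (Inl ` {1..} \<union> Inr ` (SIGMA j:{1..}. {1..N j}))"

definition obs :: "(nat \<Rightarrow> 'w \<Rightarrow> real) \<Rightarrow> (nat \<Rightarrow> nat \<Rightarrow> 'w \<Rightarrow> real)
    \<Rightarrow> 'w \<Rightarrow> nat \<Rightarrow> nat \<Rightarrow> real" where
  "obs X U \<omega> j k = X j \<omega> + U j k \<omega>"

definition num_obs :: "(nat \<Rightarrow> nat) \<Rightarrow> nat \<Rightarrow> real" where
  "num_obs N n = (\<Sum>j=1..n. real (N j))"

definition num_pairs :: "(nat \<Rightarrow> nat) \<Rightarrow> nat \<Rightarrow> real" where
  "num_pairs N n = (1/2) * (\<Sum>j=1..n. real (N j) * (real (N j) - 1))"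

definition pair_set :: "(nat \<Rightarrow> nat) \<Rightarrow> nat \<Rightarrow> (nat \<times> nat) set" where
  "pair_set N j = {(k1, k2). 1 \<le> k1 \<and> k1 < k2 \<and> k2 \<le> N j}"

text \<open>In the estimators, \<open>w j k\<close> is the observed value of \<open>W_{jk}\<close>.\<close>

definition fU_Ft_hat :: "(nat \<Rightarrow> nat) \<Rightarrow> nat \<Rightarrow> (nat \<Rightarrow> nat \<Rightarrow> real) \<Rightarrow> real \<Rightarrow> real" where
  "fU_Ft_hat N n w t =
     sqrt \<bar>(1 / num_pairs N n) *
           (\<Sum>j=1..n. \<Sum>(k1, k2)\<in>pair_set N j. cos (t * (w j k1 - w j k2)))\<bar>"

definition L_hat :: "(real \<Rightarrow> real) \<Rightarrow> (nat \<Rightarrow> nat) \<Rightarrow> nat \<Rightarrow> real \<Rightarrow> real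
    \<Rightarrow> (nat \<Rightarrow> nat \<Rightarrow> real) \<Rightarrow> real \<Rightarrow> complex" where
  "L_hat K N n h \<rho> w u = complex_of_real (1 / (2 * pi)) *
     (\<integral>t. iexp (- (t * u)) * (FT K t / complex_of_real (fU_Ft_hat N n w (t / h) + \<rho>)) \<partial>lborel)"

definition L_fun :: "(real \<Rightarrow> real) \<Rightarrow> (real \<Rightarrow> real) \<Rightarrow> real \<Rightarrow> real \<Rightarrow> complex" where
  "L_fun K fU h u = complex_of_real (1 / (2 * pi)) *
     (\<integral>t. iexp (- (t * u)) * (FT K t / FT fU (t / h)) \<partial>lborel)"

text \<open>The estimators below are typed as complex numbers because they are Fourier integrals; for
  symmetric \<open>K\<close> and real-valued \<open>FT fU\<close> they are real, so that the squared modulus of a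
  difference is its square.\<close>

definition fX_hat :: "(real \<Rightarrow> real) \<Rightarrow> (nat \<Rightarrow> nat) \<Rightarrow> nat \<Rightarrow> real \<Rightarrow> real
    \<Rightarrow> (nat \<Rightarrow> nat \<Rightarrow> real) \<Rightarrow> real \<Rightarrow> complex" where
  "fX_hat K N n h \<rho> w x = complex_of_real (1 / (num_obs N n * h)) *
     (\<Sum>j=1..n. \<Sum>k=1..N j. L_hat K N n h \<rho> w ((x - w j k) / h))"

definition fX_tilde :: "(real \<Rightarrow> real) \<Rightarrow> (nat \<Rightarrow> nat) \<Rightarrow> nat \<Rightarrow> real \<Rightarrow> (real \<Rightarrow> real)
    \<Rightarrow> (nat \<Rightarrow> nat \<Rightarrow> real) \<Rightarrow> real \<Rightarrow> complex" where
  "fX_tilde K N n h fU w x = complex_of_real (1 / (num_obs N n * h)) *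
     (\<Sum>j=1..n. \<Sum>k=1..N j. L_fun K fU h ((x - w j k) / h))"

text \<open>The ridge-free estimator, with value \<open>a\<close> where the integral defining \<open>L_hat\<close> is not absolutely
  convergent (a condition not depending on the argument of \<open>L_hat\<close>, since \<open>iexp\<close> has modulus 1).
  If \<open>num_pairs N n > 0\<close>, then \<open>fU_Ft_hat N n w\<close> vanishes on a null set only, so the convention
  \<open>z / 0 = 0\<close> does not affect integrability.\<close>

definition fX_hat0 :: "complex \<Rightarrow> (real \<Rightarrow> real) \<Rightarrow> (nat \<Rightarrow> nat) \<Rightarrow> nat \<Rightarrow> real
    \<Rightarrow> (nat \<Rightarrow> nat \<Rightarrow> real) \<Rightarrow> real \<Rightarrow> complex" where
  "fX_hat0 a K N n h w x =
     (if integrable lborel (\<lambda>t. FT K t / complex_of_real (fU_Ft_hat N n w (t / h)))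
      then fX_hat K N n h 0 w x else a)"

text \<open>\<open>Z n = o_p (r n)\<close> for nonnegative random variables. The values are extended reals so that a
  divergent integral counts as infinite; measurability is included because \<open>measure\<close> is 0 on
  non-measurable sets.\<close>

definition small_o_p :: "'w measure \<Rightarrow> (nat \<Rightarrow> 'w \<Rightarrow> ennreal) \<Rightarrow> (nat \<Rightarrow> real) \<Rightarrow> bool" where
  "small_o_p P Z r \<longleftrightarrow>
     (\<forall>n. Z n \<in> borel_measurable P) \<and>
     (\<forall>\<epsilon>>0. (\<lambda>n. measure P {\<omega> \<in> space P. Z n \<omega> > ennreal (\<epsilon> * r n)}) \<longlonglongrightarrow> 0)"

definition q_rate :: "real \<Rightarrow> real \<Rightarrow> nat \<Rightarrow> real" where
  "q_rate \<alpha> \<beta> n = real n powr (- 2 * (\<beta> - 1) / (2 * (\<alpha> + \<beta>) - 1))"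

end

theory Submission
  imports Defs "HOL-Real_Asymp.Real_Asymp"
begin

text \<open>Let \<open>V(t)\<close> be the average of \<open>cos(t(W_{jk} - W_{jl}))\<close>, so that the estimator of \<open>f_U^{Ft}(t)\<close> is
  \<open>|V(t)|^{1/2}\<close>, and write the difference of the two density estimators as a Fourier integral of
  the empirical characteristic function times \<open>R(t) = 1/(|V(t)|^{1/2} + \<rho>) - 1/f_U^{Ft}(t)\<close>. Since
  the \<open>X_j\<close> cancel in \<open>V\<close>, the factor \<open>R\<close> depends on the errors only and is independent of the
  signals. Averaging over the signals first, the covariance of the integrand at \<open>t\<close> and \<open>s\<close> is a
  product of \<open>f_X^{Ft}(t)\<close>, \<open>f_X^{Ft}(s)\<close> and small second moments, plus a diagonal term of order
  \<open>1/n\<close> which is concentrated near \<open>t = s\<close> because \<open>f_X^{Ft}\<close> is integrable. This concentration is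
  what makes \<open>\<beta> > \<alpha> + 1/2\<close> sufficient, and it needs moments of \<open>R\<close> only for one \<open>t\<close> at a time;
  Hoeffding's inequality together with the ridge controls the event that \<open>V(t)\<close> is far from its mean.

  Without a ridge, the estimator is compared with the one for \<open>\<rho> = n^{-\<kappa>}\<close>, \<open>\<kappa>\<close> large. With
  \<open>\<sigma> = 2p - 1\<close> the two differ by at most \<open>\<rho>^\<sigma>\<close> times the integral of \<open>|V(t)|^{-p}\<close>, so it is
  enough that \<open>E|V(t)|^{-p}\<close> is polynomially bounded for some \<open>p > 1/2\<close>. As \<open>\<alpha> > 1/2\<close>, the Fejer
  kernel shows that \<open>tU\<close> modulo \<open>2\<pi>\<close> charges an interval of length \<open>\<epsilon>\<close> with mass
  \<open>O(\<epsilon>^a)\<close> for some \<open>a > 1/2\<close>; integrating out two errors in each of two blocks with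
  replicates then yields the bound. For \<open>|t| \<le> 1/n\<close> it degenerates, but there
  \<open>V(t) \<ge> 1/2\<close> with probability tending to one.\<close>

text \<open>Two second moments at a single frequency drive the rate. Alone, \<open>R(t)\<close> has
  one of order \<open>psi(t)^(-6)/n\<close>, where \<open>psi\<close> is the transform of the error
  density. Multiplied by the average of \<open>cis (t * U j k)\<close>, which is itself of size
  \<open>psi(t)\<close>, it has one of order \<open>psi(t)^(-4)/n\<close> only. The latter enters
  the product term of the covariance, the former the diagonal term, where a further
  \<open>1/n\<close> pays for it. Compared with \<open>q_n\<close> at the cut-off
  \<open>c/h\<close>, each term yields the threshold \<beta> = \<alpha> + 1/2, and so does the
  demand that \<open>n psi(t)^4\<close> be at least a positive power of \<open>n\<close>, by which
  Hoeffding's bound absorbs any polynomial in the inverse ridge.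

  The negative moments are delicate because, for \<alpha> near 1/2, inverse moments of
  \<open>sin\<close> of an error are at hand only slightly beyond order 1/2, while merging zeros of
  \<open>c + r cos x\<close> double the exponent. The first integration therefore splits off the
  distances of \<open>c\<close> from \<plusminus>\<open>r\<close> at half the exponent, and a fresh
  error from an independent second block makes these distances random, so that the doubling only
  leads back to the exponent \<open>p\<close>.\<close>

section \<open>Negative moments of random trigonometric expressions\<close>

text \<open>With values in \<open>ennreal\<close>, the function is infinite at \<open>0\<close>, whereas \<open>0 powr (- p) = 0\<close>.\<close>

definition inv_powr :: "real \<Rightarrow> real \<Rightarrow> ennreal" where
  "inv_powr p z = inverse (ennreal (\<bar>z\<bar> powr p))"

lemma measurable_inv_powr [measurable]: "inv_powr p \<in> borel_measurable borel"
  unfolding inv_powr_def [abs_def] by measurable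

lemma inv_powr_uminus [simp]: "inv_powr p (- z) = inv_powr p z"
  by (simp add: inv_powr_def)

lemma inv_powr_abs [simp]: "inv_powr p \<bar>z\<bar> = inv_powr p z"
  by (simp add: inv_powr_def)

lemma inv_powr_antimono: "0 \<le> p \<Longrightarrow> \<bar>x\<bar> \<le> \<bar>y\<bar> \<Longrightarrow> inv_powr p y \<le> inv_powr p x"
proof (cases "x = 0")
  case False
  then show "inv_powr p y \<le> inv_powr p x" if "0 \<le> p" "\<bar>x\<bar> \<le> \<bar>y\<bar>"
    using that by (auto simp: inv_powr_def inverse_ennreal powr_mono2 intro!: ennreal_leI)
qed (simp add: inv_powr_def)

lemma inv_powr_mult: "inv_powr p (x * y) = inv_powr p x * inv_powr p y"
proof (cases "x = 0 \<or> y = 0")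
  case True
  then show ?thesis
    by (auto simp: inv_powr_def ennreal_top_mult ennreal_mult_top)
next
  case False
  then show ?thesis
    by (simp add: inv_powr_def abs_mult powr_mult inverse_ennreal ennreal_mult[symmetric] powr_gt_zero)
qed

lemma inv_powr_sqrt: "inv_powr p (sqrt x) = inv_powr (p / 2) x"
proof -
  have "sqrt \<bar>x\<bar> powr p = \<bar>x\<bar> powr (p / 2)"
    by (simp add: powr_half_sqrt[symmetric] powr_powr)
  then show ?thesis
    by (simp add: inv_powr_def real_sqrt_abs2[symmetric] flip: real_sqrt_abs2)
qed

lemma inv_powr_square: "inv_powr (p / 2) (x\<^sup>2) = inv_powr p x"
  using inv_powr_sqrt[of p "x\<^sup>2"] by simp

lemma inv_powr_min: "inv_powr p (min x y) \<le> inv_powr p x + inv_powr p y"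
  by (simp add: min_def)

text \<open>Raised to the power \<open>-p\<close>, the first bound keeps the exponent at the price of a factor that is
  singular for \<open>c = \<plusminus>r\<close>; the second has no such factor but doubles the exponent.\<close>

lemma abs_affine_cos_ge:
  fixes c r :: real
  assumes "r \<ge> 0"
  obtains a b where
    "\<And>x. \<bar>c + r * cos x\<bar> \<ge> sqrt (r * min \<bar>r - c\<bar> \<bar>r + c\<bar>) * min \<bar>sin ((x - a) / 2)\<bar> \<bar>sin ((x - b) / 2)\<bar>"
    "\<And>x. \<bar>c + r * cos x\<bar> \<ge> r * (min \<bar>sin ((x - a) / 2)\<bar> \<bar>sin ((x - b) / 2)\<bar>)\<^sup>2"
proof (cases "\<bar>c\<bar> \<le> r")
  case True
  show thesis
  proof (cases "r = 0")
    case True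
    then show thesis by (intro that[of 0 0]) auto
  next
    case False
    with assms have r: "r > 0" by simp
    \<comment> \<open>The zeros of \<open>c + r * cos x\<close> are at \<plusminus>\<open>f\<close>
      modulo \<open>2 * pi\<close>; the difference of cosines factors into the half-angle sines at
      these two points.\<close>
    define f where "f = arccos (- c / r)"
    have cf: "c = - r * cos f"
      using True r by (simp add: f_def abs_le_iff field_simps)
    have "(r * sin f)\<^sup>2 = r\<^sup>2 - c\<^sup>2"
      by (simp add: cf power_mult_distrib sin_squared_eq right_diff_distrib)
    then have sf: "(r * sin f)\<^sup>2 = (r - c) * (r + c)"
      by (simp add: algebra_simps power2_eq_square)
    have eq: "\<bar>c + r * cos x\<bar> = 2 * r * (\<bar>sin ((x - - f) / 2)\<bar> * \<bar>sin ((x - f) / 2)\<bar>)" for x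
    proof -
      have "c + r * cos x = r * (cos x - cos f)" by (simp add: cf algebra_simps)
      also have "cos x - cos f = 2 * sin ((x + f) / 2) * sin ((f - x) / 2)" by (rule cos_diff_cos)
      also have "sin ((f - x) / 2) = - sin ((x - f) / 2)"
        by (metis minus_diff_eq minus_divide_left sin_minus)
      finally show ?thesis using r by (simp add: abs_mult)
    qed
    \<comment> \<open>\<open>f\<close> is the difference of the two half angles, so both sines
      cannot be small: the larger one is at least half of \<open>\<bar>sin f\<bar>\<close>, and
      \<open>r * \<bar>sin f\<bar>\<close> is the square root of
      \<open>(r - c) * (r + c)\<close>.\<close>
    have le: "sqrt (r * min \<bar>r - c\<bar> \<bar>r + c\<bar>) \<le> 2 * r * max \<bar>sin ((x - - f) / 2)\<bar> \<bar>sin ((x - f) / 2)\<bar>" for x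
    proof -
      have "r * min \<bar>r - c\<bar> \<bar>r + c\<bar> \<le> max \<bar>r - c\<bar> \<bar>r + c\<bar> * min \<bar>r - c\<bar> \<bar>r + c\<bar>"
        using True by (intro mult_right_mono) (auto simp: max_def)
      also have "\<dots> = (r - c) * (r + c)"
        using True by (auto simp: max_def min_def mult.commute)
      finally have "sqrt (r * min \<bar>r - c\<bar> \<bar>r + c\<bar>) \<le> sqrt ((r * sin f)\<^sup>2)"
        unfolding sf by (rule real_sqrt_le_mono)
      also have "\<dots> = r * \<bar>sin f\<bar>" using r by (simp add: abs_mult)
      also have "\<bar>sin f\<bar> \<le> \<bar>sin ((x - - f) / 2)\<bar> + \<bar>sin ((x - f) / 2)\<bar>"
      proof -
        have "f = (x - - f) / 2 - (x - f) / 2" by (simp add: field_simps)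
        then have "sin f = sin ((x - - f) / 2) * cos ((x - f) / 2) - cos ((x - - f) / 2) * sin ((x - f) / 2)"
          by (metis sin_diff)
        also have "\<bar>\<dots>\<bar> \<le> \<bar>sin ((x - - f) / 2)\<bar> * \<bar>cos ((x - f) / 2)\<bar> + \<bar>cos ((x - - f) / 2)\<bar> * \<bar>sin ((x - f) / 2)\<bar>"
          by (metis abs_mult abs_triangle_ineq4)
        also have "\<dots> \<le> \<bar>sin ((x - - f) / 2)\<bar> * 1 + 1 * \<bar>sin ((x - f) / 2)\<bar>"
          by (intro add_mono mult_left_mono mult_right_mono) auto
        finally show ?thesis by simp
      qed
      also have "\<dots> \<le> 2 * max \<bar>sin ((x - - f) / 2)\<bar> \<bar>sin ((x - f) / 2)\<bar>" by (simp add: max_def)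
      finally show ?thesis using r by simp
    qed
    show thesis
    proof (rule that[of "-f" f])
      fix x
      let ?A = "\<bar>sin ((x - - f) / 2)\<bar>" and ?B = "\<bar>sin ((x - f) / 2)\<bar>"
      have "sqrt (r * min \<bar>r - c\<bar> \<bar>r + c\<bar>) * min ?A ?B \<le> 2 * r * max ?A ?B * min ?A ?B"
        by (intro mult_right_mono le) auto
      also have "\<dots> = 2 * r * (?A * ?B)" by (auto simp: max_def min_def)
      finally show "sqrt (r * min \<bar>r - c\<bar> \<bar>r + c\<bar>) * min ?A ?B \<le> \<bar>c + r * cos x\<bar>" by (simp add: eq)
      have "(min ?A ?B)\<^sup>2 \<le> ?A * ?B"
        unfolding power2_eq_square by (intro mult_mono) auto
      also have "\<dots> \<le> 2 * (?A * ?B)" by simp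
      finally show "r * (min ?A ?B)\<^sup>2 \<le> \<bar>c + r * cos x\<bar>"
        using r unfolding eq by (simp add: mult.assoc)
    qed
  qed
next
  case False
  \<comment> \<open>Without a real zero, the modulus is the gap \<open>\<bar>c\<bar> - r\<close>
    plus a quadratic term \<open>2 * r * s^2\<close> in the half-angle sine \<open>s\<close>; the
    arithmetic-geometric mean inequality trades the two against each other.\<close>
  have main: "sqrt (r * (\<bar>c\<bar> - r)) * \<bar>s\<bar> \<le> (\<bar>c\<bar> - r) + 2 * r * s\<^sup>2" for s
  proof -
    have "4 * ((\<bar>c\<bar> - r) * (2 * r * s\<^sup>2)) \<le> ((\<bar>c\<bar> - r) + 2 * r * s\<^sup>2)\<^sup>2"
      using zero_le_power2[of "(\<bar>c\<bar> - r) - 2 * r * s\<^sup>2"] by (simp add: power2_eq_square algebra_simps)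
    moreover have "0 \<le> (\<bar>c\<bar> - r) * (r * s\<^sup>2)" using False assms by simp
    ultimately have "(\<bar>c\<bar> - r) * (r * s\<^sup>2) \<le> ((\<bar>c\<bar> - r) + 2 * r * s\<^sup>2)\<^sup>2" by linarith
    then have "sqrt ((r * (\<bar>c\<bar> - r)) * s\<^sup>2) \<le> (\<bar>c\<bar> - r) + 2 * r * s\<^sup>2"
      using False assms by (intro real_le_lsqrt) (auto simp: mult_ac)
    then show ?thesis by (simp add: real_sqrt_mult)
  qed
  have m: "min \<bar>r - c\<bar> \<bar>r + c\<bar> = \<bar>c\<bar> - r" using False assms by (auto simp: min_def abs_if)
  \<comment> \<open>The modulus is smallest where \<open>cos x = -1\<close> for positive
    \<open>c\<close> and where \<open>cos x = 1\<close> for negative \<open>c\<close>; both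
    witnesses are this one point.\<close>
  show thesis
  proof (cases "c > 0")
    case True
    have eq: "\<bar>c + r * cos x\<bar> = (\<bar>c\<bar> - r) + 2 * r * (sin ((x - - pi) / 2))\<^sup>2" for x
    proof -
      have s: "sin ((x - - pi) / 2) = cos (x / 2)" by (simp add: add_divide_distrib sin_add)
      have c2: "cos x = 2 * (cos (x / 2))\<^sup>2 - 1"
        using cos_double_cos[of "x / 2"] by simp
      have *: "c + r * cos x = (\<bar>c\<bar> - r) + 2 * r * (sin ((x - - pi) / 2))\<^sup>2"
        unfolding s by (subst c2) (use True in \<open>simp add: algebra_simps\<close>)
      have "\<dots> \<ge> 0" using False assms by (intro add_nonneg_nonneg) auto
      with * show ?thesis by simp
    qed
    show thesis
      by (rule that[of "-pi" "-pi"]) (use main False assms in \<open>auto simp: eq m simp del: diff_minus_eq_add\<close>)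
  next
    case False': False
    have eq: "\<bar>c + r * cos x\<bar> = (\<bar>c\<bar> - r) + 2 * r * (sin ((x - 0) / 2))\<^sup>2" for x
    proof -
      have c2: "cos x = 1 - 2 * (sin (x / 2))\<^sup>2"
        using cos_double_sin[of "x / 2"] by simp
      have *: "- (c + r * cos x) = (\<bar>c\<bar> - r) + 2 * r * (sin ((x - 0) / 2))\<^sup>2"
        by (subst c2) (use False' in \<open>simp add: algebra_simps\<close>)
      have "\<dots> \<ge> 0" using False assms by (intro add_nonneg_nonneg) auto
      with * show ?thesis by simp
    qed
    show thesis
      by (rule that[of 0 0]) (use main False assms in \<open>auto simp: eq m simp del: diff_zero\<close>)
  qed
qed

text \<open>After rotation by the argument of \<open>w\<close>, the second summand is real and drops
  out of the imaginary part. What is left is \<open>\<bar>sin (x - Arg w)\<bar>\<close>, twice a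
  product of half-angle sines.\<close>

lemma cmod_cis_add_ge:
  fixes w :: complex
  obtains a b where
    "\<And>x. cmod (cis x + w) \<ge> (min \<bar>sin ((x - a) / 2)\<bar> \<bar>sin ((x - b) / 2)\<bar>)\<^sup>2"
proof -
  define a where "a = Arg w"
  have w: "w = of_real (cmod w) * cis a"
    using rcis_cmod_Arg[of w] by (simp add: a_def rcis_def)
  show thesis
  proof (rule that[of a "a - pi"])
    fix x
    let ?A = "\<bar>sin ((x - a) / 2)\<bar>" and ?B = "\<bar>sin ((x - (a - pi)) / 2)\<bar>"
    have e: "2 * ((x - a) / 2) = x - a" by simp
    have "sin ((x - (a - pi)) / 2) = sin ((x - a) / 2 + pi / 2)"
      by (simp add: field_simps)
    then have B: "sin ((x - (a - pi)) / 2) = cos ((x - a) / 2)" by (simp add: sin_add)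
    have "cis x + w = cis a * (cis (x - a) + of_real (cmod w))"
      by (subst w) (simp add: algebra_simps cis_mult)
    then have "cmod (cis x + w) = cmod (cis (x - a) + of_real (cmod w))"
      by (simp add: norm_mult)
    also have "\<dots> \<ge> \<bar>sin (x - a)\<bar>"
      using abs_Im_le_cmod[of "cis (x - a) + of_real (cmod w)"] by simp
    also have "sin (x - a) = 2 * sin ((x - a) / 2) * cos ((x - a) / 2)"
      using sin_double[of "(x - a) / 2"] unfolding e .
    finally have "2 * (?A * ?B) \<le> cmod (cis x + w)" by (simp add: B abs_mult)
    moreover have "(min ?A ?B)\<^sup>2 \<le> ?A * ?B"
      unfolding power2_eq_square by (intro mult_mono) auto
    moreover have "0 \<le> ?A * ?B" by simp
    ultimately show "(min ?A ?B)\<^sup>2 \<le> cmod (cis x + w)" by linarith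
  qed
qed

text \<open>\<open>D\<close> will be the law of one error and \<open>t\<close> the frequency.
  Uniformity in the shift \<open>a\<close> is essential, since \<open>a\<close> later stands for a
  phase determined by all the errors that have been conditioned on.\<close>

locale sin_moment =
  fixes D :: "real measure" and p t :: real and C :: ennreal
  assumes sets_D [measurable_cong]: "sets D = sets borel"
    and p_pos: "0 < p"
    and sin_moment: "\<And>a. (\<integral>\<^sup>+u. inv_powr p (sin ((t * u - a) / 2)) \<partial>D) \<le> C"
begin

lemma sin_min_moment:
  "(\<integral>\<^sup>+u. inv_powr p (min \<bar>sin ((t * u - a) / 2)\<bar> \<bar>sin ((t * u - b) / 2)\<bar>) \<partial>D) \<le> 2 * C"
proof -
  have "(\<integral>\<^sup>+u. inv_powr p (min \<bar>sin ((t * u - a) / 2)\<bar> \<bar>sin ((t * u - b) / 2)\<bar>) \<partial>D)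
      \<le> (\<integral>\<^sup>+u. inv_powr p (sin ((t * u - a) / 2)) + inv_powr p (sin ((t * u - b) / 2)) \<partial>D)"
    by (intro nn_integral_mono order_trans[OF inv_powr_min]) simp
  also have "\<dots> = (\<integral>\<^sup>+u. inv_powr p (sin ((t * u - a) / 2)) \<partial>D) + (\<integral>\<^sup>+u. inv_powr p (sin ((t * u - b) / 2)) \<partial>D)"
    by (intro nn_integral_add) measurable
  also have "\<dots> \<le> C + C" by (intro add_mono sin_moment)
  finally show ?thesis by (simp add: mult_2)
qed

text \<open>Integrating one error at the full exponent \<open>p\<close> leaves \<open>r\<close>,
  \<open>r - c\<close> and \<open>r + c\<close> at half the exponent only. These are then within
  reach of the half-exponent bounds below, applied to further errors.\<close>

lemma affine_cos_moment:
  assumes "r \<ge> 0"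
  shows "(\<integral>\<^sup>+u. inv_powr p (c + r * cos (t * u + d)) \<partial>D)
    \<le> inv_powr (p / 2) r * (inv_powr (p / 2) (r - c) + inv_powr (p / 2) (r + c)) * (2 * C)"
proof -
  obtain a b where ab: "\<And>x. \<bar>c + r * cos x\<bar> \<ge> sqrt (r * min \<bar>r - c\<bar> \<bar>r + c\<bar>) * min \<bar>sin ((x - a) / 2)\<bar> \<bar>sin ((x - b) / 2)\<bar>"
    using abs_affine_cos_ge[OF assms] by metis
  let ?m = "\<lambda>u. min \<bar>sin ((t * u - (a - d)) / 2)\<bar> \<bar>sin ((t * u - (b - d)) / 2)\<bar>"
  let ?e = "inv_powr (p / 2) r * (inv_powr (p / 2) (r - c) + inv_powr (p / 2) (r + c))"
  have "inv_powr p (c + r * cos (t * u + d)) \<le> ?e * inv_powr p (?m u)" for u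
  proof -
    have "inv_powr p (c + r * cos (t * u + d)) \<le> inv_powr p (sqrt (r * min \<bar>r - c\<bar> \<bar>r + c\<bar>) * ?m u)"
      using ab[of "t * u + d"] p_pos assms
      by (intro inv_powr_antimono) (auto simp: abs_mult algebra_simps)
    also have "\<dots> = inv_powr (p / 2) r * inv_powr (p / 2) (min \<bar>r - c\<bar> \<bar>r + c\<bar>) * inv_powr p (?m u)"
      by (simp add: inv_powr_mult inv_powr_sqrt)
    also have "\<dots> \<le> ?e * inv_powr p (?m u)"
      by (intro mult_right_mono mult_left_mono order_trans[OF inv_powr_min]) auto
    finally show ?thesis .
  qed
  then have "(\<integral>\<^sup>+u. inv_powr p (c + r * cos (t * u + d)) \<partial>D) \<le> (\<integral>\<^sup>+u. ?e * inv_powr p (?m u) \<partial>D)"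
    by (intro nn_integral_mono)
  also have "\<dots> = ?e * (\<integral>\<^sup>+u. inv_powr p (?m u) \<partial>D)"
    by (intro nn_integral_cmult) measurable
  also have "\<dots> \<le> ?e * (2 * C)"
    by (intro mult_left_mono sin_min_moment) auto
  finally show ?thesis .
qed

text \<open>Halving the exponent offsets the square in the second bound of
  \<open>abs_affine_cos_ge\<close>. No factor in \<open>c\<close> survives, so \<open>c\<close> may
  depend on the other errors in any way.\<close>

lemma affine_cos_half_moment:
  assumes "r \<ge> 0"
  shows "(\<integral>\<^sup>+u. inv_powr (p / 2) (c + r * cos (t * u + d)) \<partial>D) \<le> inv_powr (p / 2) r * (2 * C)"
proof -
  obtain a b where ab: "\<And>x. \<bar>c + r * cos x\<bar> \<ge> r * (min \<bar>sin ((x - a) / 2)\<bar> \<bar>sin ((x - b) / 2)\<bar>)\<^sup>2"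
    using abs_affine_cos_ge[OF assms] by metis
  let ?m = "\<lambda>u. min \<bar>sin ((t * u - (a - d)) / 2)\<bar> \<bar>sin ((t * u - (b - d)) / 2)\<bar>"
  have "inv_powr (p / 2) (c + r * cos (t * u + d)) \<le> inv_powr (p / 2) r * inv_powr p (?m u)" for u
  proof -
    have "inv_powr (p / 2) (c + r * cos (t * u + d)) \<le> inv_powr (p / 2) (r * (?m u)\<^sup>2)"
      using ab[of "t * u + d"] p_pos assms
      by (intro inv_powr_antimono) (auto simp: abs_mult algebra_simps)
    also have "\<dots> = inv_powr (p / 2) r * inv_powr p (?m u)"
      by (simp add: inv_powr_mult inv_powr_square)
    finally show ?thesis .
  qed
  then have "(\<integral>\<^sup>+u. inv_powr (p / 2) (c + r * cos (t * u + d)) \<partial>D) \<le> (\<integral>\<^sup>+u. inv_powr (p / 2) r * inv_powr p (?m u) \<partial>D)"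
    by (intro nn_integral_mono)
  also have "\<dots> = inv_powr (p / 2) r * (\<integral>\<^sup>+u. inv_powr p (?m u) \<partial>D)"
    by (intro nn_integral_cmult) measurable
  also have "\<dots> \<le> inv_powr (p / 2) r * (2 * C)"
    by (intro mult_left_mono sin_min_moment) auto
  finally show ?thesis .
qed

lemma cis_add_half_moment: "(\<integral>\<^sup>+u. inv_powr (p / 2) (cmod (cis (t * u) + w)) \<partial>D) \<le> 2 * C"
proof -
  obtain a b where ab: "\<And>x. cmod (cis x + w) \<ge> (min \<bar>sin ((x - a) / 2)\<bar> \<bar>sin ((x - b) / 2)\<bar>)\<^sup>2"
    using cmod_cis_add_ge by metis
  have "inv_powr (p / 2) (cmod (cis (t * u) + w))
      \<le> inv_powr p (min \<bar>sin ((t * u - a) / 2)\<bar> \<bar>sin ((t * u - b) / 2)\<bar>)" for u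
    using ab[of "t * u"] p_pos
    by (subst inv_powr_square[symmetric]) (intro inv_powr_antimono, auto)
  then have "(\<integral>\<^sup>+u. inv_powr (p / 2) (cmod (cis (t * u) + w)) \<partial>D)
     \<le> (\<integral>\<^sup>+u. inv_powr p (min \<bar>sin ((t * u - a) / 2)\<bar> \<bar>sin ((t * u - b) / 2)\<bar>) \<partial>D)"
    by (intro nn_integral_mono)
  also have "\<dots> \<le> 2 * C" by (rule sin_min_moment)
  finally show ?thesis .
qed

text \<open>The law of cosines: as a function of one error, the squared modulus of a block sum is
  affine in a shifted cosine.\<close>

lemma half_square_cmod_cis_add:
  "(cmod (cis x + z))\<^sup>2 / 2 = (1 + (cmod z)\<^sup>2) / 2 + cmod z * cos (x + - Arg z)"
proof -
  define a where "a = Arg z"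
  have z: "z = of_real (cmod z) * cis a"
    using rcis_cmod_Arg[of z] by (simp add: a_def rcis_def)
  have "(cmod (cis x + of_real (cmod z) * cis a))\<^sup>2 / 2 = (1 + (cmod z)\<^sup>2) / 2 + cmod z * cos (x + - a)"
  proof -
    have "(cos x + cmod z * cos a)\<^sup>2 + (sin x + cmod z * sin a)\<^sup>2
        = ((cos x)\<^sup>2 + (sin x)\<^sup>2) + (cmod z)\<^sup>2 * ((cos a)\<^sup>2 + (sin a)\<^sup>2) + 2 * cmod z * (cos x * cos a + sin x * sin a)"
      by algebra
    then show ?thesis
      by (simp only: cmod_power2) (simp add: cos_diff add_divide_distrib)
  qed
  then show ?thesis by (simp add: z[symmetric] a_def[symmetric] flip: z)
qed

text \<open>\<open>u1\<close>, \<open>u2\<close> are errors of one block, \<open>v1\<close>,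
  \<open>v2\<close> of another; \<open>w\<close>, \<open>w'\<close> and \<open>c\<close> collect
  everything else. With one block only, the distances \<open>r - k\<close> and \<open>r + k\<close>
  left by integrating \<open>u1\<close> would be functions of \<open>r\<close> alone, and
  \<open>k - r\<close> could have a double zero. The term in \<open>v1\<close> inside
  \<open>k\<close> makes both affine in a fresh cosine.\<close>

lemma two_block_moment:
  "(\<integral>\<^sup>+v2. \<integral>\<^sup>+u2. \<integral>\<^sup>+v1. \<integral>\<^sup>+u1. inv_powr p ((cmod (cis (t * u1) + (cis (t * u2) + w)))\<^sup>2 / 2
      + (cmod (cis (t * v1) + (cis (t * v2) + w')))\<^sup>2 / 2 + c) \<partial>D \<partial>D \<partial>D \<partial>D) \<le> 2 * (2 * C) ^ 4"
proof -
  let ?i = "inv_powr (p / 2)"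
  \<comment> \<open>\<open>u1\<close> is integrated at exponent \<open>p\<close>, then
    \<open>v1\<close> at exponent \<open>p / 2\<close>. What remains are the moduli of the rests of
    the two blocks at exponent \<open>p / 2\<close>, one depending on \<open>u2\<close> and the
    other on \<open>v2\<close>, so the outer integrals separate.\<close>
  have inner: "(\<integral>\<^sup>+v1. \<integral>\<^sup>+u1. inv_powr p ((cmod (cis (t * u1) + z))\<^sup>2 / 2
      + (cmod (cis (t * v1) + z'))\<^sup>2 / 2 + c) \<partial>D \<partial>D) \<le> 2 * (2 * C)\<^sup>2 * (?i (cmod z) * ?i (cmod z'))" for z z'
  proof -
    define r where "r = cmod z"
    define r' where "r' = cmod z'"
    define k where "k v = (1 + r\<^sup>2) / 2 + c + (cmod (cis (t * v) + z'))\<^sup>2 / 2" for v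
    have kv: "k v = (1 + r\<^sup>2) / 2 + c + ((1 + r'\<^sup>2) / 2 + r' * cos (t * v + - Arg z'))" for v
      unfolding k_def half_square_cmod_cis_add by (simp add: r'_def)
    have [measurable]: "k \<in> borel_measurable borel"
      unfolding k_def cmod_power2 by (simp add: cis.sel) measurable
    have "(\<integral>\<^sup>+u1. inv_powr p ((cmod (cis (t * u1) + z))\<^sup>2 / 2 + (cmod (cis (t * v) + z'))\<^sup>2 / 2 + c) \<partial>D)
        \<le> ?i r * (?i (r - k v) + ?i (r + k v)) * (2 * C)" for v
    proof -
      have "(\<integral>\<^sup>+u1. inv_powr p ((cmod (cis (t * u1) + z))\<^sup>2 / 2 + (cmod (cis (t * v) + z'))\<^sup>2 / 2 + c) \<partial>D)
         = (\<integral>\<^sup>+u1. inv_powr p (k v + r * cos (t * u1 + - Arg z)) \<partial>D)"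
        by (intro nn_integral_cong, subst half_square_cmod_cis_add[of _ z]) (simp add: k_def r_def algebra_simps)
      also have "\<dots> \<le> ?i r * (?i (r - k v) + ?i (r + k v)) * (2 * C)"
        by (rule affine_cos_moment) (simp add: r_def)
      finally show ?thesis .
    qed
    then have "(\<integral>\<^sup>+v1. \<integral>\<^sup>+u1. inv_powr p ((cmod (cis (t * u1) + z))\<^sup>2 / 2
        + (cmod (cis (t * v1) + z'))\<^sup>2 / 2 + c) \<partial>D \<partial>D)
      \<le> (\<integral>\<^sup>+v. (2 * C * ?i r) * (?i (r - k v) + ?i (r + k v)) \<partial>D)"
      by (intro nn_integral_mono) (simp add: mult_ac)
    also have "\<dots> = (2 * C * ?i r) * ((\<integral>\<^sup>+v. ?i (r - k v) \<partial>D) + (\<integral>\<^sup>+v. ?i (r + k v) \<partial>D))"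
      by (subst nn_integral_cmult, measurable, subst nn_integral_add) measurable
    also have "\<dots> \<le> (2 * C * ?i r) * (?i r' * (2 * C) + ?i r' * (2 * C))"
    proof (intro mult_left_mono add_mono)
      have "(\<integral>\<^sup>+v. ?i (r - k v) \<partial>D) = (\<integral>\<^sup>+v. ?i (((1 + r\<^sup>2) / 2 + c - r + (1 + r'\<^sup>2) / 2) + r' * cos (t * v + - Arg z')) \<partial>D)"
        by (intro nn_integral_cong, subst inv_powr_uminus[symmetric])
           (simp add: kv algebra_simps)
      also have "\<dots> \<le> ?i r' * (2 * C)" by (rule affine_cos_half_moment) (simp add: r'_def)
      finally show "(\<integral>\<^sup>+v. ?i (r - k v) \<partial>D) \<le> ?i r' * (2 * C)" .
      have "(\<integral>\<^sup>+v. ?i (r + k v) \<partial>D) = (\<integral>\<^sup>+v. ?i (((1 + r\<^sup>2) / 2 + c + r + (1 + r'\<^sup>2) / 2) + r' * cos (t * v + - Arg z')) \<partial>D)"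
        by (intro nn_integral_cong)
           (simp add: kv algebra_simps)
      also have "\<dots> \<le> ?i r' * (2 * C)" by (rule affine_cos_half_moment) (simp add: r'_def)
      finally show "(\<integral>\<^sup>+v. ?i (r + k v) \<partial>D) \<le> ?i r' * (2 * C)" .
    qed auto
    also have "\<dots> = 2 * (2 * C)\<^sup>2 * (?i r * ?i r')"
      by (simp add: power2_eq_square mult_ac flip: mult_2)
    finally show ?thesis by (simp add: r_def r'_def)
  qed
  have [measurable]: "(\<lambda>v. ?i (cmod (cis (t * v) + y))) \<in> borel_measurable borel" for y
  proof -
    have "(\<lambda>v. cmod (cis (t * v) + y)) \<in> borel_measurable borel"
      by (intro borel_measurable_continuous_onI continuous_intros)
    then show ?thesis by measurable
  qed
  have "(\<integral>\<^sup>+v2. \<integral>\<^sup>+u2. \<integral>\<^sup>+v1. \<integral>\<^sup>+u1. inv_powr p ((cmod (cis (t * u1) + (cis (t * u2) + w)))\<^sup>2 / 2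
      + (cmod (cis (t * v1) + (cis (t * v2) + w')))\<^sup>2 / 2 + c) \<partial>D \<partial>D \<partial>D \<partial>D)
     \<le> (\<integral>\<^sup>+v2. \<integral>\<^sup>+u2. 2 * (2 * C)\<^sup>2 * ?i (cmod (cis (t * v2) + w')) * ?i (cmod (cis (t * u2) + w)) \<partial>D \<partial>D)"
    by (intro nn_integral_mono order_trans[OF inner]) (simp add: mult_ac)
  also have "\<dots> \<le> (\<integral>\<^sup>+v2. 2 * (2 * C)\<^sup>2 * ?i (cmod (cis (t * v2) + w')) * (2 * C) \<partial>D)"
  proof (intro nn_integral_mono)
    fix v2
    show "(\<integral>\<^sup>+u2. 2 * (2 * C)\<^sup>2 * ?i (cmod (cis (t * v2) + w')) * ?i (cmod (cis (t * u2) + w)) \<partial>D)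
       \<le> 2 * (2 * C)\<^sup>2 * ?i (cmod (cis (t * v2) + w')) * (2 * C)"
      by (subst nn_integral_cmult) (measurable, intro mult_left_mono cis_add_half_moment, auto)
  qed
  also have "\<dots> = (2 * (2 * C)\<^sup>2 * (2 * C)) * (\<integral>\<^sup>+v2. ?i (cmod (cis (t * v2) + w')) \<partial>D)"
    by (subst nn_integral_cmult[symmetric]) (measurable, simp add: mult_ac)
  also have "\<dots> \<le> (2 * (2 * C)\<^sup>2 * (2 * C)) * (2 * C)"
    by (intro mult_left_mono cis_add_half_moment) auto
  also have "\<dots> = 2 * (2 * C) ^ 4" by (simp add: power2_eq_square power4_eq_xxxx mult_ac)
  finally show ?thesis .
qed

end

section \<open>Negative moments from the decay of the characteristic function\<close>

lemma sum_powr_le: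
  fixes a :: real
  assumes "0 < a" "a < 1"
  shows "(\<Sum>d=1..m. real d powr - a) \<le> real m powr (1 - a) / (1 - a)"
proof (induction m)
  case (Suc m)
  have "real (Suc m) powr - a \<le> (real (Suc m) powr (1 - a) - real m powr (1 - a)) / (1 - a)"
  proof (cases "m = 0")
    case True
    then show ?thesis using assms by (simp add: field_simps)
  next
    case False
    have "\<exists>z>real m. z < real (Suc m) \<and>
        real (Suc m) powr (1 - a) - real m powr (1 - a) = (real (Suc m) - real m) * ((1 - a) * z powr - a)"
    proof (rule MVT2)
      fix x assume "real m \<le> x"
      then have "x > 0" using False by simp
      then show "((\<lambda>x. x powr (1 - a)) has_real_derivative (1 - a) * x powr - a) (at x)"
        by (auto intro!: derivative_eq_intros)
    qed simp
    then obtain z where z: "real m < z" "z < real (Suc m)"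
      "real (Suc m) powr (1 - a) - real m powr (1 - a) = (1 - a) * z powr - a" by auto
    have "real (Suc m) powr - a \<le> z powr - a"
      using z assms by (intro powr_mono2') auto
    then show ?thesis unfolding z(3) using assms by simp
  qed
  with Suc show ?case by (simp add: diff_divide_distrib)
qed simp

text \<open>The distance of \<open>cis (k * x)\<close> from 1 is at most \<open>k\<close> times that
  of \<open>cis x\<close>, which is \<open>2 * \<bar>sin (x / 2)\<bar>\<close>; on this arc all
  \<open>m\<close> terms lie within 1/2 of 1. The squared modulus of the sum is \<open>m\<close>
  times a Fejer kernel.\<close>

lemma cmod_sum_cis_ge:
  assumes "\<bar>sin (x / 2)\<bar> \<le> 1 / (4 * real m)" "m > 0"
  shows "cmod (\<Sum>k<m. cis (real k * x)) \<ge> real m / 2"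
proof -
  have c: "cmod (cis x - 1) = 2 * \<bar>sin (x / 2)\<bar>"
    using dist_exp_i_1[of x] by (simp add: cis_conv_exp)
  have "cmod (\<Sum>k<m. cis (real k * x) - 1) \<le> (\<Sum>k<m. 1 / 2)"
  proof (intro order_trans[OF norm_sum] sum_mono)
    fix k assume "k \<in> {..<m}"
    have "cmod (cis (real k * x) - 1) = cmod (cis x ^ k - 1 ^ k)" by (simp only: Complex.DeMoivre power_one)
    also have "\<dots> \<le> real k * cmod (cis x - 1)" by (intro norm_power_diff) auto
    also have "\<dots> \<le> real m * (2 * (1 / (4 * real m)))"
      unfolding c using \<open>k \<in> _\<close> assms by (intro mult_mono) auto
    also have "\<dots> = 1 / 2" using assms by simp
    finally show "cmod (cis (real k * x) - 1) \<le> 1 / 2" .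
  qed
  then have "cmod ((\<Sum>k<m. cis (real k * x)) - of_nat m) \<le> real m / 2" by (simp add: sum_subtractf)
  moreover have "real m \<le> cmod (\<Sum>k<m. cis (real k * x)) + cmod ((\<Sum>k<m. cis (real k * x)) - of_nat m)"
    using norm_triangle_sub[of "of_nat m :: complex" "\<Sum>k<m. cis (real k * x)"]
    by (simp add: norm_minus_commute)
  ultimately show ?thesis by simp
qed

text \<open>A layer decomposition over dyadic scales. The thresholds are \<open>1 / (4 * m)\<close>
  for \<open>m = 2 ^ i\<close>, the arcs of \<open>cmod_sum_cis_ge\<close>. At \<open>z = 0\<close>
  all indicators are 1, and the divergent series matches the infinite left-hand side.\<close>

lemma inv_powr_le_dyadic:
  fixes p z :: real
  assumes "p > 0"
  shows "inv_powr p z \<le> ennreal (4 powr p)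
    + (\<Sum>i. ennreal (2 powr (p * real (i + 3))) * indicator {x. \<bar>x\<bar> \<le> 1 / (4 * 2 ^ i)} z)"
proof -
  let ?f = "\<lambda>i. ennreal (2 powr (p * real (i + 3))) * indicator {x. \<bar>x\<bar> \<le> 1 / (4 * 2 ^ i)} z :: ennreal"
  consider "z = 0" | "\<bar>z\<bar> > 1 / 4" | "z \<noteq> 0" "\<bar>z\<bar> \<le> 1 / 4" by fastforce
  then show ?thesis
  proof cases
    case 1
    have "of_nat n \<le> (\<Sum>i. ?f i)" for n
    proof -
      have "of_nat n = (\<Sum>i<n. 1 :: ennreal)" by simp
      also have "\<dots> \<le> (\<Sum>i<n. ?f i)"
      proof (intro sum_mono)
        fix i
        have "ennreal 1 \<le> ennreal (2 powr (p * real (i + 3)))"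
          using assms by (intro ennreal_leI ge_one_powr_ge_zero) auto
        moreover have "?f i = ennreal (2 powr (p * real (i + 3)))" using 1 by (simp del: of_nat_add)
        ultimately show "1 \<le> ?f i" by (simp only: ennreal_1)
      qed
      also have "\<dots> \<le> (\<Sum>i. ?f i)" by (intro sum_le_suminf) auto
      finally show ?thesis .
    qed
    then have "\<not> (\<Sum>i. ?f i) < top"
      using ennreal_Ex_less_of_nat[of "\<Sum>i. ?f i"] by (auto simp: not_less[symmetric])
    then have "(\<Sum>i. ?f i) = top" by (simp only: less_top[symmetric] not_not)
    then show ?thesis by (simp add: top_greatest)
  next
    case 2
    then have "inv_powr p z \<le> inv_powr p (1 / 4)" using assms by (intro inv_powr_antimono) auto
    also have "\<dots> = ennreal (4 powr p)" by (simp add: inv_powr_def inverse_ennreal powr_divide)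
    finally show ?thesis by (rule order_trans) simp
  next
    case 3
    have "(\<lambda>i. 1 / (4 * 2 ^ i) :: real) \<longlonglongrightarrow> 0"
      by real_asymp
    then have "eventually (\<lambda>i. 1 / (4 * 2 ^ i) < \<bar>z\<bar>) sequentially"
      using 3 by (intro order_tendstoD) auto
    then obtain i0 where "1 / (4 * 2 ^ i0) < \<bar>z\<bar>" by (auto simp: eventually_sequentially)
    \<comment> \<open>\<open>k\<close> is the first scale below \<open>\<bar>z\<bar>\<close>, so the
      indicator of \<open>i = k - 1\<close> is still 1. Its coefficient is
      \<open>1 / (4 * 2 ^ k) = 2 powr - (i + 3)\<close> raised to the power \<open>- p\<close>,
      hence the shift by 3.\<close>
    define k where "k = (LEAST i. 1 / (4 * 2 ^ i) < \<bar>z\<bar>)"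
    have k1: "1 / (4 * 2 ^ k) < \<bar>z\<bar>"
      unfolding k_def by (rule LeastI) fact
    have k2: "\<bar>z\<bar> \<le> 1 / (4 * 2 ^ i)" if "i < k" for i
      using not_less_Least[OF that[unfolded k_def]] by (simp only: not_less)
    have "k \<noteq> 0" using k1 3 by (intro notI) simp
    then obtain i where i: "k = Suc i" by (cases k) auto
    have "inv_powr p z \<le> inv_powr p (1 / (4 * 2 ^ k))"
      using k1 assms by (intro inv_powr_antimono) auto
    also have "1 / (4 * 2 ^ k) = (2 :: real) powr - real (i + 3)"
    proof -
      have "(2 :: real) powr - real (i + 3) = inverse (2 ^ (i + 3))"
        by (simp only: powr_minus powr_realpow[OF zero_less_numeral])
      then show ?thesis by (simp add: i power_add field_simps)
    qed
    also have "inv_powr p \<dots> = ennreal (2 powr (p * real (i + 3)))"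
    proof -
      have "inverse ((2 powr - real (i + 3)) powr p) = (2 :: real) powr (p * real (i + 3))"
        by (simp only: powr_powr powr_minus[symmetric]) (simp add: algebra_simps)
      then show ?thesis by (simp add: inv_powr_def inverse_ennreal)
    qed
    also have "\<dots> = ?f i" using k2[of i] i by (simp del: of_nat_add)
    also have "\<dots> \<le> (\<Sum>i. ?f i)"
    proof -
      have "sum ?f {i} \<le> (\<Sum>i. ?f i)" by (intro sum_le_suminf) auto
      then show ?thesis
        by (simp only: sum.insert finite.emptyI empty_iff sum.empty add_0_right not_False_eq_True)
    qed
    finally show ?thesis by (rule order_trans) simp
  qed
qed

text \<open>A row sum of a Toeplitz matrix: on either side of the diagonal the differences are
  distinct and below \<open>m\<close>.\<close>

lemma sum_abs_diff_le:
  fixes b :: "nat \<Rightarrow> real"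
  assumes "\<And>d. 0 \<le> b d" "k < m"
  shows "(\<Sum>l<m. b (if l \<le> k then k - l else l - k)) \<le> 2 * (\<Sum>d<m. b d)"
proof -
  have "(\<Sum>l<m. b (if l \<le> k then k - l else l - k)) = (\<Sum>l\<le>k. b (k - l)) + (\<Sum>l\<in>{k<..<m}. b (l - k))"
  proof -
    have eq: "{..<m} = {..k} \<union> {k<..<m}" using assms by auto
    show ?thesis unfolding eq by (subst sum.union_disjoint) auto
  qed
  also have "(\<Sum>l\<le>k. b (k - l)) = (\<Sum>d\<le>k. b d)"
    by (rule sum.reindex_bij_witness[of _ "\<lambda>d. k - d" "\<lambda>l. k - l"]) auto
  also have "\<dots> \<le> (\<Sum>d<m. b d)"
    using assms by (intro sum_mono2) auto
  also have "(\<Sum>l\<in>{k<..<m}. b (l - k)) = sum b ((\<lambda>l. l - k) ` {k<..<m})"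
    by (subst sum.reindex) (auto simp: inj_on_def)
  also have "\<dots> \<le> (\<Sum>d<m. b d)"
    using assms by (intro sum_mono2) auto
  finally show ?thesis by simp
qed

section \<open>Small-ball bounds from the Fejer kernel\<close>

context real_distribution
begin

text \<open>Expanding the square produces the characteristic function at multiples of
  \<open>t\<close>; the phases caused by \<phi> have modulus 1 and disappear under the norm.\<close>

lemma integral_cmod_sum_cis_le:
  "(\<integral>u. (cmod (\<Sum>k<m. cis (real k * (t * u - \<phi>))))\<^sup>2 \<partial>M)
    \<le> (\<Sum>k<m. \<Sum>l<m. cmod (char M (t * (real k - real l))))"
proof -
  let ?S = "\<lambda>u. \<Sum>k<m. cis (real k * (t * u - \<phi>))"
  define e where "e s u = iexp (s * u)" for s u :: real
  have int: "integrable M (e s)" for s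
    unfolding e_def by (intro integrable_const_bound[where B=1]) auto
  have S: "complex_of_real ((cmod (?S u))\<^sup>2)
      = (\<Sum>k<m. \<Sum>l<m. cis (- ((real k - real l) * \<phi>)) * e (t * (real k - real l)) u)" for u
    unfolding complex_norm_square sum_product cnj_sum e_def
    by (intro sum.cong refl) (simp only: cis_conv_exp[symmetric] cis_cnj cis_mult, intro arg_cong[where f=cis], simp add: algebra_simps)
  have "complex_of_real (\<integral>u. (cmod (?S u))\<^sup>2 \<partial>M) = (\<integral>u. complex_of_real ((cmod (?S u))\<^sup>2) \<partial>M)"
    by (rule integral_complex_of_real[symmetric])
  also have "\<dots> = (\<Sum>k<m. \<Sum>l<m. cis (- ((real k - real l) * \<phi>)) * char M (t * (real k - real l)))"
  proof -
    have "integrable M (\<lambda>u. cis c * e s u)" for c s by (intro integrable_mult_right int)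
    then show ?thesis
      unfolding S char_def e_def[symmetric]
      by (simp only: Bochner_Integration.integral_sum Bochner_Integration.integrable_sum integral_mult_right_zero)
  qed
  finally have "cmod (complex_of_real (\<integral>u. (cmod (?S u))\<^sup>2 \<partial>M))
      = cmod (\<Sum>k<m. \<Sum>l<m. cis (- ((real k - real l) * \<phi>)) * char M (t * (real k - real l)))"
    by (rule arg_cong)
  then have "\<bar>\<integral>u. (cmod (?S u))\<^sup>2 \<partial>M\<bar>
      = cmod (\<Sum>k<m. \<Sum>l<m. cis (- ((real k - real l) * \<phi>)) * char M (t * (real k - real l)))"
    by (simp only: norm_of_real)
  also have "\<dots> \<le> (\<Sum>k<m. \<Sum>l<m. cmod (char M (t * (real k - real l))))"
    by (intro sum_norm_le order_trans[OF norm_sum] sum_mono) (simp add: norm_mult)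
  finally show ?thesis by linarith
qed

text \<open>Chebyshev's inequality for the squared trigonometric sum: it is at least
  \<open>(m / 2)^2\<close> on the event, while its mean is at most \<open>2 * m\<close> times a sum
  of bounds \<open>b d\<close> for the characteristic function at \<open>t * d\<close>, which is of
  order \<open>m powr (1 - a)\<close>.\<close>

lemma emeasure_small_sin_le:
  assumes a: "0 < a" "a < 1" and B: "B \<ge> 0"
    and char_le: "\<And>s. cmod (char M s) \<le> B * (1 + \<bar>s\<bar>) powr - a"
    and t: "t \<noteq> 0" and m: "m > 0"
  shows "emeasure M {u. \<bar>sin ((t * u - \<phi>) / 2)\<bar> \<le> 1 / (4 * real m)}
    \<le> ennreal (8 * (1 + B / (1 - a)) * (1 + 1 / \<bar>t\<bar>) * real m powr - a)"
proof -
  let ?S = "\<lambda>u. \<Sum>k<m. cis (real k * (t * u - \<phi>))"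
  let ?A = "{u. \<bar>sin ((t * u - \<phi>) / 2)\<bar> \<le> 1 / (4 * real m)}"
  \<comment> \<open>A majorant of \<open>\<bar>t\<bar> powr - a\<close> for small and large
    \<open>t\<close> alike; being at least 1, it also absorbs the diagonal term
    \<open>b 0 = 1\<close>.\<close>
  define \<kappa> where "\<kappa> = 1 + 1 / \<bar>t\<bar>"
  have kap: "\<bar>t\<bar> powr - a \<le> \<kappa>" "\<kappa> \<ge> 1"
  proof -
    show "\<kappa> \<ge> 1" by (simp add: \<kappa>_def)
    show "\<bar>t\<bar> powr - a \<le> \<kappa>"
    proof (cases "\<bar>t\<bar> \<ge> 1")
      case True
      then have "\<bar>t\<bar> powr - a \<le> 1" using a t powr_mono[of "-a" 0 "\<bar>t\<bar>"] by simp
      then show ?thesis by (simp add: \<kappa>_def add_increasing2)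
    next
      case False
      then have "\<bar>t\<bar> powr - a \<le> \<bar>t\<bar> powr - 1" using a t by (intro powr_mono') auto
      also have "\<dots> = 1 / \<bar>t\<bar>" using t by (simp add: powr_minus divide_inverse)
      finally show ?thesis by (simp add: \<kappa>_def)
    qed
  qed
  define b where "b d = (if d = 0 then 1 else B * \<kappa> * real d powr - a)" for d :: nat
  have b: "cmod (char M (t * (real k - real l))) \<le> b (if l \<le> k then k - l else l - k)" for k l
  proof (cases "k = l")
    case True
    then show ?thesis by (simp add: b_def cmod_char_le_1)
  next
    case False
    define d where "d = (if l \<le> k then k - l else l - k)"
    have d: "d > 0" "\<bar>real k - real l\<bar> = real d" using False by (auto simp: d_def)
    have "cmod (char M (t * (real k - real l))) \<le> B * (1 + \<bar>t\<bar> * real d) powr - a"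
      using char_le[of "t * (real k - real l)"] by (simp add: abs_mult d)
    also have "\<dots> \<le> B * (\<bar>t\<bar> * real d) powr - a"
      using B a t d by (intro mult_left_mono powr_mono2') auto
    also have "\<dots> = B * (\<bar>t\<bar> powr - a * real d powr - a)" by (simp add: powr_mult)
    also have "\<dots> \<le> B * (\<kappa> * real d powr - a)"
      using B kap by (intro mult_left_mono mult_right_mono) auto
    finally show ?thesis using d by (simp add: b_def d_def mult_ac)
  qed
  have bsum: "(\<Sum>d<m. b d) \<le> \<kappa> * (1 + B / (1 - a)) * real m powr (1 - a)"
  proof -
    obtain m' where m': "m = Suc m'" using m by (cases m) auto
    have "(\<Sum>d<m. b d) = 1 + (\<Sum>d=1..m'. B * \<kappa> * real d powr - a)"
      unfolding m' lessThan_Suc_atMost atLeast0AtMost[symmetric]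
      by (subst sum.atLeast_Suc_atMost) (auto simp: b_def intro!: sum.cong)
    also have "(\<Sum>d=1..m'. B * \<kappa> * real d powr - a) \<le> B * \<kappa> * (real m' powr (1 - a) / (1 - a))"
      unfolding sum_distrib_left[symmetric]
      using B kap a by (intro mult_left_mono sum_powr_le) auto
    also have "\<dots> \<le> B * \<kappa> * (real m powr (1 - a) / (1 - a))"
      using B kap a by (intro mult_left_mono divide_right_mono powr_mono2) (auto simp: m')
    finally have "(\<Sum>d<m. b d) \<le> 1 + B * \<kappa> * (real m powr (1 - a) / (1 - a))" by simp
    moreover have "1 \<le> \<kappa> * real m powr (1 - a)"
      using kap m a mult_mono[of 1 \<kappa> 1 "real m powr (1 - a)"] by (simp add: ge_one_powr_ge_zero)
    moreover have "\<kappa> * (1 + B / (1 - a)) * real m powr (1 - a)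
        = \<kappa> * real m powr (1 - a) + B * \<kappa> * (real m powr (1 - a) / (1 - a))"
      by (simp add: distrib_left distrib_right)
    ultimately show ?thesis by linarith
  qed
  have [measurable]: "?S \<in> borel_measurable borel"
    by (intro borel_measurable_continuous_onI continuous_intros)
  have Sm: "cmod (?S u) \<le> real m" for u
    by (rule order_trans[OF norm_sum]) simp
  have "(real m / 2)\<^sup>2 * prob ?A = (\<integral>u. (real m / 2)\<^sup>2 * indicator ?A u \<partial>M)"
    by simp
  also have "\<dots> \<le> (\<integral>u. (cmod (?S u))\<^sup>2 \<partial>M)"
  proof (intro integral_mono)
    show "integrable M (\<lambda>u. (real m / 2)\<^sup>2 * indicator ?A u)"
      by (intro integrable_const_bound[where B="(real m / 2)\<^sup>2"]) (auto simp: indicator_def)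
    show "integrable M (\<lambda>u. (cmod (?S u))\<^sup>2)"
      using Sm by (intro integrable_const_bound[where B="(real m)\<^sup>2"]) (auto intro!: power_mono)
    fix u
    show "(real m / 2)\<^sup>2 * indicator ?A u \<le> (cmod (?S u))\<^sup>2"
      using cmod_sum_cis_ge[of "t * u - \<phi>" m] m
      by (auto simp: indicator_def simp del: power_divide intro!: power_mono)
  qed
  also have "\<dots> \<le> (\<Sum>k<m. \<Sum>l<m. cmod (char M (t * (real k - real l))))"
    by (rule integral_cmod_sum_cis_le)
  also have "\<dots> \<le> (\<Sum>k<m. \<Sum>l<m. b (if l \<le> k then k - l else l - k))"
    by (intro sum_mono b)
  also have "\<dots> \<le> (\<Sum>k<m. 2 * (\<Sum>d<m. b d))"
    using B kap by (intro sum_mono sum_abs_diff_le) (auto simp: b_def)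
  also have "\<dots> = 2 * real m * (\<Sum>d<m. b d)" by simp
  also have "\<dots> \<le> 2 * real m * (\<kappa> * (1 + B / (1 - a)) * real m powr (1 - a))"
    by (intro mult_left_mono bsum) auto
  also have "\<dots> = (real m / 2)\<^sup>2 * (8 * (1 + B / (1 - a)) * \<kappa> * real m powr - a)"
    using m by (simp add: power2_eq_square powr_diff powr_minus field_simps)
  finally have "prob ?A \<le> 8 * (1 + B / (1 - a)) * \<kappa> * real m powr - a"
    using m by (subst (asm) mult_le_cancel_left_pos) auto
  then show ?thesis
    by (simp add: emeasure_eq_measure \<kappa>_def ennreal_leI)
qed

text \<open>At scale \<open>i\<close> the weight grows like \<open>2 powr (p * i)\<close> and the
  small-ball mass decays like \<open>2 powr (- a * i)\<close>. The geometric series of ratio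
  \<open>2 powr (p - a)\<close> converges since \<open>p < a\<close>; the factor
  \<open>8 powr p\<close> is the shift by 3 in the dyadic weights.\<close>

lemma sin_inverse_moment_le:
  assumes a: "0 < p" "p < a" "a < 1" and B: "B \<ge> 0"
    and char_le: "\<And>s. cmod (char M s) \<le> B * (1 + \<bar>s\<bar>) powr - a"
    and t: "t \<noteq> 0"
  shows "(\<integral>\<^sup>+u. inv_powr p (sin ((t * u - \<phi>) / 2)) \<partial>M)
    \<le> ennreal ((4 powr p + 8 * (1 + B / (1 - a)) * (8 powr p / (1 - 2 powr (p - a)))) * (1 + 1 / \<bar>t\<bar>))"
proof -
  define \<kappa> where "\<kappa> = 1 + 1 / \<bar>t\<bar>"
  define Q where "Q = 8 * (1 + B / (1 - a)) * \<kappa>"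
  have kap: "\<kappa> \<ge> 1" and Q: "Q \<ge> 0" using a B by (auto simp: \<kappa>_def Q_def)
  let ?z = "\<lambda>u. sin ((t * u - \<phi>) / 2)"
  have "(\<integral>\<^sup>+u. inv_powr p (?z u) \<partial>M) \<le> (\<integral>\<^sup>+u. ennreal (4 powr p)
      + (\<Sum>i. ennreal (2 powr (p * real (i + 3))) * indicator {x. \<bar>x\<bar> \<le> 1 / (4 * 2 ^ i)} (?z u)) \<partial>M)"
    using a by (intro nn_integral_mono inv_powr_le_dyadic)
  also have "\<dots> = ennreal (4 powr p) + (\<integral>\<^sup>+u. (\<Sum>i. ennreal (2 powr (p * real (i + 3))) * indicator {x. \<bar>x\<bar> \<le> 1 / (4 * 2 ^ i)} (?z u)) \<partial>M)"
    by (subst nn_integral_add) (auto simp: emeasure_space_1[simplified])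
  also have "(\<integral>\<^sup>+u. (\<Sum>i. ennreal (2 powr (p * real (i + 3))) * indicator {x. \<bar>x\<bar> \<le> 1 / (4 * 2 ^ i)} (?z u)) \<partial>M)
      = (\<Sum>i. ennreal (2 powr (p * real (i + 3))) * (\<integral>\<^sup>+u. indicator {x. \<bar>x\<bar> \<le> 1 / (4 * 2 ^ i)} (?z u) \<partial>M))"
    by (subst nn_integral_suminf) (auto intro!: arg_cong[where f=suminf] nn_integral_cmult)
  also have "\<dots> \<le> (\<Sum>i. ennreal (8 powr p * Q * (2 powr (p - a)) ^ i))"
  proof (intro suminf_le allI)
    fix i
    have "(\<integral>\<^sup>+u. indicator {x. \<bar>x\<bar> \<le> 1 / (4 * 2 ^ i)} (?z u) \<partial>M)
        = (\<integral>\<^sup>+u. indicator {u. \<bar>?z u\<bar> \<le> 1 / (4 * real (2 ^ i))} u \<partial>M)"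
      by (intro nn_integral_cong) (simp add: indicator_def)
    also have "\<dots> = emeasure M {u. \<bar>?z u\<bar> \<le> 1 / (4 * real (2 ^ i))}"
      by (rule nn_integral_indicator) simp
    also have "\<dots> \<le> ennreal (Q * real (2 ^ i) powr - a)"
      unfolding Q_def \<kappa>_def using a B char_le t by (intro emeasure_small_sin_le) auto
    finally have "ennreal (2 powr (p * real (i + 3))) * (\<integral>\<^sup>+u. indicator {x. \<bar>x\<bar> \<le> 1 / (4 * 2 ^ i)} (?z u) \<partial>M)
       \<le> ennreal (2 powr (p * real (i + 3))) * ennreal (Q * real (2 ^ i) powr - a)"
      by (intro mult_left_mono) auto
    also have "\<dots> = ennreal (2 powr (p * real (i + 3)) * (Q * real (2 ^ i) powr - a))"
      using Q by (simp add: ennreal_mult)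
    also have "2 powr (p * real (i + 3)) * (Q * real (2 ^ i) powr - a) = 8 powr p * Q * (2 powr (p - a)) ^ i"
    proof -
      have e: "(8 :: real) = 2 powr 3" by simp
      have "real (2 ^ i) = 2 powr real i" by (simp add: powr_realpow)
      then have "2 powr (p * real (i + 3)) * real (2 ^ i) powr - a = 2 powr (3 * p + (p - a) * real i)"
        by (simp add: powr_powr powr_add[symmetric] algebra_simps)
      also have "\<dots> = 8 powr p * (2 powr (p - a)) ^ i"
        unfolding e by (simp only: powr_powr powr_add) (simp add: powr_realpow[symmetric] powr_powr)
      finally show ?thesis by (simp add: mult_ac)
    qed
    finally show "ennreal (2 powr (p * real (i + 3))) * (\<integral>\<^sup>+u. indicator {x. \<bar>x\<bar> \<le> 1 / (4 * 2 ^ i)} (?z u) \<partial>M)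
       \<le> ennreal (8 powr p * Q * (2 powr (p - a)) ^ i)" .
  qed auto
  also have "\<dots> = ennreal (8 powr p * Q * (1 / (1 - 2 powr (p - a))))"
  proof (rule suminf_ennreal_eq)
    have "2 powr (p - a) < (2 :: real) powr 0" using a by (intro powr_less_mono) auto
    then show "(\<lambda>i. 8 powr p * Q * (2 powr (p - a)) ^ i) sums (8 powr p * Q * (1 / (1 - 2 powr (p - a))))"
      by (intro sums_mult geometric_sums) auto
  qed (use Q in auto)
  finally have "(\<integral>\<^sup>+u. inv_powr p (?z u) \<partial>M) \<le> ennreal (4 powr p) + ennreal (8 powr p * Q * (1 / (1 - 2 powr (p - a))))"
    by (auto intro: order_trans add_left_mono)
  also have "\<dots> = ennreal (4 powr p + 8 powr p * Q * (1 / (1 - 2 powr (p - a))))"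
  proof (rule ennreal_plus[symmetric])
    have "2 powr (p - a) < (2 :: real) powr 0" using a by (intro powr_less_mono) auto
    then show "0 \<le> 8 powr p * Q * (1 / (1 - 2 powr (p - a)))" using Q by simp
  qed simp
  also have "\<dots> \<le> ennreal ((4 powr p + 8 * (1 + B / (1 - a)) * (8 powr p / (1 - 2 powr (p - a)))) * \<kappa>)"
  proof (rule ennreal_leI)
    have "4 powr p * 1 \<le> 4 powr p * \<kappa>" using kap by (intro mult_left_mono) auto
    moreover have "8 powr p * Q * (1 / (1 - 2 powr (p - a)))
        = 8 * (1 + B / (1 - a)) * (8 powr p / (1 - 2 powr (p - a))) * \<kappa>"
      by (simp add: Q_def)
    ultimately show "4 powr p + 8 powr p * Q * (1 / (1 - 2 powr (p - a)))
      \<le> (4 powr p + 8 * (1 + B / (1 - a)) * (8 powr p / (1 - 2 powr (p - a)))) * \<kappa>"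
      by (simp only: distrib_right)
  qed
  finally show ?thesis by (simp add: \<kappa>_def)
qed

end

section \<open>The replicated-measurements model\<close>

lemma prob_density_real_distribution:
  assumes "prob_density f"
  shows "real_distribution (density lborel (\<lambda>x. ennreal (f x)))"
proof (intro real_distribution.intro prob_spaceI real_distribution_axioms.intro)
  have "(\<integral>\<^sup>+x. ennreal (f x) \<partial>lborel) = ennreal (\<integral>x. f x \<partial>lborel)"
    using assms by (intro nn_integral_eq_integral) (auto simp: prob_density_def)
  then show "emeasure (density lborel (\<lambda>x. ennreal (f x))) (space (density lborel (\<lambda>x. ennreal (f x)))) = 1"
    using assms by (simp add: emeasure_density prob_density_def)
qed simp

lemma char_density_eq_FT:
  assumes "prob_density f"
  shows "char (density lborel (\<lambda>x. ennreal (f x))) = FT f"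
proof
  fix t
  have [measurable]: "f \<in> borel_measurable borel" and "AE x in lborel. 0 \<le> f x"
    using assms by (auto simp: prob_density_def)
  then show "char (density lborel (\<lambda>x. ennreal (f x))) t = FT f t"
    unfolding char_def FT_def by (subst integral_density) (auto simp: scaleR_conv_of_real mult.commute)
qed

lemma measurable_FT [measurable]:
  assumes "integrable lborel f"
  shows "FT f \<in> borel_measurable borel"
proof -
  have [measurable]: "f \<in> borel_measurable borel" using assms by auto
  show ?thesis unfolding FT_def [abs_def] by measurable
qed

lemma FT_minus: "FT f (- t) = cnj (FT f t)"
  unfolding FT_def
  by (subst Bochner_Integration.integral_cnj[symmetric])
    (auto intro!: Bochner_Integration.integral_cong simp: exp_cnj)

section \<open>Block sums and the pair average\<close>

definition block_sum :: "(nat \<Rightarrow> nat) \<Rightarrow> nat \<Rightarrow> real \<Rightarrow> (nat \<Rightarrow> nat \<Rightarrow> real) \<Rightarrow> complex" where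
  "block_sum N j t w = (\<Sum>k=1..N j. cis (t * w j k))"

text \<open>This is \<open>V(t)\<close> of the overview. Squared moduli of block sums display both
  features needed: independent summands over blocks, and a cosine in each single error.\<close>

definition pair_avg :: "(nat \<Rightarrow> nat) \<Rightarrow> nat \<Rightarrow> real \<Rightarrow> (nat \<Rightarrow> nat \<Rightarrow> real) \<Rightarrow> real" where
  "pair_avg N n t w = (1 / num_pairs N n) * (\<Sum>j=1..n. ((cmod (block_sum N j t w))\<^sup>2 - real (N j)) / 2)"

text \<open>The squared modulus runs over all ordered pairs: the diagonal contributes
  \<open>N j\<close>, and the two triangles agree because the cosine is even.\<close>

lemma sum_pair_set_cos:
  "(\<Sum>(k1, k2)\<in>pair_set N j. cos (t * (w j k1 - w j k2))) = ((cmod (block_sum N j t w))\<^sup>2 - real (N j)) / 2"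
proof -
  let ?c = "\<lambda>(k, l). cos (t * (w j k - w j l))"
  let ?A = "{1..N j}"
  let ?L = "pair_set N j" and ?U = "prod.swap ` pair_set N j" and ?D = "(\<lambda>k. (k, k)) ` ?A"
  have fin: "finite (pair_set N j)"
    by (rule finite_subset[of _ "?A \<times> ?A"]) (auto simp: pair_set_def)
  have split: "?A \<times> ?A = ?L \<union> (?U \<union> ?D)"
    by (auto simp: pair_set_def image_iff)
  have re: "of_real ((cmod (block_sum N j t w))\<^sup>2) = (\<Sum>k\<in>?A. \<Sum>l\<in>?A. cis (t * (w j k - w j l)))"
    unfolding complex_norm_square block_sum_def cnj_sum sum_product
    by (intro sum.cong refl) (simp add: cis_cnj cis_mult right_diff_distrib)
  have "(cmod (block_sum N j t w))\<^sup>2 = Re (of_real ((cmod (block_sum N j t w))\<^sup>2))" by simp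
  also have "\<dots> = (\<Sum>k\<in>?A. \<Sum>l\<in>?A. cos (t * (w j k - w j l)))"
    unfolding re by (simp add: Re_sum)
  also have "\<dots> = (\<Sum>p\<in>?A \<times> ?A. ?c p)"
    by (simp add: sum.cartesian_product)
  also have "\<dots> = sum ?c ?L + (sum ?c ?U + sum ?c ?D)"
    unfolding split using fin
    by (subst sum.union_disjoint; (subst sum.union_disjoint)?) (auto simp: pair_set_def)
  also have "sum ?c ?U = sum ?c ?L"
  proof -
    have "cos (t * (x - y)) = cos (t * (y - x))" for x y
      using cos_minus[of "t * (x - y)"] by (simp add: algebra_simps)
    then show ?thesis
      by (subst sum.reindex) (auto simp: inj_on_def intro!: sum.cong)
  qed
  also have "sum ?c ?D = real (N j)"
    by (subst sum.reindex) (auto simp: inj_on_def)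
  finally show ?thesis by simp
qed

lemma fU_Ft_hat_eq: "fU_Ft_hat N n w t = sqrt \<bar>pair_avg N n t w\<bar>"
  unfolding fU_Ft_hat_def pair_avg_def sum_pair_set_cos ..

lemma fU_Ft_hat_obs: "fU_Ft_hat N n (obs X U \<omega>) t = fU_Ft_hat N n (\<lambda>j k. U j k \<omega>) t"
  by (simp add: fU_Ft_hat_def obs_def)

lemma cmod_block_sum_le: "cmod (block_sum N j t w) \<le> real (N j)"
  unfolding block_sum_def by (rule order_trans[OF norm_sum]) simp

lemma block_sum_cong:
  "(\<And>k. k \<in> {1..N j} \<Longrightarrow> w j k = w' j k) \<Longrightarrow> block_sum N j t w = block_sum N j t w'"
  by (simp add: block_sum_def)

lemma pair_avg_cong:
  assumes "\<And>j k. j \<in> {1..n} \<Longrightarrow> k \<in> {1..N j} \<Longrightarrow> w j k = w' j k"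
  shows "pair_avg N n t w = pair_avg N n t w'"
  unfolding pair_avg_def using assms
  by (intro arg_cong2[where f="(*)"] refl sum.cong arg_cong[where f="\<lambda>z. ((cmod z)\<^sup>2 - _) / 2"] block_sum_cong) auto

lemma measurable_cis [measurable]: "cis \<in> borel_measurable borel"
  by (intro borel_measurable_continuous_onI continuous_intros)

lemma measurable_cnj [measurable]: "cnj \<in> borel_measurable borel"
  by (intro borel_measurable_continuous_onI continuous_intros)

lemma measurable_block_sum:
  assumes [measurable]: "t \<in> borel_measurable M"
    and w: "\<And>k. k \<in> {1..N j} \<Longrightarrow> (\<lambda>x. w x j k) \<in> borel_measurable M"
  shows "(\<lambda>x. block_sum N j (t x) (w x)) \<in> borel_measurable M"
  unfolding block_sum_def
proof (rule borel_measurable_sum)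
  fix k assume "k \<in> {1..N j}"
  then have [measurable]: "(\<lambda>x. w x j k) \<in> borel_measurable M" by (rule w)
  show "(\<lambda>x. cis (t x * w x j k)) \<in> borel_measurable M" by measurable
qed

lemma measurable_pair_avg:
  assumes "t \<in> borel_measurable M"
    and w: "\<And>j k. j \<in> {1..n} \<Longrightarrow> k \<in> {1..N j} \<Longrightarrow> (\<lambda>x. w x j k) \<in> borel_measurable M"
  shows "(\<lambda>x. pair_avg N n (t x) (w x)) \<in> borel_measurable M"
  unfolding pair_avg_def
proof (intro borel_measurable_times borel_measurable_const borel_measurable_sum)
  fix j assume "j \<in> {1..n}"
  then have [measurable]: "(\<lambda>x. block_sum N j (t x) (w x)) \<in> borel_measurable M"
    by (intro measurable_block_sum assms)
  show "(\<lambda>x. ((cmod (block_sum N j (t x) (w x)))\<^sup>2 - real (N j)) / 2) \<in> borel_measurable M"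
    by measurable
qed

context prob_space
begin

lemma integrable_bounded [intro]:
  fixes f :: "'a \<Rightarrow> 'b::{banach, second_countable_topology}"
  assumes "f \<in> borel_measurable M" "\<And>\<omega>. norm (f \<omega>) \<le> B"
  shows "integrable M f"
  using assms by (intro integrable_const_bound[where B=B]) auto

text \<open>Only pairwise orthogonality is asked for, so that the estimate serves independent blocks
  as well as all single errors together.\<close>

lemma second_moment_sum_uncorrelated_le:
  fixes W :: "'i \<Rightarrow> 'a \<Rightarrow> complex"
  assumes A: "finite A" and meas [measurable]: "\<And>a. a \<in> A \<Longrightarrow> W a \<in> borel_measurable M"
    and bound: "\<And>a \<omega>. a \<in> A \<Longrightarrow> cmod (W a \<omega>) \<le> b"
    and uncorr: "\<And>a c. a \<in> A \<Longrightarrow> c \<in> A \<Longrightarrow> a \<noteq> c \<Longrightarrow> (\<integral>\<omega>. W a \<omega> * cnj (W c \<omega>) \<partial>M) = 0"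
  shows "(\<integral>\<omega>. (cmod (\<Sum>a\<in>A. W a \<omega>))\<^sup>2 \<partial>M) \<le> real (card A) * b\<^sup>2"
proof -
  have int: "integrable M (\<lambda>\<omega>. W a \<omega> * cnj (W c \<omega>))" if "a \<in> A" "c \<in> A" for a c
  proof (rule integrable_bounded)
    show "(\<lambda>\<omega>. W a \<omega> * cnj (W c \<omega>)) \<in> borel_measurable M" using that by measurable
    show "norm (W a \<omega> * cnj (W c \<omega>)) \<le> b * b" for \<omega>
      unfolding norm_mult complex_mod_cnj using that order_trans[OF norm_ge_zero bound[OF that(1)]]
      by (intro mult_mono bound) auto
  qed
  have "complex_of_real (\<integral>\<omega>. (cmod (\<Sum>a\<in>A. W a \<omega>))\<^sup>2 \<partial>M) = (\<integral>\<omega>. of_real ((cmod (\<Sum>a\<in>A. W a \<omega>))\<^sup>2) \<partial>M)"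
    by (rule integral_complex_of_real[symmetric])
  also have "\<dots> = (\<integral>\<omega>. (\<Sum>a\<in>A. \<Sum>c\<in>A. W a \<omega> * cnj (W c \<omega>)) \<partial>M)"
    unfolding complex_norm_square cnj_sum sum_product ..
  also have "\<dots> = (\<Sum>a\<in>A. \<Sum>c\<in>A. \<integral>\<omega>. W a \<omega> * cnj (W c \<omega>) \<partial>M)"
    by (simp add: int)
  also have "\<dots> = (\<Sum>a\<in>A. \<integral>\<omega>. W a \<omega> * cnj (W a \<omega>) \<partial>M)"
  proof (intro sum.cong refl)
    fix a assume a: "a \<in> A"
    have "(\<Sum>c\<in>A. \<integral>\<omega>. W a \<omega> * cnj (W c \<omega>) \<partial>M) = (\<Sum>c\<in>A. if c = a then \<integral>\<omega>. W a \<omega> * cnj (W a \<omega>) \<partial>M else 0)"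
      using uncorr[OF a] by (intro sum.cong) auto
    then show "(\<Sum>c\<in>A. \<integral>\<omega>. W a \<omega> * cnj (W c \<omega>) \<partial>M) = (\<integral>\<omega>. W a \<omega> * cnj (W a \<omega>) \<partial>M)"
      using a A by simp
  qed
  finally have "cmod (complex_of_real (\<integral>\<omega>. (cmod (\<Sum>a\<in>A. W a \<omega>))\<^sup>2 \<partial>M))
     = cmod (\<Sum>a\<in>A. \<integral>\<omega>. W a \<omega> * cnj (W a \<omega>) \<partial>M)" by (rule arg_cong)
  then have "\<bar>\<integral>\<omega>. (cmod (\<Sum>a\<in>A. W a \<omega>))\<^sup>2 \<partial>M\<bar> = cmod (\<Sum>a\<in>A. \<integral>\<omega>. W a \<omega> * cnj (W a \<omega>) \<partial>M)"
    by (simp only: norm_of_real)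
  also have "\<dots> \<le> (\<Sum>a\<in>A. b\<^sup>2)"
  proof (intro sum_norm_le)
    fix a assume a: "a \<in> A"
    have "cmod (\<integral>\<omega>. W a \<omega> * cnj (W a \<omega>) \<partial>M) \<le> (\<integral>\<omega>. cmod (W a \<omega> * cnj (W a \<omega>)) \<partial>M)"
      by (rule integral_norm_bound)
    also have "\<dots> \<le> b\<^sup>2"
    proof (intro integral_le_const)
      show "integrable M (\<lambda>\<omega>. cmod (W a \<omega> * cnj (W a \<omega>)))" using int a by (intro integrable_norm) auto
      have "cmod (W a \<omega>) * cmod (W a \<omega>) \<le> b * b" for \<omega>
        using order_trans[OF norm_ge_zero bound[OF a]] by (intro mult_mono bound a) auto
      then show "AE \<omega> in M. cmod (W a \<omega> * cnj (W a \<omega>)) \<le> b\<^sup>2"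
        by (simp add: norm_mult power2_eq_square)
    qed
    finally show "cmod (\<integral>\<omega>. W a \<omega> * cnj (W a \<omega>) \<partial>M) \<le> b\<^sup>2" .
  qed
  finally show ?thesis by simp
qed

end

section \<open>Independence and transforms in the model\<close>

locale replicated_observations = prob_space P
  for P :: "'w measure" +
  fixes N :: "nat \<Rightarrow> nat" and fX fU :: "real \<Rightarrow> real"
    and X :: "nat \<Rightarrow> 'w \<Rightarrow> real" and U :: "nat \<Rightarrow> nat \<Rightarrow> 'w \<Rightarrow> real"
  assumes model: "replicated_model P N fX fU X U"
    and fX: "prob_density fX" and fU: "prob_density fU"
    and FT_fU_real: "\<forall>t. FT fU t \<in> \<real>" and FT_fU_nonzero: "\<forall>t. FT fU t \<noteq> 0"
begin

definition psi :: "real \<Rightarrow> real" where "psi t = Re (FT fU t)"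

text \<open>The single family over a sum type in which the model states independence; any grouping
  of signals and errors is a choice of disjoint index sets.\<close>

definition Z :: "nat + nat \<times> nat \<Rightarrow> 'w \<Rightarrow> real" where
  "Z = (\<lambda>i. case i of Inl j \<Rightarrow> X j | Inr (j, k) \<Rightarrow> U j k)"

lemma Z_simps [simp]: "Z (Inl j) = X j" "Z (Inr (j, k)) = U j k"
  by (simp_all add: Z_def)

abbreviation Index :: "(nat + nat \<times> nat) set" where
  "Index \<equiv> Inl ` {1..} \<union> Inr ` (SIGMA j:{1..}. {1..N j})"

lemma indep_Z: "indep_vars (\<lambda>_. borel) Z Index"
  using model by (simp add: replicated_model_def Z_def)

lemma measurable_X: "j \<ge> 1 \<Longrightarrow> X j \<in> borel_measurable P"
  using model by (auto simp: replicated_model_def distributed_def)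

lemma measurable_U: "j \<ge> 1 \<Longrightarrow> k \<in> {1..N j} \<Longrightarrow> U j k \<in> borel_measurable P"
  using model by (auto simp: replicated_model_def distributed_def)

lemma distr_U: "j \<ge> 1 \<Longrightarrow> k \<in> {1..N j} \<Longrightarrow> distr P borel (U j k) = density lborel (\<lambda>x. ennreal (fU x))"
  using model by (auto simp: replicated_model_def distributed_def cong: distr_cong)

lemma distr_X: "j \<ge> 1 \<Longrightarrow> distr P borel (X j) = density lborel (\<lambda>x. ennreal (fX x))"
  using model by (auto simp: replicated_model_def distributed_def cong: distr_cong)

lemma FT_fU_eq: "FT fU t = complex_of_real (psi t)"
  using FT_fU_real by (simp add: psi_def of_real_Re)

lemma expectation_cis_X: "j \<ge> 1 \<Longrightarrow> (\<integral>\<omega>. cis (t * X j \<omega>) \<partial>P) = FT fX t"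
proof -
  assume j: "j \<ge> 1"
  have "(\<integral>\<omega>. cis (t * X j \<omega>) \<partial>P) = (\<integral>x. cis (t * x) \<partial>distr P borel (X j))"
    using measurable_X[OF j] by (subst integral_distr) auto
  also have "\<dots> = FT fX t"
    unfolding distr_X[OF j] char_density_eq_FT[OF fX, symmetric] char_def by (simp add: cis_conv_exp)
  finally show ?thesis .
qed

lemma expectation_cis_U: "j \<ge> 1 \<Longrightarrow> k \<in> {1..N j} \<Longrightarrow> (\<integral>\<omega>. cis (t * U j k \<omega>) \<partial>P) = of_real (psi t)"
proof -
  assume j: "j \<ge> 1" "k \<in> {1..N j}"
  have "(\<integral>\<omega>. cis (t * U j k \<omega>) \<partial>P) = (\<integral>x. cis (t * x) \<partial>distr P borel (U j k))"
    using measurable_U[OF j] by (subst integral_distr) auto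
  also have "\<dots> = FT fU t"
    unfolding distr_U[OF j] char_density_eq_FT[OF fU, symmetric] char_def by (simp add: cis_conv_exp)
  finally show ?thesis by (simp add: FT_fU_eq)
qed

lemma measurable_psi [measurable]: "psi \<in> borel_measurable borel"
proof -
  have [measurable]: "FT fU \<in> borel_measurable borel"
    using fU by (intro measurable_FT) (simp add: prob_density_def)
  show ?thesis unfolding psi_def [abs_def] by measurable
qed

lemma cmod_FT_fX_le_1: "cmod (FT fX t) \<le> 1"
  using real_distribution.cmod_char_le_1[OF prob_density_real_distribution[OF fX]]
  by (simp add: char_density_eq_FT[OF fX])

lemma psi_le_1: "psi t \<le> 1"
  using real_distribution.cmod_char_le_1[OF prob_density_real_distribution[OF fU], of t]
  by (simp add: char_density_eq_FT[OF fU] FT_fU_eq)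

text \<open>A continuous real function without zeros and with value 1 at 0 stays positive. Hence the
  root of the pair average, whose mean is \<open>(psi t)^2\<close>, targets \<open>psi\<close>
  itself and not merely its modulus.\<close>

lemma psi_pos: "psi t > 0"
proof (rule ccontr)
  assume neg: "\<not> psi t > 0"
  have cont: "isCont psi x" for x
    unfolding psi_def [abs_def] char_density_eq_FT[OF fU, symmetric]
    by (intro continuous_Re real_distribution.isCont_char prob_density_real_distribution fU)
  have p0: "psi 0 = 1"
    using real_distribution.char_zero[OF prob_density_real_distribution[OF fU]]
    by (simp add: char_density_eq_FT[OF fU] psi_def)
  have "\<exists>x. psi x = 0"
  proof (cases "t \<le> 0")
    case True
    then show ?thesis using IVT[of psi t 0 0] neg p0 cont by auto
  next
    case False
    then show ?thesis using IVT2[of psi t 0 0] neg p0 cont by auto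
  qed
  then show False using FT_fU_nonzero by (auto simp: FT_fU_eq)
qed

lemma psi_minus: "psi (- t) = psi t"
  by (simp add: psi_def FT_minus)

lemma expectation_mult_Z:
  fixes f g :: "real \<Rightarrow> complex"
  assumes "a \<in> Index" "b \<in> Index" "a \<noteq> b"
    and [measurable]: "f \<in> borel_measurable borel" "g \<in> borel_measurable borel"
    and bd: "\<And>x. cmod (f x) \<le> B" "\<And>x. cmod (g x) \<le> B"
  shows "(\<integral>\<omega>. f (Z a \<omega>) * g (Z b \<omega>) \<partial>P) = (\<integral>\<omega>. f (Z a \<omega>) \<partial>P) * (\<integral>\<omega>. g (Z b \<omega>) \<partial>P)"
proof (rule indep_var_lebesgue_integral)
  have "indep_var (PiM {a} (\<lambda>_. borel)) (\<lambda>\<omega>. restrict (\<lambda>i. Z i \<omega>) {a}) (PiM {b} (\<lambda>_. borel)) (\<lambda>\<omega>. restrict (\<lambda>i. Z i \<omega>) {b})"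
    using assms by (intro indep_var_restrict[OF indep_Z]) auto
  then have "indep_var borel ((\<lambda>y. f (y a)) \<circ> (\<lambda>\<omega>. restrict (\<lambda>i. Z i \<omega>) {a})) borel ((\<lambda>y. g (y b)) \<circ> (\<lambda>\<omega>. restrict (\<lambda>i. Z i \<omega>) {b}))"
    by (rule indep_var_compose) measurable
  then show "indep_var borel (\<lambda>\<omega>. f (Z a \<omega>)) borel (\<lambda>\<omega>. g (Z b \<omega>))"
    by (simp add: comp_def)
  have "Z a \<in> borel_measurable P" "Z b \<in> borel_measurable P"
    using indep_Z assms(1,2) unfolding indep_vars_def by auto
  then show "integrable P (\<lambda>\<omega>. f (Z a \<omega>))" "integrable P (\<lambda>\<omega>. g (Z b \<omega>))"
    by (auto intro!: integrable_bounded[where B=B] bd)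
qed

lemma indep_block_sums:
  "indep_vars (\<lambda>_. borel) (\<lambda>j \<omega>. block_sum N j t (\<lambda>j k. U j k \<omega>)) {1..}"
proof -
  let ?K = "\<lambda>j. Inr ` ({j} \<times> {1..N j}) :: (nat + nat \<times> nat) set"
  have "indep_vars (\<lambda>j. PiM (?K j) (\<lambda>_. borel)) (\<lambda>j \<omega>. restrict (\<lambda>i. Z i \<omega>) (?K j)) {1..}"
    by (rule indep_vars_restrict[OF indep_Z]) (auto simp: disjoint_family_on_def)
  then have "indep_vars (\<lambda>_. borel) (\<lambda>j \<omega>. block_sum N j t (\<lambda>j' k. restrict (\<lambda>i. Z i \<omega>) (?K j) (Inr (j', k)))) {1..}"
  proof (rule indep_vars_compose2[where Y="\<lambda>j y. block_sum N j t (\<lambda>j k. y (Inr (j, k)))"])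
    fix j :: nat
    show "(\<lambda>y. block_sum N j t (\<lambda>j k. y (Inr (j, k)))) \<in> measurable (PiM (?K j) (\<lambda>_. borel)) borel"
      by (intro measurable_block_sum measurable_component_singleton) auto
  qed
  then show ?thesis
    by (rule indep_vars_cong[THEN iffD1, rotated -1]) (auto simp: fun_eq_iff intro!: block_sum_cong)
qed

end

section \<open>Concentration of the pair average and of the block average\<close>

locale bounded_replications = replicated_observations P N fX fU X U
  for P :: "'w measure" and N fX fU X U +
  fixes C1 :: real
  assumes C1: "C1 > 1"
    and N_bounds: "\<And>j. j \<ge> 1 \<Longrightarrow> 1 \<le> N j \<and> real (N j) \<le> C1"
    and num_pairs_ge: "\<And>n. n \<ge> 1 \<Longrightarrow> num_pairs N n \<ge> real n / C1"
begin

abbreviation errs :: "'w \<Rightarrow> nat \<Rightarrow> nat \<Rightarrow> real" where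
  "errs \<omega> \<equiv> \<lambda>j k. U j k \<omega>"

definition Y :: "real \<Rightarrow> nat \<Rightarrow> 'w \<Rightarrow> real" where
  "Y t j \<omega> = ((cmod (block_sum N j t (errs \<omega>)))\<^sup>2 - real (N j)) / 2"

lemma measurable_errs_block_sum:
  assumes "j \<ge> 1"
  shows "(\<lambda>\<omega>. block_sum N j t (errs \<omega>)) \<in> borel_measurable P"
  using assms by (intro measurable_block_sum measurable_U) auto

lemma measurable_Y: "j \<ge> 1 \<Longrightarrow> Y t j \<in> borel_measurable P"
proof -
  assume "j \<ge> 1"
  then have [measurable]: "(\<lambda>\<omega>. block_sum N j t (errs \<omega>)) \<in> borel_measurable P"
    by (rule measurable_errs_block_sum)
  show ?thesis unfolding Y_def [abs_def] by measurable
qed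

lemma measurable_errs_pair_avg [measurable]: "(\<lambda>\<omega>. pair_avg N n t (errs \<omega>)) \<in> borel_measurable P"
  by (intro measurable_pair_avg measurable_U) auto

lemma Y_bounds:
  "- (real (N j) / 2) \<le> Y t j \<omega>" "Y t j \<omega> \<le> ((real (N j))\<^sup>2 - real (N j)) / 2"
proof -
  have "(cmod (block_sum N j t (errs \<omega>)))\<^sup>2 \<le> (real (N j))\<^sup>2"
    using cmod_block_sum_le by (intro power_mono) auto
  then show "- (real (N j) / 2) \<le> Y t j \<omega>" "Y t j \<omega> \<le> ((real (N j))\<^sup>2 - real (N j)) / 2"
    by (simp_all add: Y_def)
qed

lemma abs_Y_le: "\<bar>Y t j \<omega>\<bar> \<le> (real (N j))\<^sup>2 / 2 + real (N j) / 2"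
  using Y_bounds(1)[of j t \<omega>] Y_bounds(2)[of t j \<omega>] zero_le_power2[of "real (N j)"] by (simp add: abs_le_iff field_simps)

lemma integrable_Y: "j \<ge> 1 \<Longrightarrow> integrable P (Y t j)"
  using abs_Y_le by (intro integrable_bounded[OF measurable_Y]) auto

lemma expectation_cis_pair:
  assumes "j \<ge> 1" "k \<in> {1..N j}" "j' \<ge> 1" "k' \<in> {1..N j'}" "(j, k) \<noteq> (j', k')"
  shows "(\<integral>\<omega>. cis (t * U j k \<omega>) * cnj (cis (t * U j' k' \<omega>)) \<partial>P) = (of_real (psi t))\<^sup>2"
proof -
  have "(\<integral>\<omega>. cis (t * Z (Inr (j, k)) \<omega>) * cis (- t * Z (Inr (j', k')) \<omega>) \<partial>P)
      = (\<integral>\<omega>. cis (t * Z (Inr (j, k)) \<omega>) \<partial>P) * (\<integral>\<omega>. cis (- t * Z (Inr (j', k')) \<omega>) \<partial>P)"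
    using assms by (intro expectation_mult_Z[where B=1]) auto
  then show ?thesis
    unfolding Z_simps expectation_cis_U[OF assms(1,2)] expectation_cis_U[OF assms(3,4)]
    by (simp add: cis_cnj psi_minus power2_eq_square)
qed

lemma expectation_Y:
  assumes "j \<ge> 1"
  shows "expectation (Y t j) = real (N j) * (real (N j) - 1) / 2 * (psi t)\<^sup>2"
proof -
  let ?A = "{1..N j}"
  let ?S = "\<lambda>\<omega>. block_sum N j t (errs \<omega>)"
  let ?e = "\<lambda>k l \<omega>. cis (t * U j k \<omega>) * cnj (cis (t * U j l \<omega>))"
  have [measurable]: "U j k \<in> borel_measurable P" if "k \<in> ?A" for k
    using assms that by (rule measurable_U)
  have int: "integrable P (?e k l)" if "k \<in> ?A" "l \<in> ?A" for k l
  proof (rule integrable_bounded)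
    have [measurable]: "U j k \<in> borel_measurable P" "U j l \<in> borel_measurable P"
      using assms that by (auto intro: measurable_U)
    show "?e k l \<in> borel_measurable P" by measurable
    show "norm (?e k l \<omega>) \<le> 1" for \<omega> by (simp add: norm_mult)
  qed
  have "complex_of_real (\<integral>\<omega>. (cmod (?S \<omega>))\<^sup>2 \<partial>P) = (\<integral>\<omega>. of_real ((cmod (?S \<omega>))\<^sup>2) \<partial>P)"
    by (rule integral_complex_of_real[symmetric])
  also have "\<dots> = (\<integral>\<omega>. (\<Sum>k\<in>?A. \<Sum>l\<in>?A. ?e k l \<omega>) \<partial>P)"
    unfolding complex_norm_square block_sum_def cnj_sum sum_product ..
  also have "\<dots> = (\<Sum>k\<in>?A. \<Sum>l\<in>?A. \<integral>\<omega>. ?e k l \<omega> \<partial>P)"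
    by (simp only: Bochner_Integration.integral_sum Bochner_Integration.integrable_sum int cong: sum.cong)
  also have "\<dots> = (\<Sum>k\<in>?A. \<Sum>l\<in>?A. (of_real (psi t))\<^sup>2 + (if l = k then 1 - (of_real (psi t))\<^sup>2 else 0))"
  proof (intro sum.cong refl)
    fix k l assume "k \<in> ?A" "l \<in> ?A"
    then show "(\<integral>\<omega>. ?e k l \<omega> \<partial>P) = (of_real (psi t))\<^sup>2 + (if l = k then 1 - (of_real (psi t))\<^sup>2 else 0)"
      using assms expectation_cis_pair[of j k j l t] prob_space
      by (cases "k = l") (auto simp: cis_cnj cis_mult)
  qed
  also have "\<dots> = complex_of_real ((real (N j))\<^sup>2 * (psi t)\<^sup>2 + real (N j) * (1 - (psi t)\<^sup>2))"
    by (simp add: sum.distrib power2_eq_square algebra_simps)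
  finally have E: "(\<integral>\<omega>. (cmod (?S \<omega>))\<^sup>2 \<partial>P) = (real (N j))\<^sup>2 * (psi t)\<^sup>2 + real (N j) * (1 - (psi t)\<^sup>2)"
    by (simp only: of_real_eq_iff)
  have i2: "integrable P (\<lambda>\<omega>. (cmod (?S \<omega>))\<^sup>2)"
  proof (rule integrable_bounded)
    have [measurable]: "?S \<in> borel_measurable P" using assms by (rule measurable_errs_block_sum)
    show "(\<lambda>\<omega>. (cmod (?S \<omega>))\<^sup>2) \<in> borel_measurable P" by measurable
    show "norm ((cmod (?S \<omega>))\<^sup>2) \<le> (real (N j))\<^sup>2" for \<omega>
      using cmod_block_sum_le by (auto intro!: power_mono)
  qed
  have "expectation (Y t j) = ((\<integral>\<omega>. (cmod (?S \<omega>))\<^sup>2 \<partial>P) - real (N j)) / 2"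
    unfolding Y_def [abs_def] using i2 prob_space by simp
  also have "\<dots> = real (N j) * (real (N j) - 1) / 2 * (psi t)\<^sup>2"
    unfolding E by (simp add: power2_eq_square algebra_simps)
  finally show ?thesis .
qed

lemma num_pairs_pos: "n \<ge> 1 \<Longrightarrow> num_pairs N n > 0"
proof -
  assume n: "n \<ge> 1"
  have "0 < real n / C1" using n C1 by simp
  also have "\<dots> \<le> num_pairs N n" using n by (rule num_pairs_ge)
  finally show ?thesis .
qed

lemma sum_expectation_Y: "(\<Sum>j=1..n. expectation (Y t j)) = num_pairs N n * (psi t)\<^sup>2"
  unfolding num_pairs_def sum_distrib_left sum_distrib_right
  by (intro sum.cong refl) (simp add: expectation_Y)

lemma pair_avg_eq_sum_Y: "pair_avg N n t (errs \<omega>) = (\<Sum>j=1..n. Y t j \<omega>) / num_pairs N n"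
  by (simp add: pair_avg_def Y_def)

lemma pair_avg_minus:
  assumes "n \<ge> 1"
  shows "pair_avg N n t (errs \<omega>) - (psi t)\<^sup>2 = (\<Sum>j=1..n. Y t j \<omega> - expectation (Y t j)) / num_pairs N n"
proof -
  have "(psi t)\<^sup>2 = (\<Sum>j=1..n. expectation (Y t j)) / num_pairs N n"
    unfolding sum_expectation_Y using num_pairs_pos[OF assms] by simp
  then show ?thesis
    by (simp add: pair_avg_eq_sum_Y sum_subtractf diff_divide_distrib)
qed

lemma N_sq_le: "j \<ge> 1 \<Longrightarrow> (real (N j))\<^sup>2 \<le> C1\<^sup>2"
  using N_bounds[of j] by (intro power_mono) auto

text \<open>Independent centred summands of size at most \<open>C1^2\<close>, normalised by at least
  \<open>n / C1\<close> pairs, give \<open>n * C1^4 / (n / C1)^2\<close>.\<close>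

lemma second_moment_pair_avg_le:
  assumes n: "n \<ge> 1"
  shows "(\<integral>\<omega>. (pair_avg N n t (errs \<omega>) - (psi t)\<^sup>2)\<^sup>2 \<partial>P) \<le> C1 ^ 6 / real n"
proof -
  define W where "W j \<omega> = complex_of_real (Y t j \<omega> - expectation (Y t j))" for j \<omega>
  have W_meas: "W j \<in> borel_measurable P" if "j \<ge> 1" for j
    using measurable_Y[OF that, of t] unfolding W_def [abs_def] by measurable
  have bd: "cmod (W j \<omega>) \<le> C1\<^sup>2" if "j \<in> {1..n}" for j \<omega>
  proof -
    let ?a = "- (real (N j) / 2)" and ?b = "((real (N j))\<^sup>2 - real (N j)) / 2"
    have j: "j \<ge> 1" using that by simp
    have "?a \<le> expectation (Y t j)" "expectation (Y t j) \<le> ?b"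
      by (intro integral_ge_const integral_le_const integrable_Y j AE_I2 Y_bounds)+
    then have "\<bar>Y t j \<omega> - expectation (Y t j)\<bar> \<le> ?b - ?a"
      using Y_bounds(1)[of j t \<omega>] Y_bounds(2)[of t j \<omega>] unfolding abs_le_iff by (intro conjI; linarith)
    also have "?b - ?a = (real (N j))\<^sup>2 / 2" by (simp add: field_simps)
    also have "\<dots> \<le> C1\<^sup>2" using N_sq_le[OF j] zero_le_power2[of C1] by linarith
    finally show ?thesis by (simp only: W_def norm_of_real)
  qed
  have indep_W: "indep_vars (\<lambda>_. borel) W {1..}"
    unfolding W_def [abs_def] Y_def
    by (rule indep_vars_compose2[OF indep_block_sums]) measurable
  have uncorr: "(\<integral>\<omega>. W a \<omega> * cnj (W c \<omega>) \<partial>P) = 0" if ac: "a \<in> {1..n}" "c \<in> {1..n}" "a \<noteq> c" for a c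
  proof -
    have "(\<integral>\<omega>. (\<Prod>i\<in>{a, c}. W i \<omega>) \<partial>P) = (\<Prod>i\<in>{a, c}. \<integral>\<omega>. W i \<omega> \<partial>P)"
    proof (rule indep_vars_lebesgue_integral)
      show "indep_vars (\<lambda>_. borel) W {a, c}" using ac by (intro indep_vars_subset[OF indep_W]) auto
      show "integrable P (W i)" if "i \<in> {a, c}" for i
        using that ac by (intro integrable_bounded[OF W_meas bd]) auto
    qed simp
    moreover have "(\<integral>\<omega>. W a \<omega> \<partial>P) = 0"
    proof -
      have "(\<integral>\<omega>. Y t a \<omega> - expectation (Y t a) \<partial>P) = 0"
        using ac integrable_Y[of a t] prob_space by simp
      then show ?thesis unfolding W_def integral_complex_of_real by simp
    qed
    moreover have "cnj (W c \<omega>) = W c \<omega>" for \<omega> by (simp add: W_def)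
    ultimately show ?thesis using ac by simp
  qed
  have "(\<integral>\<omega>. (cmod (\<Sum>j=1..n. W j \<omega>))\<^sup>2 \<partial>P) \<le> real (card {1..n}) * (C1\<^sup>2)\<^sup>2"
    using W_meas bd uncorr by (intro second_moment_sum_uncorrelated_le) auto
  also have "\<dots> = real n * C1 ^ 4" by simp
  finally have le: "(\<integral>\<omega>. (cmod (\<Sum>j=1..n. W j \<omega>))\<^sup>2 \<partial>P) \<le> real n * C1 ^ 4" .
  have eq: "(pair_avg N n t (errs \<omega>) - (psi t)\<^sup>2)\<^sup>2 = (cmod (\<Sum>j=1..n. W j \<omega>))\<^sup>2 / (num_pairs N n)\<^sup>2" for \<omega>
    unfolding pair_avg_minus[OF n] W_def of_real_sum[symmetric] norm_of_real by (simp add: power_divide)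
  have "(\<integral>\<omega>. (pair_avg N n t (errs \<omega>) - (psi t)\<^sup>2)\<^sup>2 \<partial>P) \<le> real n * C1 ^ 4 / (num_pairs N n)\<^sup>2"
    unfolding eq using le by (simp add: divide_right_mono)
  also have "\<dots> \<le> real n * C1 ^ 4 / (real n / C1)\<^sup>2"
    using n C1 num_pairs_pos[OF n] num_pairs_ge[OF n]
    by (intro divide_left_mono power_mono mult_pos_pos) auto
  also have "\<dots> = C1 ^ 6 / real n"
    using n C1 by (simp add: field_simps power2_eq_square eval_nat_numeral)
  finally show ?thesis .
qed

text \<open>Hoeffding's inequality over blocks. Each summand ranges over an interval of length
  \<open>(N j)^2 / 2\<close>, at most \<open>C1^2\<close>; the normalisation contributes the other
  two of the six powers of \<open>C1\<close>.\<close>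

lemma tail_pair_avg_le:
  assumes n: "n \<ge> 1" and e: "e \<ge> 0"
  shows "prob {\<omega> \<in> space P. \<bar>pair_avg N n t (errs \<omega>) - (psi t)\<^sup>2\<bar> \<ge> e}
    \<le> 2 * exp (- 2 * real n * e\<^sup>2 / C1 ^ 6)"
proof -
  let ?a = "\<lambda>j. - (real (N j) / 2)" and ?b = "\<lambda>j. ((real (N j))\<^sup>2 - real (N j)) / 2"
  let ?\<mu> = "\<Sum>j=1..n. expectation (Y t j)"
  have indep_Y: "indep_vars (\<lambda>_. borel) (Y t) {1..n}"
    unfolding Y_def [abs_def]
    by (rule indep_vars_subset[of _ _ "{1..}"], rule indep_vars_compose2[OF indep_block_sums]) auto
  interpret Hoeffding_ineq P "{1..n}" "Y t" ?a ?b ?\<mu>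
    by unfold_locales (use indep_Y Y_bounds in auto)
  have w: "?b j - ?a j = (real (N j))\<^sup>2 / 2" for j by (simp add: field_simps)
  have pos: "(\<Sum>j=1..n. (?b j - ?a j)\<^sup>2) > 0"
    unfolding w using n N_bounds by (intro sum_pos) (auto simp: Suc_le_eq)
  have wle: "(\<Sum>j=1..n. (?b j - ?a j)\<^sup>2) \<le> real n * C1 ^ 4"
  proof -
    have "(\<Sum>j=1..n. (?b j - ?a j)\<^sup>2) \<le> (\<Sum>j=1..n. C1 ^ 4)"
    proof (rule sum_mono)
      fix j assume "j \<in> {1..n}"
      then have "(real (N j))\<^sup>2 \<le> C1\<^sup>2" by (intro N_sq_le) auto
      then have "(real (N j))\<^sup>2 / 2 \<le> C1\<^sup>2" using zero_le_power2[of C1] by linarith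
      then have "((real (N j))\<^sup>2 / 2)\<^sup>2 \<le> (C1\<^sup>2)\<^sup>2" by (intro power_mono) auto
      then show "(?b j - ?a j)\<^sup>2 \<le> C1 ^ 4" unfolding w by simp
    qed
    then show ?thesis by simp
  qed
  have eq: "{\<omega> \<in> space P. \<bar>pair_avg N n t (errs \<omega>) - (psi t)\<^sup>2\<bar> \<ge> e}
      = {\<omega> \<in> space P. \<bar>(\<Sum>j=1..n. Y t j \<omega>) - ?\<mu>\<bar> \<ge> e * num_pairs N n}"
    using num_pairs_pos[OF n]
    by (auto simp: pair_avg_minus[OF n] sum_subtractf abs_mult pos_le_divide_eq)
  have "prob {\<omega> \<in> space P. \<bar>pair_avg N n t (errs \<omega>) - (psi t)\<^sup>2\<bar> \<ge> e}
      \<le> 2 * exp (-2 * (e * num_pairs N n)\<^sup>2 / (\<Sum>j=1..n. (?b j - ?a j)\<^sup>2))"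
    unfolding eq using e num_pairs_pos[OF n] pos by (intro Hoeffding_ineq_abs_ge) auto
  also have "\<dots> \<le> 2 * exp (- 2 * real n * e\<^sup>2 / C1 ^ 6)"
  proof -
    have "2 * real n * e\<^sup>2 / C1 ^ 6 = 2 * (e * (real n / C1))\<^sup>2 / (real n * C1 ^ 4)"
      using n C1 by (simp add: field_simps power2_eq_square eval_nat_numeral)
    also have "\<dots> \<le> 2 * (e * num_pairs N n)\<^sup>2 / (\<Sum>j=1..n. (?b j - ?a j)\<^sup>2)"
      using pos wle e n C1 num_pairs_ge[OF n]
      by (intro frac_le mult_left_mono power_mono) auto
    finally show ?thesis by simp
  qed
  finally show ?thesis .
qed

lemma num_obs_ge: "num_obs N n \<ge> real n"
proof -
  have "real n = (\<Sum>j=1..n. 1)" by simp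
  also have "\<dots> \<le> num_obs N n" unfolding num_obs_def using N_bounds by (intro sum_mono) auto
  finally show ?thesis .
qed

text \<open>The \<open>num_obs N n\<close> centred terms have modulus at most 2 and are pairwise
  uncorrelated, also within a block, because the errors themselves are independent once the signals
  are left out.\<close>

lemma second_moment_block_avg_le:
  assumes n: "n \<ge> 1"
  shows "(\<integral>\<omega>. (cmod ((\<Sum>j=1..n. block_sum N j t (errs \<omega>)) / of_real (num_obs N n) - of_real (psi t)))\<^sup>2 \<partial>P) \<le> 4 / real n"
proof -
  let ?A = "SIGMA j:{1..n}. {1..N j}"
  let ?M = "num_obs N n"
  have M: "?M > 0" using num_obs_ge[of n] n by linarith
  define W where "W a \<omega> = (case a of (j, k) \<Rightarrow> cis (t * U j k \<omega>) - of_real (psi t))" for a \<omega>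
  have cardA: "real (card ?A) = ?M"
    by (simp add: num_obs_def)
  have W_meas: "W a \<in> borel_measurable P" if aA: "a \<in> ?A" for a
  proof -
    obtain j k where a: "a = (j, k)" "j \<ge> 1" "k \<in> {1..N j}" using aA by auto
    have [measurable]: "U j k \<in> borel_measurable P" using a by (intro measurable_U)
    show ?thesis unfolding W_def [abs_def] a by simp
  qed
  have bd: "cmod (W a \<omega>) \<le> 2" for a \<omega>
  proof -
    have "cmod (cis x - of_real (psi t)) \<le> 1 + 1" for x
      using psi_pos[of t] psi_le_1[of t] by (intro order_trans[OF norm_triangle_ineq4] add_mono) auto
    then show ?thesis by (simp add: W_def split: prod.split)
  qed
  have uncorr: "(\<integral>\<omega>. W a \<omega> * cnj (W c \<omega>) \<partial>P) = 0" if ac: "a \<in> ?A" "c \<in> ?A" "a \<noteq> c" for a c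
  proof -
    obtain j k where a: "a = (j, k)" "j \<ge> 1" "k \<in> {1..N j}" using ac by auto
    obtain j' k' where c: "c = (j', k')" "j' \<ge> 1" "k' \<in> {1..N j'}" using ac by auto
    have [measurable]: "U j k \<in> borel_measurable P" "U j' k' \<in> borel_measurable P"
      using a c by (auto intro: measurable_U)
    have i1: "integrable P (\<lambda>\<omega>. cis (t * U j k \<omega>))" "integrable P (\<lambda>\<omega>. cis (- (t * U j' k' \<omega>)))"
      by (auto intro!: integrable_bounded[where B=1])
    have i2: "integrable P (\<lambda>\<omega>. cis (t * U j k \<omega>) * cis (- (t * U j' k' \<omega>)))"
      by (auto intro!: integrable_bounded[where B=1] simp: norm_mult)
    have "W a \<omega> * cnj (W c \<omega>) = cis (t * U j k \<omega>) * cis (- (t * U j' k' \<omega>)) - of_real (psi t) * cis (t * U j k \<omega>)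
        - of_real (psi t) * cis (- (t * U j' k' \<omega>)) + (of_real (psi t))\<^sup>2" for \<omega>
      by (simp add: W_def a c cis_cnj algebra_simps power2_eq_square)
    then have "(\<integral>\<omega>. W a \<omega> * cnj (W c \<omega>) \<partial>P) = (\<integral>\<omega>. cis (t * U j k \<omega>) * cis (- (t * U j' k' \<omega>)) \<partial>P)
        - of_real (psi t) * (\<integral>\<omega>. cis (t * U j k \<omega>) \<partial>P)
        - of_real (psi t) * (\<integral>\<omega>. cis (- (t * U j' k' \<omega>)) \<partial>P) + (of_real (psi t))\<^sup>2"
      using i1 i2 prob_space by simp
    also have "(\<integral>\<omega>. cis (t * U j k \<omega>) * cis (- (t * U j' k' \<omega>)) \<partial>P) = (of_real (psi t))\<^sup>2"
      using expectation_cis_pair[OF a(2,3) c(2,3), of t] ac a c by (simp add: cis_cnj)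
    also have "(\<integral>\<omega>. cis (- (t * U j' k' \<omega>)) \<partial>P) = of_real (psi t)"
      using expectation_cis_U[OF c(2,3), of "- t"] by (simp add: psi_minus)
    also have "(\<integral>\<omega>. cis (t * U j k \<omega>) \<partial>P) = of_real (psi t)" by (rule expectation_cis_U[OF a(2,3)])
    finally show ?thesis by (simp add: power2_eq_square)
  qed
  have le: "(\<integral>\<omega>. (cmod (\<Sum>a\<in>?A. W a \<omega>))\<^sup>2 \<partial>P) \<le> real (card ?A) * 2\<^sup>2"
    using W_meas bd uncorr by (intro second_moment_sum_uncorrelated_le) auto
  have "(\<Sum>a\<in>?A. W a \<omega>) = (\<Sum>j=1..n. block_sum N j t (errs \<omega>)) - of_real (psi t) * of_real ?M" for \<omega>
    unfolding W_def block_sum_def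
    by (subst sum.Sigma[symmetric]) (auto simp: sum_subtractf num_obs_def sum_distrib_left mult.commute)
  then have "(\<Sum>j=1..n. block_sum N j t (errs \<omega>)) / of_real ?M - of_real (psi t) = (\<Sum>a\<in>?A. W a \<omega>) / of_real ?M" for \<omega>
    using M by (simp add: diff_divide_distrib)
  then have "(\<integral>\<omega>. (cmod ((\<Sum>j=1..n. block_sum N j t (errs \<omega>)) / of_real ?M - of_real (psi t)))\<^sup>2 \<partial>P)
     = (\<integral>\<omega>. (cmod (\<Sum>a\<in>?A. W a \<omega>))\<^sup>2 \<partial>P) / ?M\<^sup>2"
    by (simp add: norm_divide power_divide)
  also have "\<dots> \<le> real (card ?A) * 2\<^sup>2 / ?M\<^sup>2"
    by (intro divide_right_mono le) auto
  also have "\<dots> = 4 / ?M" using M unfolding cardA by (simp add: power2_eq_square)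
  also have "\<dots> \<le> 4 / real n" using n num_obs_ge[of n] by (intro divide_left_mono mult_pos_pos) auto
  finally show ?thesis .
qed

end

section \<open>Second moments of the inverse error\<close>

text \<open>Under the hypothesis \<open>v\<close>, \<open>sqrt \<bar>v\<bar>\<close> is at least
  \<open>p / 2\<close>, so the denominator is at least \<open>p^2 / 2\<close>, and the root is
  linearised by \<open>\<bar>sqrt \<bar>v\<bar> - p\<bar> \<le> \<bar>v - p^2\<bar> / p\<close>. The
  crude second bound is meant to be multiplied by a small random factor.\<close>

lemma inverse_error_near:
  fixes v p \<rho> :: real
  assumes p: "p > 0" and \<rho>: "\<rho> \<ge> 0" and v: "\<bar>v - p\<^sup>2\<bar> < p\<^sup>2 / 2"
  shows "(1 / (sqrt \<bar>v\<bar> + \<rho>) - 1 / p)\<^sup>2 \<le> 8 * (v - p\<^sup>2)\<^sup>2 / p ^ 6 + 8 * \<rho>\<^sup>2 / p ^ 4"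
    and "\<bar>1 / (sqrt \<bar>v\<bar> + \<rho>) - 1 / p\<bar> \<le> 3 / p"
proof -
  define s where "s = sqrt \<bar>v\<bar>"
  have p2: "p\<^sup>2 > 0" using p by simp
  have "(p / 2)\<^sup>2 = p\<^sup>2 / 4" by (simp add: power_divide)
  with v p2 have "(p / 2)\<^sup>2 \<le> \<bar>v\<bar>" by linarith
  then have s: "s \<ge> p / 2" unfolding s_def by (intro real_le_rsqrt)
  have s2: "s\<^sup>2 = \<bar>v\<bar>" by (simp add: s_def)
  have "\<bar>s - p\<bar> * p \<le> \<bar>s - p\<bar> * (s + p)" using s p by (intro mult_left_mono) auto
  also have "\<dots> = \<bar>(s - p) * (s + p)\<bar>" using s p by (simp add: abs_mult)
  also have "(s - p) * (s + p) = \<bar>v\<bar> - p\<^sup>2" unfolding s2[symmetric] by (simp add: algebra_simps power2_eq_square)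
  also have "\<bar>\<bar>v\<bar> - p\<^sup>2\<bar> \<le> \<bar>v - p\<^sup>2\<bar>" using p2 by linarith
  finally have sp: "\<bar>s - p\<bar> \<le> \<bar>v - p\<^sup>2\<bar> / p" using p by (simp add: field_simps)
  have den: "(s + \<rho>) * p \<ge> p\<^sup>2 / 2"
    using s p \<rho> mult_right_mono[of "p / 2" "s + \<rho>" p] by (simp add: power2_eq_square)
  have "1 / (s + \<rho>) - 1 / p = (p - s - \<rho>) / ((s + \<rho>) * p)"
    using s p \<rho> by (simp add: field_simps)
  then have "\<bar>1 / (s + \<rho>) - 1 / p\<bar> = \<bar>p - s - \<rho>\<bar> / ((s + \<rho>) * p)"
    using s p \<rho> by (simp add: abs_mult)
  also have "\<dots> \<le> (\<bar>v - p\<^sup>2\<bar> / p + \<rho>) / (p\<^sup>2 / 2)"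
    using sp \<rho> den p2 p by (intro frac_le) auto
  also have "\<dots> = 2 * (\<bar>v - p\<^sup>2\<bar> / p + \<rho>) / p\<^sup>2" by simp
  finally have "(1 / (s + \<rho>) - 1 / p)\<^sup>2 \<le> (2 * (\<bar>v - p\<^sup>2\<bar> / p + \<rho>) / p\<^sup>2)\<^sup>2"
    by (rule abs_le_square_iff[THEN iffD1, OF order_trans]) (rule abs_ge_self)
  also have "\<dots> = 4 * (\<bar>v - p\<^sup>2\<bar> / p + \<rho>)\<^sup>2 / p ^ 4"
  proof -
    have "(2 * x / p\<^sup>2)\<^sup>2 = 4 * x\<^sup>2 / p ^ 4" for x
      by (simp add: power_mult_distrib power_divide)
    then show ?thesis .
  qed
  also have "\<dots> \<le> 4 * (2 * ((\<bar>v - p\<^sup>2\<bar> / p)\<^sup>2 + \<rho>\<^sup>2)) / p ^ 4"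
  proof -
    have "(x + y)\<^sup>2 \<le> 2 * (x\<^sup>2 + y\<^sup>2)" for x y :: real
      using zero_le_power2[of "x - y"] by (simp add: power2_eq_square algebra_simps)
    then show ?thesis using p by (intro divide_right_mono mult_left_mono) auto
  qed
  also have "\<dots> = 8 * (v - p\<^sup>2)\<^sup>2 / p ^ 6 + 8 * \<rho>\<^sup>2 / p ^ 4"
    using p by (simp add: power_divide field_simps power2_eq_square eval_nat_numeral)
  finally show "(1 / (sqrt \<bar>v\<bar> + \<rho>) - 1 / p)\<^sup>2 \<le> 8 * (v - p\<^sup>2)\<^sup>2 / p ^ 6 + 8 * \<rho>\<^sup>2 / p ^ 4"
    by (simp only: s_def)
  have "1 / (s + \<rho>) \<le> 1 / (p / 2)" using s p \<rho> by (intro divide_left_mono) auto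
  then have 1: "1 / (s + \<rho>) \<le> 2 * (1 / p)" by simp
  have 2: "0 \<le> 1 / (s + \<rho>)" "0 < 1 / p" using s p \<rho> by simp_all
  have "\<bar>y - x\<bar> \<le> 3 * x" if "y \<le> 2 * x" "0 \<le> y" "0 < x" for x y :: real
    using that by linarith
  from this[OF 1 2] show "\<bar>1 / (sqrt \<bar>v\<bar> + \<rho>) - 1 / p\<bar> \<le> 3 / p"
    unfolding s_def[symmetric] by simp
qed

lemma measurable_fU_Ft_hat:
  assumes "t \<in> borel_measurable M"
    and w: "\<And>j k. j \<in> {1..n} \<Longrightarrow> k \<in> {1..N j} \<Longrightarrow> (\<lambda>x. w x j k) \<in> borel_measurable M"
  shows "(\<lambda>x. fU_Ft_hat N n (w x) (t x)) \<in> borel_measurable M"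
proof -
  have [measurable]: "(\<lambda>x. pair_avg N n (t x) (w x)) \<in> borel_measurable M"
    using assms by (rule measurable_pair_avg)
  show ?thesis unfolding fU_Ft_hat_eq by measurable
qed

text \<open>Cauchy-Schwarz with prescribed bounds on the second moments, from the
  arithmetic-geometric mean inequality with weights \<open>b / (2 * a)\<close> and
  \<open>a / (2 * b)\<close>.\<close>

lemma (in prob_space) expectation_mult_le:
  fixes f g :: "'a \<Rightarrow> complex"
  assumes [measurable]: "f \<in> borel_measurable M" "g \<in> borel_measurable M"
    and bd: "\<And>\<omega>. cmod (f \<omega>) \<le> B" "\<And>\<omega>. cmod (g \<omega>) \<le> B"
    and a: "a > 0" "b > 0" and fa: "(\<integral>\<omega>. (cmod (f \<omega>))\<^sup>2 \<partial>M) \<le> a\<^sup>2" and gb: "(\<integral>\<omega>. (cmod (g \<omega>))\<^sup>2 \<partial>M) \<le> b\<^sup>2"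
  shows "cmod (\<integral>\<omega>. f \<omega> * cnj (g \<omega>) \<partial>M) \<le> a * b"
proof -
  have i: "integrable M (\<lambda>\<omega>. (cmod (f \<omega>))\<^sup>2)" "integrable M (\<lambda>\<omega>. (cmod (g \<omega>))\<^sup>2)"
    using bd by (auto intro!: integrable_bounded[where B="B\<^sup>2"] power_mono)
  have le: "cmod (f \<omega> * cnj (g \<omega>)) \<le> (cmod (f \<omega>))\<^sup>2 * (b / (2 * a)) + (cmod (g \<omega>))\<^sup>2 * (a / (2 * b))" for \<omega>
  proof -
    have "2 * (cmod (f \<omega>) * b) * (cmod (g \<omega>) * a) \<le> (cmod (f \<omega>) * b)\<^sup>2 + (cmod (g \<omega>) * a)\<^sup>2"
      by (rule sum_squares_bound)
    then have "cmod (f \<omega>) * cmod (g \<omega>) * (2 * a * b) \<le> (cmod (f \<omega>))\<^sup>2 * b\<^sup>2 + (cmod (g \<omega>))\<^sup>2 * a\<^sup>2"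
      by (simp add: power_mult_distrib mult_ac)
    then have "cmod (f \<omega>) * cmod (g \<omega>) \<le> ((cmod (f \<omega>))\<^sup>2 * b\<^sup>2 + (cmod (g \<omega>))\<^sup>2 * a\<^sup>2) / (2 * a * b)"
      using a by (subst pos_le_divide_eq) auto
    also have "\<dots> = (cmod (f \<omega>))\<^sup>2 * (b / (2 * a)) + (cmod (g \<omega>))\<^sup>2 * (a / (2 * b))"
      using a by (simp add: field_simps power2_eq_square)
    finally show ?thesis by (simp add: norm_mult)
  qed
  have "cmod (\<integral>\<omega>. f \<omega> * cnj (g \<omega>) \<partial>M) \<le> (\<integral>\<omega>. cmod (f \<omega> * cnj (g \<omega>)) \<partial>M)"
    by (rule integral_norm_bound)
  also have "\<dots> \<le> (\<integral>\<omega>. (cmod (f \<omega>))\<^sup>2 * (b / (2 * a)) + (cmod (g \<omega>))\<^sup>2 * (a / (2 * b)) \<partial>M)"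
  proof (intro integral_mono le)
    have "cmod (f \<omega>) * cmod (g \<omega>) \<le> B * B" for \<omega>
      using order_trans[OF norm_ge_zero bd(1)] by (intro mult_mono bd) auto
    then show "integrable M (\<lambda>\<omega>. cmod (f \<omega> * cnj (g \<omega>)))"
      by (intro integrable_norm integrable_bounded[where B="B * B"]) (auto simp: norm_mult)
    show "integrable M (\<lambda>\<omega>. (cmod (f \<omega>))\<^sup>2 * (b / (2 * a)) + (cmod (g \<omega>))\<^sup>2 * (a / (2 * b)))"
      using i by (intro Bochner_Integration.integrable_add integrable_mult_left) auto
  qed
  also have "\<dots> = (\<integral>\<omega>. (cmod (f \<omega>))\<^sup>2 \<partial>M) * (b / (2 * a)) + (\<integral>\<omega>. (cmod (g \<omega>))\<^sup>2 \<partial>M) * (a / (2 * b))"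
    using i by simp
  also have "\<dots> \<le> a\<^sup>2 * (b / (2 * a)) + b\<^sup>2 * (a / (2 * b))"
    using a by (intro add_mono mult_right_mono fa gb) auto
  also have "\<dots> = a * b" using a by (simp add: field_simps power2_eq_square)
  finally show ?thesis .
qed

context bounded_replications
begin

definition inv_err :: "nat \<Rightarrow> real \<Rightarrow> real \<Rightarrow> (nat \<Rightarrow> nat \<Rightarrow> real) \<Rightarrow> real" where
  "inv_err n \<rho> t w = 1 / (fU_Ft_hat N n w t + \<rho>) - 1 / psi t"

definition block_avg :: "nat \<Rightarrow> real \<Rightarrow> (nat \<Rightarrow> nat \<Rightarrow> real) \<Rightarrow> complex" where
  "block_avg n t w = (\<Sum>j=1..n. block_sum N j t w) / of_real (num_obs N n)"

text \<open>The deterministic bound on the squared inverse error that the ridge provides, times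
  Hoeffding's probability of a deviation by \<open>p^2 / 2\<close>.\<close>

definition tail_term :: "nat \<Rightarrow> real \<Rightarrow> real \<Rightarrow> real" where
  "tail_term n \<rho> p = (1 / \<rho> + 1 / p)\<^sup>2 * (2 * exp (- real n * p ^ 4 / (2 * C1 ^ 6)))"

lemma fU_Ft_hat_nonneg: "fU_Ft_hat N n w t \<ge> 0"
  by (simp add: fU_Ft_hat_eq)

lemma abs_inv_err_le: "\<rho> > 0 \<Longrightarrow> \<bar>inv_err n \<rho> t w\<bar> \<le> 1 / \<rho> + 1 / psi t"
proof -
  assume r: "\<rho> > 0"
  have "1 / (fU_Ft_hat N n w t + \<rho>) \<le> 1 / \<rho>"
    using r fU_Ft_hat_nonneg[of n w t] by (intro divide_left_mono mult_pos_pos) auto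
  moreover have "0 \<le> 1 / (fU_Ft_hat N n w t + \<rho>)" using r fU_Ft_hat_nonneg[of n w t] by simp
  moreover have "0 \<le> 1 / psi t" "0 \<le> 1 / \<rho>" using psi_pos[of t] r by simp_all
  ultimately show ?thesis unfolding inv_err_def by linarith
qed

lemma measurable_inv_err:
  assumes [measurable]: "t \<in> borel_measurable M"
    and w: "\<And>j k. j \<in> {1..n} \<Longrightarrow> k \<in> {1..N j} \<Longrightarrow> (\<lambda>x. w x j k) \<in> borel_measurable M"
  shows "(\<lambda>x. inv_err n \<rho> (t x) (w x)) \<in> borel_measurable M"
proof -
  have [measurable]: "(\<lambda>x. fU_Ft_hat N n (w x) (t x)) \<in> borel_measurable M"
    using assms by (rule measurable_fU_Ft_hat)
  show ?thesis unfolding inv_err_def by measurable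
qed

lemma measurable_block_avg:
  assumes "t \<in> borel_measurable M"
    and w: "\<And>j k. j \<in> {1..n} \<Longrightarrow> k \<in> {1..N j} \<Longrightarrow> (\<lambda>x. w x j k) \<in> borel_measurable M"
  shows "(\<lambda>x. block_avg n (t x) (w x)) \<in> borel_measurable M"
  unfolding block_avg_def using assms
  by (intro borel_measurable_divide borel_measurable_const borel_measurable_sum measurable_block_sum) auto

lemma cmod_block_avg_le_1: "n \<ge> 1 \<Longrightarrow> cmod (block_avg n t w) \<le> 1"
proof -
  assume n: "n \<ge> 1"
  have M: "num_obs N n > 0" using num_obs_ge[of n] n by linarith
  have "cmod (\<Sum>j=1..n. block_sum N j t w) \<le> (\<Sum>j=1..n. real (N j))"
    by (intro order_trans[OF norm_sum] sum_mono cmod_block_sum_le)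
  then have "cmod (\<Sum>j=1..n. block_sum N j t w) \<le> num_obs N n" by (simp only: num_obs_def)
  then show ?thesis using M by (simp add: block_avg_def norm_divide)
qed

lemma measurable_errs_inv_err [measurable]: "(\<lambda>\<omega>. inv_err n \<rho> t (errs \<omega>)) \<in> borel_measurable P"
  by (intro measurable_inv_err measurable_U) auto

lemma measurable_errs_block_avg [measurable]: "(\<lambda>\<omega>. block_avg n t (errs \<omega>)) \<in> borel_measurable P"
  by (intro measurable_block_avg measurable_U) auto

context
  fixes n :: nat and \<rho> t :: real
  assumes n: "n \<ge> 1" and \<rho>: "\<rho> > 0"
begin

definition far :: "'w set" where
  "far = {\<omega> \<in> space P. \<bar>pair_avg N n t (errs \<omega>) - (psi t)\<^sup>2\<bar> \<ge> (psi t)\<^sup>2 / 2}"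

lemma far_sets [measurable]: "far \<in> sets P"
  unfolding far_def by measurable

lemma prob_far_le: "prob far \<le> 2 * exp (- real n * (psi t) ^ 4 / (2 * C1 ^ 6))"
  using tail_pair_avg_le[OF n, of "(psi t)\<^sup>2 / 2" t]
  by (simp add: far_def power_divide)

lemma integrable_pair_avg_sq: "integrable P (\<lambda>\<omega>. (pair_avg N n t (errs \<omega>) - (psi t)\<^sup>2)\<^sup>2)"
proof (rule integrable_bounded)
  let ?D = "\<lambda>\<omega>. pair_avg N n t (errs \<omega>) - (psi t)\<^sup>2"
  fix \<omega>
  have "\<bar>\<Sum>j=1..n. Y t j \<omega>\<bar> \<le> (\<Sum>j=1..n. (real (N j))\<^sup>2 / 2 + real (N j) / 2)"
    by (intro order_trans[OF sum_abs] sum_mono abs_Y_le)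
  then have "\<bar>pair_avg N n t (errs \<omega>)\<bar> \<le> (\<Sum>j=1..n. (real (N j))\<^sup>2 / 2 + real (N j) / 2) / num_pairs N n"
    using num_pairs_pos[OF n] by (simp add: pair_avg_eq_sum_Y divide_right_mono)
  moreover have "\<bar>?D \<omega>\<bar> \<le> \<bar>pair_avg N n t (errs \<omega>)\<bar> + (psi t)\<^sup>2"
    using abs_triangle_ineq4[of "pair_avg N n t (errs \<omega>)" "(psi t)\<^sup>2"] by simp
  ultimately have "\<bar>?D \<omega>\<bar> \<le> (\<Sum>j=1..n. (real (N j))\<^sup>2 / 2 + real (N j) / 2) / num_pairs N n + (psi t)\<^sup>2" by linarith
  then have "\<bar>?D \<omega>\<bar>\<^sup>2 \<le> ((\<Sum>j=1..n. (real (N j))\<^sup>2 / 2 + real (N j) / 2) / num_pairs N n + (psi t)\<^sup>2)\<^sup>2"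
    by (intro power_mono) auto
  then show "norm ((?D \<omega>)\<^sup>2) \<le> ((\<Sum>j=1..n. (real (N j))\<^sup>2 / 2 + real (N j) / 2) / num_pairs N n + (psi t)\<^sup>2)\<^sup>2" by simp
qed measurable

lemma second_moment_inv_err_le:
  "(\<integral>\<omega>. (inv_err n \<rho> t (errs \<omega>))\<^sup>2 \<partial>P)
    \<le> 8 * (C1 ^ 6 / real n) / (psi t) ^ 6 + 8 * \<rho>\<^sup>2 / (psi t) ^ 4 + tail_term n \<rho> (psi t)"
proof -
  let ?p = "psi t" and ?D = "\<lambda>\<omega>. pair_avg N n t (errs \<omega>) - (psi t)\<^sup>2"
  let ?b = "1 / \<rho> + 1 / ?p"
  have p: "?p > 0" by (rule psi_pos)
  have le: "(inv_err n \<rho> t (errs \<omega>))\<^sup>2 \<le> 8 * (?D \<omega>)\<^sup>2 / ?p ^ 6 + 8 * \<rho>\<^sup>2 / ?p ^ 4 + ?b\<^sup>2 * indicator far \<omega>"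
    if w: "\<omega> \<in> space P" for \<omega>
  proof (cases "\<omega> \<in> far")
    case True
    have "\<bar>inv_err n \<rho> t (errs \<omega>)\<bar>\<^sup>2 \<le> ?b\<^sup>2" using \<rho> by (intro power_mono abs_inv_err_le) auto
    then have "(inv_err n \<rho> t (errs \<omega>))\<^sup>2 \<le> ?b\<^sup>2" by simp
    moreover have "0 \<le> 8 * (?D \<omega>)\<^sup>2 / ?p ^ 6" "0 \<le> 8 * \<rho>\<^sup>2 / ?p ^ 4" using p by simp_all
    moreover have "indicator far \<omega> = (1 :: real)" using True by simp
    ultimately show ?thesis by (simp only: mult_1_right)
  next
    case False
    then have "\<bar>?D \<omega>\<bar> < ?p\<^sup>2 / 2" using w by (simp add: far_def)
    from inverse_error_near(1)[OF p less_imp_le[OF \<rho>] this] False show ?thesis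
      by (simp add: inv_err_def fU_Ft_hat_eq)
  qed
  have i: "integrable P (\<lambda>\<omega>. 8 * (?D \<omega>)\<^sup>2 / ?p ^ 6)"
    using integrable_pair_avg_sq by simp
  have i2: "integrable P (\<lambda>\<omega>. ?b\<^sup>2 * indicator far \<omega>)"
    by (intro integrable_bounded[where B="?b\<^sup>2"]) (auto simp: indicator_def)
  have "(\<integral>\<omega>. (inv_err n \<rho> t (errs \<omega>))\<^sup>2 \<partial>P)
     \<le> (\<integral>\<omega>. 8 * (?D \<omega>)\<^sup>2 / ?p ^ 6 + 8 * \<rho>\<^sup>2 / ?p ^ 4 + ?b\<^sup>2 * indicator far \<omega> \<partial>P)"
  proof (intro integral_mono le)
    show "integrable P (\<lambda>\<omega>. (inv_err n \<rho> t (errs \<omega>))\<^sup>2)"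
    proof (rule integrable_bounded)
      show "norm ((inv_err n \<rho> t (errs \<omega>))\<^sup>2) \<le> ?b\<^sup>2" for \<omega>
        using power_mono[OF abs_inv_err_le[OF \<rho>, of n t "errs \<omega>"], of 2] by simp
    qed measurable
    show "integrable P (\<lambda>\<omega>. 8 * (?D \<omega>)\<^sup>2 / ?p ^ 6 + 8 * \<rho>\<^sup>2 / ?p ^ 4 + ?b\<^sup>2 * indicator far \<omega>)"
      using i i2 by (intro Bochner_Integration.integrable_add) auto
  qed
  also have "\<dots> = 8 * (\<integral>\<omega>. (?D \<omega>)\<^sup>2 \<partial>P) / ?p ^ 6 + 8 * \<rho>\<^sup>2 / ?p ^ 4 + ?b\<^sup>2 * prob far"
    using i i2 prob_space by simp
  also have "\<dots> \<le> 8 * (C1 ^ 6 / real n) / ?p ^ 6 + 8 * \<rho>\<^sup>2 / ?p ^ 4 + ?b\<^sup>2 * (2 * exp (- real n * ?p ^ 4 / (2 * C1 ^ 6)))"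
    using p by (intro add_mono divide_right_mono mult_left_mono second_moment_pair_avg_le n prob_far_le order_refl) auto
  finally show ?thesis by (simp add: tail_term_def)
qed

text \<open>The leading term gains a factor \<open>(psi t)^2\<close> over
  \<open>second_moment_inv_err_le\<close>. The block average splits into its mean
  \<open>psi t\<close>, paired with the sharp bound on the inverse error, and a fluctuation with
  second moment at most \<open>4 / n\<close>, for which the crude bound \<open>3 / psi t\<close> is
  enough; twice its square is the origin of 18.\<close>

lemma second_moment_avg_inv_err_le:
  "(\<integral>\<omega>. (cmod (block_avg n t (errs \<omega>) * of_real (inv_err n \<rho> t (errs \<omega>))))\<^sup>2 \<partial>P)
    \<le> 16 * (C1 ^ 6 / real n) / (psi t) ^ 4 + 16 * \<rho>\<^sup>2 / (psi t)\<^sup>2 + 18 * (4 / real n) / (psi t)\<^sup>2 + tail_term n \<rho> (psi t)"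
proof -
  let ?p = "psi t" and ?D = "\<lambda>\<omega>. pair_avg N n t (errs \<omega>) - (psi t)\<^sup>2"
  let ?R = "\<lambda>\<omega>. inv_err n \<rho> t (errs \<omega>)" and ?E = "\<lambda>\<omega>. block_avg n t (errs \<omega>)"
  let ?G = "\<lambda>\<omega>. (cmod (?E \<omega> - of_real ?p))\<^sup>2"
  let ?b = "1 / \<rho> + 1 / ?p"
  have p: "?p > 0" by (rule psi_pos)
  have sq: "(cmod (?E \<omega> * of_real (?R \<omega>)))\<^sup>2 = (cmod (?E \<omega>))\<^sup>2 * (?R \<omega>)\<^sup>2" for \<omega>
    by (simp add: norm_mult power_mult_distrib)
  have bsq: "(cmod (?E \<omega> * of_real (?R \<omega>)))\<^sup>2 \<le> ?b\<^sup>2" for \<omega>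
  proof -
    have "cmod (?E \<omega> * of_real (?R \<omega>)) \<le> 1 * ?b"
      unfolding norm_mult norm_of_real using \<rho> n
      by (intro mult_mono cmod_block_avg_le_1 abs_inv_err_le) auto
    then show ?thesis by (intro power_mono) auto
  qed
  have le: "(cmod (?E \<omega> * of_real (?R \<omega>)))\<^sup>2
      \<le> 16 * (?D \<omega>)\<^sup>2 / ?p ^ 4 + 16 * \<rho>\<^sup>2 / ?p\<^sup>2 + 18 * ?G \<omega> / ?p\<^sup>2 + ?b\<^sup>2 * indicator far \<omega>"
    if w: "\<omega> \<in> space P" for \<omega>
  proof (cases "\<omega> \<in> far")
    case True
    have "0 \<le> 16 * (?D \<omega>)\<^sup>2 / ?p ^ 4" "0 \<le> 16 * \<rho>\<^sup>2 / ?p\<^sup>2" "0 \<le> 18 * ?G \<omega> / ?p\<^sup>2" using p by simp_all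
    moreover have "indicator far \<omega> = (1 :: real)" using True by simp
    ultimately show ?thesis using bsq[of \<omega>] by (simp only: mult_1_right)
  next
    case False
    then have d: "\<bar>?D \<omega>\<bar> < ?p\<^sup>2 / 2" using w by (simp add: far_def)
    have R1: "(?R \<omega>)\<^sup>2 \<le> 8 * (?D \<omega>)\<^sup>2 / ?p ^ 6 + 8 * \<rho>\<^sup>2 / ?p ^ 4" and "\<bar>?R \<omega>\<bar> \<le> 3 / ?p"
      using inverse_error_near[OF p less_imp_le[OF \<rho>] d] by (simp_all add: inv_err_def fU_Ft_hat_eq)
    then have "\<bar>?R \<omega>\<bar>\<^sup>2 \<le> (3 / ?p)\<^sup>2" by (intro power_mono) auto
    then have R2: "(?R \<omega>)\<^sup>2 \<le> 9 / ?p\<^sup>2" by (simp add: power_divide)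
    have "cmod (?E \<omega>) \<le> ?p + cmod (?E \<omega> - of_real ?p)"
      using norm_triangle_sub[of "?E \<omega>" "of_real ?p"] p by simp
    then have "(cmod (?E \<omega>))\<^sup>2 \<le> (?p + cmod (?E \<omega> - of_real ?p))\<^sup>2" by (intro power_mono) auto
    also have "\<dots> \<le> 2 * ?p\<^sup>2 + 2 * ?G \<omega>"
      using zero_le_power2[of "?p - cmod (?E \<omega> - of_real ?p)"] by (simp add: power2_eq_square algebra_simps)
    finally have "(cmod (?E \<omega>))\<^sup>2 * (?R \<omega>)\<^sup>2 \<le> (2 * ?p\<^sup>2 + 2 * ?G \<omega>) * (?R \<omega>)\<^sup>2"
      by (intro mult_right_mono) auto
    also have "\<dots> = 2 * ?p\<^sup>2 * (?R \<omega>)\<^sup>2 + 2 * ?G \<omega> * (?R \<omega>)\<^sup>2" by (simp add: distrib_right)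
    also have "\<dots> \<le> 2 * ?p\<^sup>2 * (8 * (?D \<omega>)\<^sup>2 / ?p ^ 6 + 8 * \<rho>\<^sup>2 / ?p ^ 4) + 2 * ?G \<omega> * (9 / ?p\<^sup>2)"
      by (intro add_mono mult_left_mono R1 R2) auto
    also have "\<dots> = 16 * (?D \<omega>)\<^sup>2 / ?p ^ 4 + 16 * \<rho>\<^sup>2 / ?p\<^sup>2 + 18 * ?G \<omega> / ?p\<^sup>2"
    proof -
      have "2 * x\<^sup>2 * (8 * d / x ^ 6 + 8 * r / x ^ 4) + 2 * G * (9 / x\<^sup>2) = 16 * d / x ^ 4 + 16 * r / x\<^sup>2 + 18 * G / x\<^sup>2"
        if "x > 0" for x d r G :: real
        using that by (simp add: field_simps power2_eq_square eval_nat_numeral)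
      from this[OF p] show ?thesis .
    qed
    finally show ?thesis unfolding sq using False by simp
  qed
  have iD: "integrable P (\<lambda>\<omega>. 16 * (?D \<omega>)\<^sup>2 / ?p ^ 4)" using integrable_pair_avg_sq by simp
  have iG: "integrable P ?G"
  proof (rule integrable_bounded)
    fix \<omega>
    have "cmod (?E \<omega> - of_real ?p) \<le> 1 + 1"
      using p psi_le_1[of t] n by (intro order_trans[OF norm_triangle_ineq4] add_mono cmod_block_avg_le_1) auto
    then have "(cmod (?E \<omega> - of_real ?p))\<^sup>2 \<le> 2\<^sup>2" by (intro power_mono) auto
    then show "norm (?G \<omega>) \<le> 4" by simp
  qed measurable
  have iF: "integrable P (\<lambda>\<omega>. ?b\<^sup>2 * indicator far \<omega>)"
    by (intro integrable_bounded[where B="?b\<^sup>2"]) (auto simp: indicator_def)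
  have G: "integral\<^sup>L P ?G \<le> 4 / real n"
    using second_moment_block_avg_le[OF n, of t] by (simp add: block_avg_def)
  have "(\<integral>\<omega>. (cmod (?E \<omega> * of_real (?R \<omega>)))\<^sup>2 \<partial>P)
     \<le> (\<integral>\<omega>. 16 * (?D \<omega>)\<^sup>2 / ?p ^ 4 + 16 * \<rho>\<^sup>2 / ?p\<^sup>2 + 18 * ?G \<omega> / ?p\<^sup>2 + ?b\<^sup>2 * indicator far \<omega> \<partial>P)"
  proof (intro integral_mono le)
    show "integrable P (\<lambda>\<omega>. (cmod (?E \<omega> * of_real (?R \<omega>)))\<^sup>2)"
      using bsq by (intro integrable_bounded[where B="?b\<^sup>2"]) auto
    show "integrable P (\<lambda>\<omega>. 16 * (?D \<omega>)\<^sup>2 / ?p ^ 4 + 16 * \<rho>\<^sup>2 / ?p\<^sup>2 + 18 * ?G \<omega> / ?p\<^sup>2 + ?b\<^sup>2 * indicator far \<omega>)"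
      using iD iG iF by (intro Bochner_Integration.integrable_add) auto
  qed
  also have "\<dots> = 16 * (\<integral>\<omega>. (?D \<omega>)\<^sup>2 \<partial>P) / ?p ^ 4 + 16 * \<rho>\<^sup>2 / ?p\<^sup>2 + 18 * integral\<^sup>L P ?G / ?p\<^sup>2 + ?b\<^sup>2 * prob far"
    using iD iG iF prob_space by simp
  also have "\<dots> \<le> 16 * (C1 ^ 6 / real n) / ?p ^ 4 + 16 * \<rho>\<^sup>2 / ?p\<^sup>2 + 18 * (4 / real n) / ?p\<^sup>2
      + ?b\<^sup>2 * (2 * exp (- real n * ?p ^ 4 / (2 * C1 ^ 6)))"
    using p by (intro add_mono divide_right_mono mult_left_mono second_moment_pair_avg_le n prob_far_le G order_refl) auto
  finally show ?thesis by (simp add: tail_term_def)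
qed

end

end

section \<open>Covariance of the estimation error\<close>

context bounded_replications
begin

abbreviation err_index :: "nat \<Rightarrow> (nat + nat \<times> nat) set" where
  "err_index n \<equiv> Inr ` (SIGMA j:{1..n}. {1..N j})"

definition emp_cf :: "nat \<Rightarrow> real \<Rightarrow> 'w \<Rightarrow> complex" where
  "emp_cf n t \<omega> = (\<Sum>j=1..n. cis (t * X j \<omega>) * block_sum N j t (errs \<omega>)) / of_real (num_obs N n)"

lemma emp_cf_eq: "emp_cf n t \<omega> = (\<Sum>j=1..n. \<Sum>k=1..N j. cis (t * obs X U \<omega> j k)) / of_real (num_obs N n)"
  unfolding emp_cf_def block_sum_def sum_distrib_left
  by (simp add: obs_def cis_mult distrib_left)

text \<open>\<open>g\<close> takes whole arrays as arguments, and \<open>g_cong\<close> expresses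
  that it reads only the first \<open>n\<close> blocks. It therefore factors through the coordinates
  in \<open>err_index n\<close>, which are disjoint from those of the signals.\<close>

lemma expectation_signal_times_errors:
  fixes g :: "(nat \<Rightarrow> nat \<Rightarrow> real) \<Rightarrow> complex"
  assumes ij: "i \<in> {1..n}" "j \<in> {1..n}"
    and g_cong: "\<And>w w'. (\<And>j k. j \<in> {1..n} \<Longrightarrow> k \<in> {1..N j} \<Longrightarrow> w j k = w' j k) \<Longrightarrow> g w = g w'"
    and g_meas: "(\<lambda>y. g (\<lambda>j k. y (Inr (j, k)))) \<in> borel_measurable (PiM (err_index n) (\<lambda>_. borel))"
    and bd: "\<And>w. cmod (g w) \<le> B"
  shows "(\<integral>\<omega>. (cis (t * X i \<omega>) * cnj (cis (s * X j \<omega>))) * g (errs \<omega>) \<partial>P)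
    = (\<integral>\<omega>. cis (t * X i \<omega>) * cnj (cis (s * X j \<omega>)) \<partial>P) * (\<integral>\<omega>. g (errs \<omega>) \<partial>P)"
proof (rule indep_var_lebesgue_integral)
  let ?A = "{Inl i, Inl j} :: (nat + nat \<times> nat) set"
  let ?rA = "\<lambda>\<omega>. restrict (\<lambda>i. Z i \<omega>) ?A" and ?rB = "\<lambda>\<omega>. restrict (\<lambda>i. Z i \<omega>) (err_index n)"
  have "indep_var (PiM ?A (\<lambda>_. borel)) ?rA (PiM (err_index n) (\<lambda>_. borel)) ?rB"
    using ij by (intro indep_var_restrict[OF indep_Z]) auto
  then have "indep_var borel ((\<lambda>y. cis (t * y (Inl i)) * cnj (cis (s * y (Inl j)))) \<circ> ?rA)
      borel ((\<lambda>y. g (\<lambda>j k. y (Inr (j, k)))) \<circ> ?rB)"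
    by (rule indep_var_compose) (measurable, rule g_meas)
  moreover have "(\<lambda>y. cis (t * y (Inl i)) * cnj (cis (s * y (Inl j)))) \<circ> ?rA = (\<lambda>\<omega>. cis (t * X i \<omega>) * cnj (cis (s * X j \<omega>)))"
    by (auto simp: fun_eq_iff)
  moreover have "(\<lambda>y. g (\<lambda>j k. y (Inr (j, k)))) \<circ> ?rB = (\<lambda>\<omega>. g (errs \<omega>))"
    by (auto simp: fun_eq_iff intro!: g_cong)
  ultimately show ind: "indep_var borel (\<lambda>\<omega>. cis (t * X i \<omega>) * cnj (cis (s * X j \<omega>))) borel (\<lambda>\<omega>. g (errs \<omega>))"
    by simp
  show "integrable P (\<lambda>\<omega>. cis (t * X i \<omega>) * cnj (cis (s * X j \<omega>)))"
    using indep_var_rv1[OF ind] by (rule integrable_bounded[where B=1]) (simp add: norm_mult)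
  show "integrable P (\<lambda>\<omega>. g (errs \<omega>))"
    using indep_var_rv2[OF ind] bd by (rule integrable_bounded)
qed

text \<open>Written as a term common to all pairs plus a correction on the diagonal: in this form
  the double sum over blocks closes up to a product of two block averages.\<close>

lemma expectation_cis_X_pair:
  assumes "i \<ge> 1" "j \<ge> 1"
  shows "(\<integral>\<omega>. cis (t * X i \<omega>) * cnj (cis (s * X j \<omega>)) \<partial>P)
    = FT fX t * cnj (FT fX s) + (if j = i then FT fX (t - s) - FT fX t * cnj (FT fX s) else 0)"
proof (cases "i = j")
  case True
  have "(\<integral>\<omega>. cis (t * X i \<omega>) * cnj (cis (s * X i \<omega>)) \<partial>P) = (\<integral>\<omega>. cis ((t - s) * X i \<omega>) \<partial>P)"
    by (simp add: cis_cnj cis_mult left_diff_distrib)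
  then show ?thesis using True expectation_cis_X[OF assms(1)] by simp
next
  case False
  have "(\<integral>\<omega>. cis (t * Z (Inl i) \<omega>) * cis (- s * Z (Inl j) \<omega>) \<partial>P)
      = (\<integral>\<omega>. cis (t * Z (Inl i) \<omega>) \<partial>P) * (\<integral>\<omega>. cis (- s * Z (Inl j) \<omega>) \<partial>P)"
    using assms False by (intro expectation_mult_Z[where B=1]) auto
  then show ?thesis using False
    unfolding Z_simps expectation_cis_X[OF assms(1)] expectation_cis_X[OF assms(2)]
    by (simp add: cis_cnj FT_minus)
qed

text \<open>The common term of all pairs multiplies the complete double sum, which is
  \<open>num_obs N n\<close> squared times a cross moment of averages; there the better bounds
  \<open>ut\<close>, \<open>us\<close> apply. The diagonal correction has only \<open>n\<close>
  terms and makes do with \<open>rt\<close>, \<open>rs\<close>: the sum of \<open>(N i)^2\<close> is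
  at most \<open>C1 * num_obs N n\<close>, so one factor \<open>1 / num_obs N n\<close>
  survives.\<close>

lemma covariance_bound:
  assumes n: "n \<ge> 1" and \<rho>: "\<rho> > 0"
    and pos: "ut > 0" "us > 0" "rt > 0" "rs > 0"
    and ut: "(\<integral>\<omega>. (cmod (block_avg n t (errs \<omega>) * of_real (inv_err n \<rho> t (errs \<omega>))))\<^sup>2 \<partial>P) \<le> ut\<^sup>2"
    and us: "(\<integral>\<omega>. (cmod (block_avg n s (errs \<omega>) * of_real (inv_err n \<rho> s (errs \<omega>))))\<^sup>2 \<partial>P) \<le> us\<^sup>2"
    and rt: "(\<integral>\<omega>. (inv_err n \<rho> t (errs \<omega>))\<^sup>2 \<partial>P) \<le> rt\<^sup>2"
    and rs: "(\<integral>\<omega>. (inv_err n \<rho> s (errs \<omega>))\<^sup>2 \<partial>P) \<le> rs\<^sup>2"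
  shows "cmod (\<integral>\<omega>. (emp_cf n t \<omega> * of_real (inv_err n \<rho> t (errs \<omega>))) * cnj (emp_cf n s \<omega> * of_real (inv_err n \<rho> s (errs \<omega>))) \<partial>P)
    \<le> cmod (FT fX t) * cmod (FT fX s) * (ut * us)
      + C1 / real n * (cmod (FT fX (t - s)) + cmod (FT fX t) * cmod (FT fX s)) * (rt * rs)"
proof -
  let ?M = "num_obs N n" and ?R = "\<lambda>t w. inv_err n \<rho> t w"
  have M: "?M > 0" using num_obs_ge[of n] n by linarith
  \<comment> \<open>The inverse error is absorbed into the block sum. The product depends on errors
    alone, but through all first \<open>n\<close> blocks and not just block \<open>j\<close>, so the
    \<open>b j\<close> are not independent; only the signals can be averaged out.\<close>
  define b where "b j t w = block_sum N j t w * of_real (?R t w)" for j t w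
  define g where "g i j w = b i t w * cnj (b j s w)" for i j w
  define q where "q u = 1 / \<rho> + 1 / psi u" for u
  have q: "\<bar>?R u w\<bar> \<le> q u" "q u \<ge> 0" for u w
    using abs_inv_err_le[OF \<rho>] psi_pos[of u] \<rho> by (auto simp: q_def)
  have b_bd: "cmod (b j u w) \<le> real (N j) * q u" for j u w
    unfolding b_def norm_mult norm_of_real using q by (intro mult_mono cmod_block_sum_le) auto
  have g_bd: "cmod (g i j w) \<le> (real (N i) * q t) * (real (N j) * q s)" for i j w
    unfolding g_def norm_mult complex_mod_cnj using q by (intro mult_mono b_bd) auto
  have b_meas: "(\<lambda>x. b j u (w x)) \<in> borel_measurable M'"
    if "j \<in> {1..n}" and "\<And>j k. j \<in> {1..n} \<Longrightarrow> k \<in> {1..N j} \<Longrightarrow> (\<lambda>x. w x j k) \<in> borel_measurable M'"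
    for j u w and M' :: "'z measure"
  proof -
    have [measurable]: "(\<lambda>x. ?R u (w x)) \<in> borel_measurable M'" using that by (intro measurable_inv_err) auto
    have [measurable]: "(\<lambda>x. block_sum N j u (w x)) \<in> borel_measurable M'" using that by (intro measurable_block_sum) auto
    show ?thesis unfolding b_def by measurable
  qed
  have g_meas: "(\<lambda>x. g i j (w x)) \<in> borel_measurable M'"
    if "i \<in> {1..n}" "j \<in> {1..n}" and "\<And>j k. j \<in> {1..n} \<Longrightarrow> k \<in> {1..N j} \<Longrightarrow> (\<lambda>x. w x j k) \<in> borel_measurable M'"
    for i j w and M' :: "'z measure"
  proof -
    have [measurable]: "(\<lambda>x. b i t (w x)) \<in> borel_measurable M'" "(\<lambda>x. b j s (w x)) \<in> borel_measurable M'"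
      using that by (auto intro: b_meas)
    show ?thesis unfolding g_def by measurable
  qed
  have b_cong: "b j u w = b j u w'"
    if "j \<in> {1..n}" and "\<And>j k. j \<in> {1..n} \<Longrightarrow> k \<in> {1..N j} \<Longrightarrow> w j k = w' j k" for j u w w'
  proof -
    have "block_sum N j u w = block_sum N j u w'" using that by (intro block_sum_cong) auto
    moreover have "pair_avg N n u w = pair_avg N n u w'" using that by (intro pair_avg_cong) auto
    ultimately show ?thesis by (simp add: b_def inv_err_def fU_Ft_hat_eq)
  qed
  define h where "h i j = (\<integral>\<omega>. g i j (errs \<omega>) \<partial>P)" for i j
  have g_int: "integrable P (\<lambda>\<omega>. g i j (errs \<omega>))" if "i \<in> {1..n}" "j \<in> {1..n}" for i j
    using that by (intro integrable_bounded[OF g_meas g_bd] measurable_U) auto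
  have XU: "(\<integral>\<omega>. (cis (t * X i \<omega>) * cnj (cis (s * X j \<omega>))) * g i j (errs \<omega>) \<partial>P)
      = (FT fX t * cnj (FT fX s) + (if j = i then FT fX (t - s) - FT fX t * cnj (FT fX s) else 0)) * h i j"
    if ij: "i \<in> {1..n}" "j \<in> {1..n}" for i j
  proof -
    have "(\<integral>\<omega>. (cis (t * X i \<omega>) * cnj (cis (s * X j \<omega>))) * g i j (errs \<omega>) \<partial>P)
       = (\<integral>\<omega>. cis (t * X i \<omega>) * cnj (cis (s * X j \<omega>)) \<partial>P) * (\<integral>\<omega>. g i j (errs \<omega>) \<partial>P)"
    proof (rule expectation_signal_times_errors[OF ij])
      show "g i j w = g i j w'" if "\<And>j k. j \<in> {1..n} \<Longrightarrow> k \<in> {1..N j} \<Longrightarrow> w j k = w' j k" for w w'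
        unfolding g_def using b_cong[of i w w'] b_cong[of j w w'] ij that by simp
      show "(\<lambda>y. g i j (\<lambda>j k. y (Inr (j, k)))) \<in> borel_measurable (PiM (err_index n) (\<lambda>_. borel))"
        using ij by (intro g_meas measurable_component_singleton) auto
    qed (rule g_bd)
    then show ?thesis using ij by (simp add: expectation_cis_X_pair h_def)
  qed
  have prod: "(emp_cf n t \<omega> * of_real (?R t (errs \<omega>))) * cnj (emp_cf n s \<omega> * of_real (?R s (errs \<omega>)))
      = (\<Sum>i=1..n. \<Sum>j=1..n. (cis (t * X i \<omega>) * cnj (cis (s * X j \<omega>))) * g i j (errs \<omega>)) / of_real (?M\<^sup>2)" for \<omega>
  proof -
    have e: "emp_cf n u \<omega> * of_real (?R u (errs \<omega>)) = (\<Sum>i=1..n. cis (u * X i \<omega>) * b i u (errs \<omega>)) / of_real ?M" for u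
      by (simp add: emp_cf_def b_def sum_distrib_right mult.assoc)
    have "(\<Sum>i=1..n. cis (t * X i \<omega>) * b i t (errs \<omega>)) * cnj (\<Sum>j=1..n. cis (s * X j \<omega>) * b j s (errs \<omega>))
       = (\<Sum>i=1..n. \<Sum>j=1..n. (cis (t * X i \<omega>) * cnj (cis (s * X j \<omega>))) * g i j (errs \<omega>))"
      unfolding cnj_sum sum_product g_def by (intro sum.cong refl) (simp add: mult_ac)
    then show ?thesis unfolding e by (simp add: power2_eq_square)
  qed
  have term_int: "integrable P (\<lambda>\<omega>. (cis (t * X i \<omega>) * cnj (cis (s * X j \<omega>))) * g i j (errs \<omega>))"
    if ij: "i \<in> {1..n}" "j \<in> {1..n}" for i j
  proof (rule integrable_bounded)
    have [measurable]: "X i \<in> borel_measurable P" "X j \<in> borel_measurable P" "(\<lambda>\<omega>. g i j (errs \<omega>)) \<in> borel_measurable P"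
      using ij measurable_X g_int by auto
    show "(\<lambda>\<omega>. (cis (t * X i \<omega>) * cnj (cis (s * X j \<omega>))) * g i j (errs \<omega>)) \<in> borel_measurable P" by measurable
    show "norm ((cis (t * X i \<omega>) * cnj (cis (s * X j \<omega>))) * g i j (errs \<omega>)) \<le> (real (N i) * q t) * (real (N j) * q s)" for \<omega>
      using g_bd[of i j "errs \<omega>"] by (simp add: norm_mult)
  qed
  let ?p = "FT fX t * cnj (FT fX s)"
  have "(\<integral>\<omega>. (emp_cf n t \<omega> * of_real (?R t (errs \<omega>))) * cnj (emp_cf n s \<omega> * of_real (?R s (errs \<omega>))) \<partial>P)
      = (\<integral>\<omega>. (\<Sum>i=1..n. \<Sum>j=1..n. (cis (t * X i \<omega>) * cnj (cis (s * X j \<omega>))) * g i j (errs \<omega>)) \<partial>P) / of_real (?M\<^sup>2)"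
    unfolding prod by (rule integral_divide_zero)
  also have "(\<integral>\<omega>. (\<Sum>i=1..n. \<Sum>j=1..n. (cis (t * X i \<omega>) * cnj (cis (s * X j \<omega>))) * g i j (errs \<omega>)) \<partial>P)
      = (\<Sum>i=1..n. \<Sum>j=1..n. (?p + (if j = i then FT fX (t - s) - ?p else 0)) * h i j)"
    by (simp only: Bochner_Integration.integral_sum Bochner_Integration.integrable_sum term_int XU cong: sum.cong)
  also have "\<dots> = ?p * (\<Sum>i=1..n. \<Sum>j=1..n. h i j) + (\<Sum>i=1..n. (FT fX (t - s) - ?p) * h i i)"
    unfolding sum_distrib_left sum.distrib[symmetric]
  proof (intro sum.cong refl)
    fix i assume i: "i \<in> {1..n}"
    have "(\<Sum>j=1..n. (?p + (if j = i then FT fX (t - s) - ?p else 0)) * h i j)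
       = (\<Sum>j=1..n. ?p * h i j + (if j = i then (FT fX (t - s) - ?p) * h i i else 0))"
      by (intro sum.cong) (auto simp: algebra_simps)
    then show "(\<Sum>j=1..n. (?p + (if j = i then FT fX (t - s) - ?p else 0)) * h i j)
       = (\<Sum>j=1..n. ?p * h i j) + (FT fX (t - s) - ?p) * h i i"
      using i by (simp add: sum.distrib)
  qed
  also have "(\<Sum>i=1..n. \<Sum>j=1..n. h i j)
      = of_real (?M\<^sup>2) * (\<integral>\<omega>. (block_avg n t (errs \<omega>) * of_real (?R t (errs \<omega>))) * cnj (block_avg n s (errs \<omega>) * of_real (?R s (errs \<omega>))) \<partial>P)"
  proof -
    have "(\<Sum>i=1..n. \<Sum>j=1..n. h i j) = (\<integral>\<omega>. (\<Sum>i=1..n. \<Sum>j=1..n. g i j (errs \<omega>)) \<partial>P)"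
      unfolding h_def
      by (simp only: Bochner_Integration.integral_sum Bochner_Integration.integrable_sum g_int cong: sum.cong)
    also have "\<dots> = (\<integral>\<omega>. of_real (?M\<^sup>2) * ((block_avg n t (errs \<omega>) * of_real (?R t (errs \<omega>))) * cnj (block_avg n s (errs \<omega>) * of_real (?R s (errs \<omega>)))) \<partial>P)"
    proof (intro Bochner_Integration.integral_cong refl)
      fix \<omega>
      have e: "of_real ?M * (block_avg n u (errs \<omega>) * of_real (?R u (errs \<omega>))) = (\<Sum>i=1..n. b i u (errs \<omega>))" for u
        using M by (simp add: block_avg_def b_def sum_distrib_right)
      have "(\<Sum>i=1..n. \<Sum>j=1..n. g i j (errs \<omega>)) = (\<Sum>i=1..n. b i t (errs \<omega>)) * cnj (\<Sum>i=1..n. b i s (errs \<omega>))"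
        unfolding g_def cnj_sum sum_product ..
      then show "(\<Sum>i=1..n. \<Sum>j=1..n. g i j (errs \<omega>)) = of_real (?M\<^sup>2) * ((block_avg n t (errs \<omega>) * of_real (?R t (errs \<omega>))) * cnj (block_avg n s (errs \<omega>) * of_real (?R s (errs \<omega>))))"
        unfolding e[symmetric] by (simp add: power2_eq_square mult_ac)
    qed
    finally show ?thesis by simp
  qed
  finally have eq: "(\<integral>\<omega>. (emp_cf n t \<omega> * of_real (?R t (errs \<omega>))) * cnj (emp_cf n s \<omega> * of_real (?R s (errs \<omega>))) \<partial>P)
     = ?p * (\<integral>\<omega>. (block_avg n t (errs \<omega>) * of_real (?R t (errs \<omega>))) * cnj (block_avg n s (errs \<omega>) * of_real (?R s (errs \<omega>))) \<partial>P)
      + (\<Sum>i=1..n. (FT fX (t - s) - ?p) * h i i) / of_real (?M\<^sup>2)"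
    (is "?lhs = ?p * ?I + ?S / _")
    using M by (simp add: add_divide_distrib)
  have I: "cmod ?I \<le> ut * us"
  proof (rule expectation_mult_le)
    show "cmod (block_avg n t (errs \<omega>) * of_real (?R t (errs \<omega>))) \<le> max (q t) (q s)" for \<omega>
      unfolding norm_mult norm_of_real using mult_mono[OF cmod_block_avg_le_1[OF n] q(1)] by (simp add: le_max_iff_disj)
    show "cmod (block_avg n s (errs \<omega>) * of_real (?R s (errs \<omega>))) \<le> max (q t) (q s)" for \<omega>
      unfolding norm_mult norm_of_real using mult_mono[OF cmod_block_avg_le_1[OF n] q(1)] by (simp add: le_max_iff_disj)
  qed (use pos ut us in auto)
  have b2: "(\<integral>\<omega>. (cmod (b i u (errs \<omega>)))\<^sup>2 \<partial>P) \<le> (real (N i) * r)\<^sup>2"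
    if i: "i \<in> {1..n}" and r: "(\<integral>\<omega>. (?R u (errs \<omega>))\<^sup>2 \<partial>P) \<le> r\<^sup>2" for i u r
  proof -
    have [measurable]: "(\<lambda>\<omega>. b i u (errs \<omega>)) \<in> borel_measurable P"
      using i by (intro b_meas measurable_U) auto
    have "(\<integral>\<omega>. (cmod (b i u (errs \<omega>)))\<^sup>2 \<partial>P) \<le> (\<integral>\<omega>. (real (N i))\<^sup>2 * (?R u (errs \<omega>))\<^sup>2 \<partial>P)"
    proof (rule integral_mono)
      have "(cmod (b i u (errs \<omega>)))\<^sup>2 \<le> (real (N i) * q u)\<^sup>2" for \<omega>
        by (intro power_mono b_bd) auto
      then show "integrable P (\<lambda>\<omega>. (cmod (b i u (errs \<omega>)))\<^sup>2)"
        by (intro integrable_bounded[where B="(real (N i) * q u)\<^sup>2"]) auto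
      have "\<bar>?R u (errs \<omega>)\<bar>\<^sup>2 \<le> (q u)\<^sup>2" for \<omega> using q by (intro power_mono) auto
      then show "integrable P (\<lambda>\<omega>. (real (N i))\<^sup>2 * (?R u (errs \<omega>))\<^sup>2)"
        by (intro integrable_mult_right integrable_bounded[where B="(q u)\<^sup>2"]) auto
      show "(cmod (b i u (errs \<omega>)))\<^sup>2 \<le> (real (N i))\<^sup>2 * (?R u (errs \<omega>))\<^sup>2" for \<omega>
        unfolding b_def norm_mult power_mult_distrib
        by (simp add: mult_right_mono power_mono cmod_block_sum_le)
    qed
    also have "\<dots> \<le> (real (N i))\<^sup>2 * r\<^sup>2" using r by (simp add: mult_left_mono)
    finally show ?thesis by (simp add: power_mult_distrib)
  qed
  have hii: "cmod (h i i) \<le> (real (N i))\<^sup>2 * (rt * rs)" if i: "i \<in> {1..n}" for i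
  proof -
    have Ni: "real (N i) > 0" using N_bounds[of i] i by auto
    have "cmod (h i i) \<le> (real (N i) * rt) * (real (N i) * rs)"
      unfolding h_def g_def
    proof (rule expectation_mult_le)
      show "(\<lambda>\<omega>. b i t (errs \<omega>)) \<in> borel_measurable P" "(\<lambda>\<omega>. b i s (errs \<omega>)) \<in> borel_measurable P"
        using i by (auto intro!: b_meas measurable_U)
      show "cmod (b i t (errs \<omega>)) \<le> max (real (N i) * q t) (real (N i) * q s)" for \<omega>
        using b_bd[of i t "errs \<omega>"] by (simp add: le_max_iff_disj)
      show "cmod (b i s (errs \<omega>)) \<le> max (real (N i) * q t) (real (N i) * q s)" for \<omega>
        using b_bd[of i s "errs \<omega>"] by (simp add: le_max_iff_disj)
    qed (use Ni pos b2[OF i rt] b2[OF i rs] in auto)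
    then show ?thesis by (simp add: power2_eq_square mult_ac)
  qed
  let ?d = "cmod (FT fX (t - s)) + cmod (FT fX t) * cmod (FT fX s)"
  have d: "cmod (FT fX (t - s) - ?p) \<le> ?d"
    by (rule order_trans[OF norm_triangle_ineq4]) (simp add: norm_mult)
  have "cmod ?S \<le> (\<Sum>i=1..n. ?d * ((C1 * real (N i)) * (rt * rs)))"
  proof (intro sum_norm_le)
    fix i assume i: "i \<in> {1..n}"
    have "(real (N i))\<^sup>2 * (rt * rs) \<le> C1 * real (N i) * (rt * rs)"
      using N_bounds[of i] i pos by (intro mult_right_mono) (auto simp: power2_eq_square)
    with hii[OF i] have "cmod (h i i) \<le> C1 * real (N i) * (rt * rs)" by linarith
    then show "cmod ((FT fX (t - s) - ?p) * h i i) \<le> ?d * (C1 * real (N i) * (rt * rs))"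
      unfolding norm_mult using d by (intro mult_mono) auto
  qed
  also have "\<dots> = ?d * (C1 * ?M * (rt * rs))"
    unfolding num_obs_def by (simp add: sum_distrib_left sum_distrib_right)
  finally have S: "cmod ?S \<le> ?d * (C1 * ?M * (rt * rs))" .
  have "cmod ?lhs \<le> cmod (?p * ?I) + cmod (?S / of_real (?M\<^sup>2))"
    unfolding eq by (rule norm_triangle_ineq)
  also have "cmod (?p * ?I) \<le> cmod (FT fX t) * cmod (FT fX s) * (ut * us)"
    unfolding norm_mult complex_mod_cnj using I by (intro mult_left_mono) auto
  also have "cmod (?S / of_real (?M\<^sup>2)) \<le> ?d * (C1 * ?M * (rt * rs)) / ?M\<^sup>2"
    unfolding norm_divide norm_of_real using S by (simp add: divide_right_mono)
  also have "\<dots> = C1 * (?d * (rt * rs)) / ?M" using M by (simp add: power2_eq_square)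
  also have "\<dots> \<le> C1 * (?d * (rt * rs)) / real n"
    using n num_obs_ge[of n] C1 pos M by (intro divide_left_mono mult_nonneg_nonneg add_nonneg_nonneg mult_pos_pos) auto
  also have "\<dots> = C1 / real n * ?d * (rt * rs)" by simp
  finally show ?thesis by simp
qed

end

section \<open>Mean squared error with a ridge\<close>

text \<open>Holds for non-integrable \<open>f\<close> as well, since the Bochner integral is then 0
  by convention. This makes it usable inside iterated integrals.\<close>

lemma ennreal_norm_integral_le:
  fixes f :: "'a \<Rightarrow> 'b::{banach, second_countable_topology}"
  shows "ennreal (norm (\<integral>x. f x \<partial>M)) \<le> (\<integral>\<^sup>+x. ennreal (norm (f x)) \<partial>M)"
proof (cases "integrable M f")
  case True
  then show ?thesis by (rule integral_norm_bound_ennreal)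
next
  case False
  then show ?thesis by (simp add: not_integrable_integral_eq)
qed

section \<open>Integrals of power weights\<close>

lemma nn_integral_abs_le:
  fixes f :: "real \<Rightarrow> real"
  assumes [measurable]: "f \<in> borel_measurable borel" "A \<in> sets borel" and A: "\<And>s. s \<in> A \<Longrightarrow> - s \<in> A"
  shows "(\<integral>\<^sup>+s. ennreal (f \<bar>s\<bar>) * indicator A s \<partial>lborel) \<le> 2 * (\<integral>\<^sup>+s. ennreal (f s) * indicator (A \<inter> {0..}) s \<partial>lborel)"
proof -
  let ?g = "\<lambda>s. ennreal (f s) * indicator (A \<inter> {0..}) s"
  have "(\<integral>\<^sup>+s. ennreal (f \<bar>s\<bar>) * indicator A s \<partial>lborel) \<le> (\<integral>\<^sup>+s. ?g s + ?g (0 + (-1) * s) \<partial>lborel)"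
    using A by (intro nn_integral_mono) (auto simp: indicator_def abs_if)
  also have "\<dots> = (\<integral>\<^sup>+s. ?g s \<partial>lborel) + (\<integral>\<^sup>+s. ?g (0 + (-1) * s) \<partial>lborel)"
    by (intro nn_integral_add) measurable
  also have "(\<integral>\<^sup>+s. ?g (0 + (-1) * s) \<partial>lborel) = (\<integral>\<^sup>+s. ?g s \<partial>lborel)"
    by (subst nn_integral_real_affine[of ?g "-1" 0]) auto
  finally show ?thesis by (simp add: mult_2)
qed

lemma nn_integral_powr_interval_le:
  fixes \<gamma> T :: real
  assumes "\<gamma> > 0" "T \<ge> 0"
  shows "(\<integral>\<^sup>+s. ennreal ((1 + \<bar>s\<bar>) powr (\<gamma> - 1)) * indicator {-T..T} s \<partial>lborel) \<le> ennreal (2 * ((1 + T) powr \<gamma> / \<gamma>))"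
proof -
  have "(\<integral>\<^sup>+s. ennreal ((1 + \<bar>s\<bar>) powr (\<gamma> - 1)) * indicator {-T..T} s \<partial>lborel)
     \<le> 2 * (\<integral>\<^sup>+s. ennreal ((1 + s) powr (\<gamma> - 1)) * indicator ({-T..T} \<inter> {0..}) s \<partial>lborel)"
    by (rule nn_integral_abs_le[of "\<lambda>s. (1 + s) powr (\<gamma> - 1)"]) auto
  also have "{-T..T} \<inter> {0..} = {0..T}" using assms by auto
  also have "2 * (\<integral>\<^sup>+s. ennreal ((1 + s) powr (\<gamma> - 1)) * indicator {0..T} s \<partial>lborel) \<le> 2 * ennreal ((1 + T) powr \<gamma> / \<gamma>)"
  proof (rule mult_left_mono)
    have "(\<integral>\<^sup>+s. ennreal ((1 + s) powr (\<gamma> - 1)) * indicator {0..T} s \<partial>lborel) = ennreal ((1 + T) powr \<gamma> / \<gamma> - (1 + 0) powr \<gamma> / \<gamma>)"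
    proof (rule nn_integral_FTC_Icc)
      fix s :: real assume "s \<in> {0..T}"
      then show "((\<lambda>s. (1 + s) powr \<gamma> / \<gamma>) has_real_derivative (1 + s) powr (\<gamma> - 1)) (at s)"
        using assms by (auto intro!: derivative_eq_intros)
    qed (use assms in auto)
    also have "\<dots> \<le> ennreal ((1 + T) powr \<gamma> / \<gamma>)" using assms by (intro ennreal_leI) auto
    finally show "(\<integral>\<^sup>+s. ennreal ((1 + s) powr (\<gamma> - 1)) * indicator {0..T} s \<partial>lborel) \<le> ennreal ((1 + T) powr \<gamma> / \<gamma>)" .
  qed simp
  also have "2 * ennreal ((1 + T) powr \<gamma> / \<gamma>) = ennreal (2 * ((1 + T) powr \<gamma> / \<gamma>))"
    using assms by (simp add: ennreal_mult'[symmetric] flip: ennreal_numeral)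
  finally show ?thesis .
qed

lemma nn_integral_powr_real_line_le:
  fixes \<beta> :: real
  assumes "\<beta> > 1"
  shows "(\<integral>\<^sup>+s. ennreal ((1 + \<bar>s\<bar>) powr - \<beta>) \<partial>lborel) \<le> ennreal (2 / (\<beta> - 1))"
proof -
  have "(\<integral>\<^sup>+s. ennreal ((1 + \<bar>s\<bar>) powr - \<beta>) * indicator UNIV s \<partial>lborel)
     \<le> 2 * (\<integral>\<^sup>+s. ennreal ((1 + s) powr - \<beta>) * indicator (UNIV \<inter> {0..}) s \<partial>lborel)"
    by (rule nn_integral_abs_le[of "\<lambda>s. (1 + s) powr - \<beta>"]) auto
  also have "(\<integral>\<^sup>+s. ennreal ((1 + s) powr - \<beta>) * indicator (UNIV \<inter> {0..}) s \<partial>lborel)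
      = (\<integral>\<^sup>+s. ennreal ((1 + s) powr - \<beta>) * indicator {0..} s \<partial>lborel)" by simp
  also have "\<dots> = ennreal (0 - (1 + 0) powr (1 - \<beta>) / (1 - \<beta>))"
  proof (rule nn_integral_FTC_atLeast)
    fix s :: real assume "0 \<le> s"
    then show "((\<lambda>s. (1 + s) powr (1 - \<beta>) / (1 - \<beta>)) has_real_derivative (1 + s) powr - \<beta>) (at s)"
      using assms by (auto intro!: derivative_eq_intros)
  next
    have "((\<lambda>s :: real. (1 + s) powr (1 - \<beta>)) \<longlongrightarrow> 0) at_top"
      using assms by (intro tendsto_neg_powr filterlim_tendsto_add_at_top[OF tendsto_const] filterlim_ident) auto
    then have "((\<lambda>s :: real. (1 + s) powr (1 - \<beta>) / (1 - \<beta>)) \<longlongrightarrow> 0 / (1 - \<beta>)) at_top"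
      using assms by (intro tendsto_intros) auto
    then show "((\<lambda>s :: real. (1 + s) powr (1 - \<beta>) / (1 - \<beta>)) \<longlongrightarrow> 0) at_top" by simp
  qed auto
  also have "0 - (1 + 0) powr (1 - \<beta>) / (1 - \<beta>) = 1 / (\<beta> - 1)"
    using assms by (simp add: field_simps)
  also have "2 * ennreal (1 / (\<beta> - 1)) = ennreal (2 / (\<beta> - 1))"
    using assms by (simp add: ennreal_mult'[symmetric] flip: ennreal_numeral)
  finally show ?thesis by simp
qed

section \<open>Second moments of random integrals\<close>

context prob_space
begin

lemma integrable_strip:
  fixes f :: "real \<times> 'a \<Rightarrow> complex"
  assumes [measurable]: "f \<in> borel_measurable (lborel \<Otimes>\<^sub>M M)"
    and bd: "\<And>t \<omega>. cmod (f (t, \<omega>)) \<le> B * indicator {-T..T} t"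
  shows "integrable (lborel \<Otimes>\<^sub>M M) f"
proof (rule Bochner_Integration.integrable_bound)
  let ?A = "{-T..T} \<times> space M"
  have "emeasure (lborel \<Otimes>\<^sub>M M) ?A = emeasure lborel {-T..T} * emeasure M (space M)"
    by (intro emeasure_pair_measure_Times) auto
  also have "\<dots> < \<infinity>" by (simp add: emeasure_space_1 emeasure_lborel_Icc_eq)
  finally show "integrable (lborel \<Otimes>\<^sub>M M) (\<lambda>p. B * indicator ?A p)"
    by (intro integrable_mult_right integrable_real_indicator) auto
  show "AE p in lborel \<Otimes>\<^sub>M M. norm (f p) \<le> norm (B * indicator ?A p)"
  proof (rule AE_I2)
    fix p :: "real \<times> 'a" assume "p \<in> space (lborel \<Otimes>\<^sub>M M)"
    then obtain t \<omega> where p: "p = (t, \<omega>)" "\<omega> \<in> space M" by (auto simp: space_pair_measure)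
    have "indicator ?A p = (indicator {-T..T} t :: real)" using p by (simp add: indicator_def)
    then show "norm (f p) \<le> norm (B * indicator ?A p)" using bd[of t \<omega>] p by simp
  qed
qed measurable

text \<open>The second moment of the integral is the double integral of the covariance. Fubini is
  applied first to \<open>W t * cnj F\<close>, with \<open>F\<close> the whole integral, and then
  inside \<open>F\<close>; each time joint integrability concerns a bounded function on the strip
  \<open>{-T..T} \<times> space M\<close>.\<close>

lemma second_moment_integral_le:
  fixes W :: "real \<Rightarrow> 'a \<Rightarrow> complex" and \<kappa> :: "real \<Rightarrow> real \<Rightarrow> real"
  assumes meas: "(\<lambda>(t, \<omega>). W t \<omega>) \<in> borel_measurable (lborel \<Otimes>\<^sub>M M)"
    and bd: "\<And>t \<omega>. cmod (W t \<omega>) \<le> b * indicator {-T..T} t" and b: "b \<ge> 0" and T: "T \<ge> 0"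
    and cov: "\<And>t s. \<bar>t\<bar> \<le> T \<Longrightarrow> \<bar>s\<bar> \<le> T \<Longrightarrow> cmod (\<integral>\<omega>. W t \<omega> * cnj (W s \<omega>) \<partial>M) \<le> \<kappa> t s"
  shows "(\<integral>\<^sup>+\<omega>. ennreal ((cmod (\<integral>t. W t \<omega> \<partial>lborel))\<^sup>2) \<partial>M)
    \<le> (\<integral>\<^sup>+t. (\<integral>\<^sup>+s. ennreal (\<kappa> t s) * indicator {-T..T} s \<partial>lborel) * indicator {-T..T} t \<partial>lborel)"
proof -
  interpret pair_sigma_finite lborel M ..
  have W_comp: "(\<lambda>x. W (f x) (g x)) \<in> borel_measurable M'"
    if "f \<in> borel_measurable M'" "g \<in> measurable M' M" for f g and M' :: "'z measure"
  proof -
    have "(\<lambda>x. (f x, g x)) \<in> measurable M' (lborel \<Otimes>\<^sub>M M)"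
      using that by (intro measurable_Pair) auto
    from measurable_compose[OF this meas] show ?thesis by simp
  qed
  define F where "F \<omega> = (\<integral>t. W t \<omega> \<partial>lborel)" for \<omega>
  have F_meas [measurable]: "F \<in> borel_measurable M"
  proof -
    have "(\<lambda>x. W (snd x) (fst x)) \<in> borel_measurable (M \<Otimes>\<^sub>M lborel)"
      by (intro W_comp) measurable
    then have "(\<lambda>(\<omega>, t). W t \<omega>) \<in> borel_measurable (M \<Otimes>\<^sub>M lborel)"
      by (simp add: case_prod_beta)
    from lborel.borel_measurable_lebesgue_integral[OF this] show ?thesis
      by (simp add: F_def [abs_def])
  qed
  have F_bd: "cmod (F \<omega>) \<le> b * (2 * T)" for \<omega>
  proof -
    have "ennreal (cmod (F \<omega>)) \<le> (\<integral>\<^sup>+t. ennreal (cmod (W t \<omega>)) \<partial>lborel)"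
      unfolding F_def by (rule ennreal_norm_integral_le)
    also have "\<dots> \<le> (\<integral>\<^sup>+t. ennreal b * indicator {-T..T} t \<partial>lborel)"
      by (intro nn_integral_mono order_trans[OF ennreal_leI[OF bd]]) (auto simp: indicator_def)
    also have "\<dots> = ennreal (b * (2 * T))"
      using b T by (simp add: nn_integral_cmult ennreal_mult)
    finally show ?thesis using b T by (subst (asm) ennreal_le_iff) auto
  qed
  have I: "integrable (lborel \<Otimes>\<^sub>M M) (\<lambda>(t, \<omega>). W t \<omega> * cnj (F \<omega>))"
  proof (rule integrable_strip)
    have "(\<lambda>x. W (fst x) (snd x) * cnj (F (snd x))) \<in> borel_measurable (lborel \<Otimes>\<^sub>M M)"
      by (intro borel_measurable_times W_comp) measurable
    then show "(\<lambda>(t, \<omega>). W t \<omega> * cnj (F \<omega>)) \<in> borel_measurable (lborel \<Otimes>\<^sub>M M)"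
      by (simp add: case_prod_beta)
    fix t \<omega>
    have "cmod (W t \<omega>) * cmod (F \<omega>) \<le> (b * indicator {-T..T} t) * (b * (2 * T))"
      using b T by (intro mult_mono bd F_bd) auto
    then show "cmod (case (t, \<omega>) of (t, \<omega>) \<Rightarrow> W t \<omega> * cnj (F \<omega>)) \<le> (b * (b * (2 * T))) * indicator {-T..T} t"
      by (simp add: norm_mult mult_ac)
  qed
  have J: "integrable (lborel \<Otimes>\<^sub>M M) (\<lambda>(s, \<omega>). W t \<omega> * cnj (W s \<omega>))" for t
  proof (rule integrable_strip)
    have "(\<lambda>x. W t (snd x) * cnj (W (fst x) (snd x))) \<in> borel_measurable (lborel \<Otimes>\<^sub>M M)"
      by (intro borel_measurable_times measurable_compose[OF _ measurable_cnj] W_comp) measurable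
    then show "(\<lambda>(s, \<omega>). W t \<omega> * cnj (W s \<omega>)) \<in> borel_measurable (lborel \<Otimes>\<^sub>M M)"
      by (simp add: case_prod_beta)
    fix s \<omega>
    have "cmod (W t \<omega>) * cmod (W s \<omega>) \<le> (b * 1) * (b * indicator {-T..T} s)"
      using b by (intro mult_mono bd order_trans[OF bd mult_left_mono]) auto
    then show "cmod (case (s, \<omega>) of (s, \<omega>) \<Rightarrow> W t \<omega> * cnj (W s \<omega>)) \<le> (b * b) * indicator {-T..T} s"
      by (simp add: norm_mult mult_ac)
  qed
  have inner: "(\<integral>\<omega>. W t \<omega> * cnj (F \<omega>) \<partial>M) = (\<integral>s. (\<integral>\<omega>. W t \<omega> * cnj (W s \<omega>) \<partial>M) \<partial>lborel)" for t
  proof -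
    have "(\<integral>\<omega>. W t \<omega> * cnj (F \<omega>) \<partial>M) = (\<integral>\<omega>. (\<integral>s. W t \<omega> * cnj (W s \<omega>) \<partial>lborel) \<partial>M)"
      by (simp add: F_def)
    also have "\<dots> = (\<integral>s. (\<integral>\<omega>. W t \<omega> * cnj (W s \<omega>) \<partial>M) \<partial>lborel)"
      by (rule Fubini_integral[OF J])
    finally show ?thesis .
  qed
  have "complex_of_real (\<integral>\<omega>. (cmod (F \<omega>))\<^sup>2 \<partial>M) = (\<integral>\<omega>. of_real ((cmod (F \<omega>))\<^sup>2) \<partial>M)"
    by (rule integral_complex_of_real[symmetric])
  also have "\<dots> = (\<integral>\<omega>. (\<integral>t. W t \<omega> * cnj (F \<omega>) \<partial>lborel) \<partial>M)"
    unfolding complex_norm_square by (simp add: F_def)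
  also have "\<dots> = (\<integral>t. (\<integral>\<omega>. W t \<omega> * cnj (F \<omega>) \<partial>M) \<partial>lborel)"
    by (rule Fubini_integral[OF I])
  also have "\<dots> = (\<integral>t. (\<integral>s. (\<integral>\<omega>. W t \<omega> * cnj (W s \<omega>) \<partial>M) \<partial>lborel) \<partial>lborel)"
    unfolding inner ..
  finally have "cmod (complex_of_real (\<integral>\<omega>. (cmod (F \<omega>))\<^sup>2 \<partial>M))
      = cmod (\<integral>t. (\<integral>s. (\<integral>\<omega>. W t \<omega> * cnj (W s \<omega>) \<partial>M) \<partial>lborel) \<partial>lborel)" by (rule arg_cong)
  then have "\<bar>\<integral>\<omega>. (cmod (F \<omega>))\<^sup>2 \<partial>M\<bar> = cmod (\<integral>t. (\<integral>s. (\<integral>\<omega>. W t \<omega> * cnj (W s \<omega>) \<partial>M) \<partial>lborel) \<partial>lborel)"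
    by (simp only: norm_of_real)
  moreover have "(\<integral>\<^sup>+\<omega>. ennreal ((cmod (F \<omega>))\<^sup>2) \<partial>M) = ennreal (\<integral>\<omega>. (cmod (F \<omega>))\<^sup>2 \<partial>M)"
  proof (rule nn_integral_eq_integral)
    have "(cmod (F \<omega>))\<^sup>2 \<le> (b * (2 * T))\<^sup>2" for \<omega> by (intro power_mono F_bd) auto
    then show "integrable M (\<lambda>\<omega>. (cmod (F \<omega>))\<^sup>2)"
      by (intro integrable_bounded[where B="(b * (2 * T))\<^sup>2"]) auto
  qed simp
  ultimately have "(\<integral>\<^sup>+\<omega>. ennreal ((cmod (F \<omega>))\<^sup>2) \<partial>M)
      \<le> ennreal (cmod (\<integral>t. (\<integral>s. (\<integral>\<omega>. W t \<omega> * cnj (W s \<omega>) \<partial>M) \<partial>lborel) \<partial>lborel))"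
    by (simp add: ennreal_leI)
  also have "\<dots> \<le> (\<integral>\<^sup>+t. ennreal (cmod (\<integral>s. (\<integral>\<omega>. W t \<omega> * cnj (W s \<omega>) \<partial>M) \<partial>lborel)) \<partial>lborel)"
    by (rule ennreal_norm_integral_le)
  also have "\<dots> \<le> (\<integral>\<^sup>+t. (\<integral>\<^sup>+s. ennreal (cmod (\<integral>\<omega>. W t \<omega> * cnj (W s \<omega>) \<partial>M)) \<partial>lborel) \<partial>lborel)"
    by (intro nn_integral_mono ennreal_norm_integral_le)
  also have "\<dots> \<le> (\<integral>\<^sup>+t. (\<integral>\<^sup>+s. ennreal (\<kappa> t s) * indicator {-T..T} s \<partial>lborel) * indicator {-T..T} t \<partial>lborel)"
  proof (intro nn_integral_mono)
    fix t
    have Z0: "W u \<omega> = 0" if "u \<notin> {-T..T}" for u \<omega> using bd[of u \<omega>] that by simp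
    show "(\<integral>\<^sup>+s. ennreal (cmod (\<integral>\<omega>. W t \<omega> * cnj (W s \<omega>) \<partial>M)) \<partial>lborel)
       \<le> (\<integral>\<^sup>+s. ennreal (\<kappa> t s) * indicator {-T..T} s \<partial>lborel) * indicator {-T..T} t"
    proof (cases "t \<in> {-T..T}")
      case True
      have "ennreal (cmod (\<integral>\<omega>. W t \<omega> * cnj (W s \<omega>) \<partial>M)) \<le> ennreal (\<kappa> t s) * indicator {-T..T} s" for s
      proof (cases "s \<in> {-T..T}")
        case s: True
        then show ?thesis using True cov[of t s] by (auto intro!: ennreal_leI)
      next
        case False
        then show ?thesis by (simp add: Z0)
      qed
      then show ?thesis using True by (simp add: nn_integral_mono)
    next
      case False
      then show ?thesis by (simp add: Z0)
    qed
  qed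
  finally show ?thesis by (simp only: F_def)
qed

end

text \<open>The substitution \<open>t = h * s\<close> turns the kernel average into an inversion
  integral of the empirical characteristic function. The multiplier \<open>m\<close> stays open so
  that the estimators with ridge, without ridge and with known error density are all
  instances.\<close>

lemma fourier_scaled_average:
  fixes m :: "real \<Rightarrow> complex"
  assumes h: "h > 0" and int: "integrable lborel (\<lambda>t. FT K t * m (t / h))"
  shows "complex_of_real (1 / (num_obs N n * h)) *
      (\<Sum>j=1..n. \<Sum>k=1..N j. complex_of_real (1 / (2 * pi)) *
        (\<integral>t. iexp (- (t * ((x - w j k) / h))) * (FT K t * m (t / h)) \<partial>lborel))
    = complex_of_real (1 / (2 * pi)) * (\<integral>s. cis (- (s * x)) * (FT K (h * s) * m s) *
        ((\<Sum>j=1..n. \<Sum>k=1..N j. cis (s * w j k)) / of_real (num_obs N n)) \<partial>lborel)"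
    and "integrable lborel (\<lambda>s. cis (- (s * x)) * (FT K (h * s) * m s) *
        ((\<Sum>j=1..n. \<Sum>k=1..N j. cis (s * w j k)) / of_real (num_obs N n)))"
proof -
  define G where "G s = FT K (h * s) * m s" for s
  have G: "integrable lborel G"
    using lborel_integrable_real_affine[OF int, of h 0] h by (simp add: G_def [abs_def])
  have Gx: "integrable lborel (\<lambda>s. cis (- (s * x)) * G s * cis (s * v))" for v
  proof (rule Bochner_Integration.integrable_bound[OF G])
    have [measurable]: "G \<in> borel_measurable borel" using G by auto
    show "(\<lambda>s. cis (- (s * x)) * G s * cis (s * v)) \<in> borel_measurable lborel" by measurable
  qed (simp add: norm_mult)
  have int_eq: "(\<integral>t. iexp (- (t * ((x - v) / h))) * (FT K t * m (t / h)) \<partial>lborel)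
      = of_real h * (\<integral>s. cis (- (s * x)) * G s * cis (s * v) \<partial>lborel)" for v
  proof -
    have "(\<integral>t. iexp (- (t * ((x - v) / h))) * (FT K t * m (t / h)) \<partial>lborel)
       = \<bar>h\<bar> *\<^sub>R (\<integral>s. iexp (- ((0 + h * s) * ((x - v) / h))) * (FT K (0 + h * s) * m ((0 + h * s) / h)) \<partial>lborel)"
      using h by (intro lborel_integral_real_affine) auto
    also have "(\<lambda>s. iexp (- ((0 + h * s) * ((x - v) / h))) * (FT K (0 + h * s) * m ((0 + h * s) / h)))
       = (\<lambda>s. cis (- (s * x)) * G s * cis (s * v))"
    proof
      fix s
      have "- ((0 + h * s) * ((x - v) / h)) = - (s * x) + s * v" using h by (simp add: field_simps)
      then have e: "iexp (- ((0 + h * s) * ((x - v) / h))) = cis (- (s * x)) * cis (s * v)"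
        by (simp only: cis_conv_exp[symmetric] cis_mult)
      show "iexp (- ((0 + h * s) * ((x - v) / h))) * (FT K (0 + h * s) * m ((0 + h * s) / h)) = cis (- (s * x)) * G s * cis (s * v)"
        unfolding e using h by (simp add: G_def)
    qed
    finally show ?thesis using h by (simp add: scaleR_conv_of_real)
  qed
  have sum_eq: "cis (- (s * x)) * G s * ((\<Sum>j=1..n. \<Sum>k=1..N j. cis (s * w j k)) / of_real (num_obs N n))
      = (\<Sum>j=1..n. \<Sum>k=1..N j. cis (- (s * x)) * G s * cis (s * w j k)) / of_real (num_obs N n)" for s
    by (simp add: sum_distrib_left)
  show "integrable lborel (\<lambda>s. cis (- (s * x)) * (FT K (h * s) * m s) *
        ((\<Sum>j=1..n. \<Sum>k=1..N j. cis (s * w j k)) / of_real (num_obs N n)))"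
    unfolding G_def[symmetric] sum_eq
    by (intro integrable_divide_zero Bochner_Integration.integrable_sum Gx)
  have avg: "(\<integral>s. cis (- (s * x)) * G s * ((\<Sum>j=1..n. \<Sum>k=1..N j. cis (s * w j k)) / of_real (num_obs N n)) \<partial>lborel)
      = (\<Sum>j=1..n. \<Sum>k=1..N j. (\<integral>s. cis (- (s * x)) * G s * cis (s * w j k) \<partial>lborel)) / of_real (num_obs N n)"
    unfolding sum_eq
    by (simp only: integral_divide_zero Bochner_Integration.integral_sum Bochner_Integration.integrable_sum Gx)
  show "complex_of_real (1 / (num_obs N n * h)) *
      (\<Sum>j=1..n. \<Sum>k=1..N j. complex_of_real (1 / (2 * pi)) *
        (\<integral>t. iexp (- (t * ((x - w j k) / h))) * (FT K t * m (t / h)) \<partial>lborel))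
    = complex_of_real (1 / (2 * pi)) * (\<integral>s. cis (- (s * x)) * (FT K (h * s) * m s) *
        ((\<Sum>j=1..n. \<Sum>k=1..N j. cis (s * w j k)) / of_real (num_obs N n)) \<partial>lborel)"
    unfolding int_eq G_def[symmetric] avg sum_distrib_left[symmetric] using h by simp
qed

lemma integrable_of_bounded_support:
  fixes g :: "real \<Rightarrow> complex"
  assumes "g \<in> borel_measurable borel" "\<And>t. cmod (g t) \<le> B * indicator {-c..c} t"
  shows "integrable lborel g"
proof (rule Bochner_Integration.integrable_bound)
  show "integrable lborel (\<lambda>t. B * indicator {-c..c} t)"
    by (intro integrable_mult_right integrable_real_indicator) (auto simp: emeasure_lborel_Icc_eq)
  show "AE t in lborel. norm (g t) \<le> norm (B * indicator {-c..c} t)"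
    using assms(2) by (intro AE_I2) (auto intro: order_trans abs_ge_self)
qed (use assms in auto)

text \<open>The first weight factorises into one-dimensional integrals. The second has an integral
  over \<open>s\<close> bounded uniformly in \<open>t\<close>, so it costs only the length
  \<open>2 * T\<close> of the range of \<open>t\<close>.\<close>

lemma nn_integral_two_point_kernel_le:
  fixes a d T \<gamma> \<beta> :: real
  assumes a: "a \<ge> 0" and d: "d \<ge> 0" and T: "T \<ge> 0" and \<gamma>: "\<gamma> > 0" and \<beta>: "\<beta> > 1"
  shows "(\<integral>\<^sup>+t. (\<integral>\<^sup>+s. ennreal (a * ((1 + \<bar>t\<bar>) powr (\<gamma> - 1) * (1 + \<bar>s\<bar>) powr (\<gamma> - 1))
        + d * ((1 + \<bar>t - s\<bar>) powr - \<beta> + (1 + \<bar>s\<bar>) powr - \<beta>)) * indicator {-T..T} s \<partial>lborel) * indicator {-T..T} t \<partial>lborel)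
    \<le> ennreal (a * (2 * ((1 + T) powr \<gamma> / \<gamma>))\<^sup>2 + d * (4 / (\<beta> - 1)) * (2 * T))"
proof -
  let ?f = "\<lambda>t :: real. ennreal ((1 + \<bar>t\<bar>) powr (\<gamma> - 1))" and ?i = "indicator {-T..T} :: real \<Rightarrow> ennreal"
  let ?b = "\<lambda>t :: real. ennreal ((1 + \<bar>t\<bar>) powr - \<beta>)"
  let ?I = "ennreal (2 * ((1 + T) powr \<gamma> / \<gamma>))" and ?J = "ennreal (2 / (\<beta> - 1))"
  have I: "(\<integral>\<^sup>+s. ?f s * ?i s \<partial>lborel) \<le> ?I" using \<gamma> T by (rule nn_integral_powr_interval_le)
  have J: "(\<integral>\<^sup>+s. ?b s \<partial>lborel) \<le> ?J" using \<beta> by (rule nn_integral_powr_real_line_le)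
  have Jt: "(\<integral>\<^sup>+s. ?b (t - s) \<partial>lborel) \<le> ?J" for t
    using J nn_integral_real_affine[of ?b "-1" t] by simp
  have inner: "(\<integral>\<^sup>+s. ennreal (a * ((1 + \<bar>t\<bar>) powr (\<gamma> - 1) * (1 + \<bar>s\<bar>) powr (\<gamma> - 1))
        + d * ((1 + \<bar>t - s\<bar>) powr - \<beta> + (1 + \<bar>s\<bar>) powr - \<beta>)) * ?i s \<partial>lborel)
      \<le> ennreal a * ?f t * ?I + ennreal d * (?J + ?J)" for t
  proof -
    have "(\<integral>\<^sup>+s. ennreal (a * ((1 + \<bar>t\<bar>) powr (\<gamma> - 1) * (1 + \<bar>s\<bar>) powr (\<gamma> - 1))
        + d * ((1 + \<bar>t - s\<bar>) powr - \<beta> + (1 + \<bar>s\<bar>) powr - \<beta>)) * ?i s \<partial>lborel)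
      \<le> (\<integral>\<^sup>+s. (ennreal a * ?f t) * (?f s * ?i s) + ennreal d * (?b (t - s) + ?b s) \<partial>lborel)"
    proof (intro nn_integral_mono)
      fix s
      have "ennreal (a * ((1 + \<bar>t\<bar>) powr (\<gamma> - 1) * (1 + \<bar>s\<bar>) powr (\<gamma> - 1))
        + d * ((1 + \<bar>t - s\<bar>) powr - \<beta> + (1 + \<bar>s\<bar>) powr - \<beta>))
        = (ennreal a * ?f t) * ?f s + ennreal d * (?b (t - s) + ?b s)"
        using a d by (simp add: ennreal_mult ennreal_plus mult.assoc)
      then show "ennreal (a * ((1 + \<bar>t\<bar>) powr (\<gamma> - 1) * (1 + \<bar>s\<bar>) powr (\<gamma> - 1))
        + d * ((1 + \<bar>t - s\<bar>) powr - \<beta> + (1 + \<bar>s\<bar>) powr - \<beta>)) * ?i s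
        \<le> (ennreal a * ?f t) * (?f s * ?i s) + ennreal d * (?b (t - s) + ?b s)"
        by (simp add: indicator_def)
    qed
    also have "\<dots> = (ennreal a * ?f t) * (\<integral>\<^sup>+s. ?f s * ?i s \<partial>lborel)
        + ennreal d * ((\<integral>\<^sup>+s. ?b (t - s) \<partial>lborel) + (\<integral>\<^sup>+s. ?b s \<partial>lborel))"
      by (simp add: nn_integral_add nn_integral_cmult)
    also have "\<dots> \<le> (ennreal a * ?f t) * ?I + ennreal d * (?J + ?J)"
      by (intro add_mono mult_left_mono I J Jt) auto
    finally show ?thesis .
  qed
  have "(\<integral>\<^sup>+t. (\<integral>\<^sup>+s. ennreal (a * ((1 + \<bar>t\<bar>) powr (\<gamma> - 1) * (1 + \<bar>s\<bar>) powr (\<gamma> - 1))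
        + d * ((1 + \<bar>t - s\<bar>) powr - \<beta> + (1 + \<bar>s\<bar>) powr - \<beta>)) * ?i s \<partial>lborel) * ?i t \<partial>lborel)
     \<le> (\<integral>\<^sup>+t. (ennreal a * ?f t * ?I + ennreal d * (?J + ?J)) * ?i t \<partial>lborel)"
    by (intro nn_integral_mono mult_right_mono inner) auto
  also have "\<dots> = (\<integral>\<^sup>+t. (ennreal a * ?I) * (?f t * ?i t) + (ennreal d * (?J + ?J)) * ?i t \<partial>lborel)"
    by (intro nn_integral_cong) (simp add: indicator_def mult_ac)
  also have "\<dots> = (ennreal a * ?I) * (\<integral>\<^sup>+t. ?f t * ?i t \<partial>lborel) + (ennreal d * (?J + ?J)) * (\<integral>\<^sup>+t. ?i t \<partial>lborel)"
    by (subst nn_integral_add, measurable, subst nn_integral_cmult, measurable, subst nn_integral_cmult) measurable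
  also have "\<dots> \<le> (ennreal a * ?I) * ?I + (ennreal d * (?J + ?J)) * ennreal (2 * T)"
    using T by (intro add_mono mult_left_mono I) (auto simp: emeasure_lborel_Icc_eq)
  also have "\<dots> = ennreal (a * (2 * ((1 + T) powr \<gamma> / \<gamma>)) * (2 * ((1 + T) powr \<gamma> / \<gamma>)) + d * (2 / (\<beta> - 1) + 2 / (\<beta> - 1)) * (2 * T))"
    using a d T \<gamma> \<beta> by (simp only: ennreal_mult[symmetric] ennreal_plus[symmetric] mult_nonneg_nonneg add_nonneg_nonneg
        divide_nonneg_nonneg powr_ge_zero zero_le_numeral less_imp_le diff_ge_0_iff_ge)
  also have "a * (2 * ((1 + T) powr \<gamma> / \<gamma>)) * (2 * ((1 + T) powr \<gamma> / \<gamma>)) + d * (2 / (\<beta> - 1) + 2 / (\<beta> - 1)) * (2 * T)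
     = a * (2 * ((1 + T) powr \<gamma> / \<gamma>))\<^sup>2 + d * (4 / (\<beta> - 1)) * (2 * T)"
    by (simp add: power2_eq_square mult.assoc add_divide_distrib[symmetric])
  finally show ?thesis .
qed

section \<open>The mean squared error bound\<close>

locale deconvolution = bounded_replications P N fX fU X U C1
  for P :: "'w measure" and N fX fU X U C1 +
  fixes K :: "real \<Rightarrow> real" and \<alpha> B1 \<beta> C2 k0 c :: real
  assumes K_int: "integrable lborel K"
    and FT_K_le: "\<And>t. cmod (FT K t) \<le> k0"
    and FT_K_support: "\<And>t. \<bar>t\<bar> > c \<Longrightarrow> FT K t = 0" and c_pos: "c > 0"
    and \<alpha>_pos: "\<alpha> > 0" and B1: "B1 > 1" and \<beta>: "\<beta> > 1" and C2: "C2 > 0"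
    and psi_lower: "\<And>t. (1 + \<bar>t\<bar>) powr - \<alpha> / B1 \<le> psi t"
    and FT_fX_le: "\<And>t. (1 + \<bar>t\<bar>) powr \<beta> * cmod (FT fX t) \<le> C2"
begin

lemma k0_nonneg: "k0 \<ge> 0"
  using FT_K_le[of 0] norm_ge_zero[of "FT K 0"] by linarith

lemma inverse_psi_le: "1 / psi t \<le> B1 * (1 + \<bar>t\<bar>) powr \<alpha>"
proof -
  have "1 / psi t \<le> 1 / ((1 + \<bar>t\<bar>) powr - \<alpha> / B1)"
    using psi_lower[of t] psi_pos[of t] B1 by (intro divide_left_mono mult_pos_pos divide_pos_pos) auto
  also have "\<dots> = B1 * (1 + \<bar>t\<bar>) powr \<alpha>"
    by (simp add: powr_minus field_simps)
  finally show ?thesis .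
qed

lemma cmod_FT_fX_le: "cmod (FT fX t) \<le> C2 * (1 + \<bar>t\<bar>) powr - \<beta>"
  using FT_fX_le[of t] by (simp add: powr_minus field_simps)

lemma measurable_FT_K [measurable]: "FT K \<in> borel_measurable borel"
  using K_int by (rule measurable_FT)

lemma cmod_emp_cf_le_1: "n \<ge> 1 \<Longrightarrow> cmod (emp_cf n t \<omega>) \<le> 1"
proof -
  assume n: "n \<ge> 1"
  have M: "num_obs N n > 0" using num_obs_ge[of n] n by linarith
  have "cmod (\<Sum>j=1..n. cis (t * X j \<omega>) * block_sum N j t (errs \<omega>)) \<le> (\<Sum>j=1..n. real (N j))"
    by (intro order_trans[OF norm_sum] sum_mono) (simp add: norm_mult cmod_block_sum_le)
  then have "cmod (\<Sum>j=1..n. cis (t * X j \<omega>) * block_sum N j t (errs \<omega>)) \<le> num_obs N n" by (simp only: num_obs_def)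
  then show ?thesis using M by (simp add: emp_cf_def norm_divide)
qed

lemma measurable_U_snd: "j \<in> {1..n} \<Longrightarrow> k \<in> {1..N j} \<Longrightarrow> (\<lambda>p. U j k (snd p)) \<in> borel_measurable (lborel \<Otimes>\<^sub>M P)"
  by (intro measurable_compose[OF measurable_snd] measurable_U) auto

lemma measurable_emp_cf_pair: "(\<lambda>p. emp_cf n (fst p) (snd p)) \<in> borel_measurable (lborel \<Otimes>\<^sub>M P)"
  unfolding emp_cf_def
proof (intro borel_measurable_divide borel_measurable_const borel_measurable_sum borel_measurable_times)
  fix j assume j: "j \<in> {1..n}"
  have [measurable]: "(\<lambda>p. X j (snd p)) \<in> borel_measurable (lborel \<Otimes>\<^sub>M P)"
    using j by (intro measurable_compose[OF measurable_snd] measurable_X) auto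
  show "(\<lambda>p. cis (fst p * X j (snd p))) \<in> borel_measurable (lborel \<Otimes>\<^sub>M P)" by measurable
  show "(\<lambda>p. block_sum N j (fst p) (errs (snd p))) \<in> borel_measurable (lborel \<Otimes>\<^sub>M P)"
    using j by (intro measurable_block_sum measurable_U_snd) auto
qed

lemma measurable_inv_err_pair: "(\<lambda>p. inv_err n \<rho> (fst p) (errs (snd p))) \<in> borel_measurable (lborel \<Otimes>\<^sub>M P)"
  by (intro measurable_inv_err measurable_U_snd) auto

lemma integrable_tilde: "h > 0 \<Longrightarrow> integrable lborel (\<lambda>t. FT K t * (1 / FT fU (t / h)))"
proof (rule integrable_of_bounded_support)
  assume h: "h > 0"
  have [measurable]: "FT fU \<in> borel_measurable borel"
    using fU by (intro measurable_FT) (simp add: prob_density_def)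
  show "(\<lambda>t. FT K t * (1 / FT fU (t / h))) \<in> borel_measurable borel" by measurable
  fix t
  show "cmod (FT K t * (1 / FT fU (t / h))) \<le> (k0 * (B1 * (1 + c / h) powr \<alpha>)) * indicator {-c..c} t"
  proof (cases "\<bar>t\<bar> \<le> c")
    case True
    have "1 / psi (t / h) \<le> B1 * (1 + \<bar>t / h\<bar>) powr \<alpha>" by (rule inverse_psi_le)
    also have "\<dots> \<le> B1 * (1 + c / h) powr \<alpha>"
      using True h \<alpha>_pos B1 by (intro mult_left_mono powr_mono2) (auto simp: divide_right_mono)
    finally have "cmod (1 / FT fU (t / h)) \<le> B1 * (1 + c / h) powr \<alpha>"
      using psi_pos[of "t / h"] by (simp add: FT_fU_eq norm_divide)
    then have "cmod (FT K t * (1 / FT fU (t / h))) \<le> k0 * (B1 * (1 + c / h) powr \<alpha>)"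
      unfolding norm_mult using k0_nonneg by (intro mult_mono FT_K_le) auto
    then show ?thesis using True by (simp add: indicator_def abs_le_iff)
  next
    case False
    then show ?thesis using FT_K_support[of t] by (auto simp: indicator_def)
  qed
qed

lemma integrable_hat:
  assumes \<rho>: "\<rho> > 0"
  shows "integrable lborel (\<lambda>t. FT K t * (1 / of_real (fU_Ft_hat N n w (t / h) + \<rho>)))"
proof (rule integrable_of_bounded_support)
  have [measurable]: "(\<lambda>t. fU_Ft_hat N n w (t / h)) \<in> borel_measurable borel"
    by (intro measurable_fU_Ft_hat) auto
  show "(\<lambda>t. FT K t * (1 / of_real (fU_Ft_hat N n w (t / h) + \<rho>))) \<in> borel_measurable borel" by measurable
  fix t
  have "cmod (1 / complex_of_real (fU_Ft_hat N n w (t / h) + \<rho>)) \<le> 1 / \<rho>"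
    unfolding norm_divide norm_of_real using \<rho> fU_Ft_hat_nonneg[of n w "t / h"]
    by (simp, intro divide_left_mono mult_pos_pos) auto
  then have "cmod (FT K t * (1 / complex_of_real (fU_Ft_hat N n w (t / h) + \<rho>))) \<le> k0 * (1 / \<rho>)"
    unfolding norm_mult using k0_nonneg by (intro mult_mono FT_K_le) auto
  then show "cmod (FT K t * (1 / of_real (fU_Ft_hat N n w (t / h) + \<rho>))) \<le> (k0 * (1 / \<rho>)) * indicator {-c..c} t"
    using FT_K_support[of t] by (cases "\<bar>t\<bar> \<le> c") (auto simp: indicator_def abs_le_iff)
qed

text \<open>Integrability is assumed instead of being derived from a positive ridge, so that the
  representation can be reused at \<open>\<rho> = 0\<close>.\<close>

lemma fX_hat_fourier:
  assumes h: "h > 0"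
    and int: "integrable lborel (\<lambda>t. FT K t * (1 / of_real (fU_Ft_hat N n (errs \<omega>) (t / h) + \<rho>)))"
  shows "fX_hat K N n h \<rho> (obs X U \<omega>) x = complex_of_real (1 / (2 * pi)) *
      (\<integral>s. cis (- (s * x)) * (FT K (h * s) * (1 / of_real (fU_Ft_hat N n (errs \<omega>) s + \<rho>))) * emp_cf n s \<omega> \<partial>lborel)"
    and "integrable lborel (\<lambda>s. cis (- (s * x)) * (FT K (h * s) * (1 / of_real (fU_Ft_hat N n (errs \<omega>) s + \<rho>))) * emp_cf n s \<omega>)"
proof -
  note f = fourier_scaled_average[where m="\<lambda>s. 1 / of_real (fU_Ft_hat N n (errs \<omega>) s + \<rho>)" and w="obs X U \<omega>" and n=n and N=N and x=x, OF h int]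
  show "fX_hat K N n h \<rho> (obs X U \<omega>) x = complex_of_real (1 / (2 * pi)) *
      (\<integral>s. cis (- (s * x)) * (FT K (h * s) * (1 / of_real (fU_Ft_hat N n (errs \<omega>) s + \<rho>))) * emp_cf n s \<omega> \<partial>lborel)"
    unfolding fX_hat_def L_hat_def fU_Ft_hat_obs emp_cf_eq f(1)[symmetric] by simp
  show "integrable lborel (\<lambda>s. cis (- (s * x)) * (FT K (h * s) * (1 / of_real (fU_Ft_hat N n (errs \<omega>) s + \<rho>))) * emp_cf n s \<omega>)"
    unfolding emp_cf_eq by (rule f(2))
qed

lemma fX_tilde_fourier:
  assumes h: "h > 0"
  shows "fX_tilde K N n h fU (obs X U \<omega>) x = complex_of_real (1 / (2 * pi)) *
      (\<integral>s. cis (- (s * x)) * (FT K (h * s) * (1 / FT fU s)) * emp_cf n s \<omega> \<partial>lborel)"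
    and "integrable lborel (\<lambda>s. cis (- (s * x)) * (FT K (h * s) * (1 / FT fU s)) * emp_cf n s \<omega>)"
proof -
  note f = fourier_scaled_average[where m="\<lambda>s. 1 / FT fU s" and w="obs X U \<omega>" and n=n and N=N and x=x, OF h integrable_tilde[OF h]]
  show "fX_tilde K N n h fU (obs X U \<omega>) x = complex_of_real (1 / (2 * pi)) *
      (\<integral>s. cis (- (s * x)) * (FT K (h * s) * (1 / FT fU s)) * emp_cf n s \<omega> \<partial>lborel)"
    unfolding fX_tilde_def L_fun_def emp_cf_eq f(1)[symmetric] by simp
  show "integrable lborel (\<lambda>s. cis (- (s * x)) * (FT K (h * s) * (1 / FT fU s)) * emp_cf n s \<omega>)"
    unfolding emp_cf_eq by (rule f(2))
qed

lemma fX_hat_minus_tilde: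
  assumes h: "h > 0" and \<rho>: "\<rho> > 0"
  shows "fX_hat K N n h \<rho> (obs X U \<omega>) x - fX_tilde K N n h fU (obs X U \<omega>) x
    = complex_of_real (1 / (2 * pi)) *
      (\<integral>s. cis (- (s * x)) * FT K (h * s) * (emp_cf n s \<omega> * of_real (inv_err n \<rho> s (errs \<omega>))) \<partial>lborel)"
proof -
  note hat = fX_hat_fourier[OF h integrable_hat[OF \<rho>]] and til = fX_tilde_fourier[OF h]
  show ?thesis
    unfolding hat(1) til(1) right_diff_distrib[symmetric] Bochner_Integration.integral_diff[OF hat(2) til(2), symmetric]
    by (intro arg_cong2[where f="(*)"] refl Bochner_Integration.integral_cong)
      (simp add: inv_err_def FT_fU_eq algebra_simps)
qed

text \<open>Dominating the exponent \<open>2 * \<alpha> - \<beta>\<close> by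
  \<open>\<gamma> - 1\<close> with positive \<open>\<gamma>\<close> makes the integral of the
  product term a power of \<open>1 + T\<close> in all cases, including convergent and logarithmic
  ones. The diagonal term uses the worst inverse error on the range, at its end \<open>T\<close>:
  decay in \<open>t - s\<close> leaves one free integration over \<open>t\<close>, whence the
  exponent \<open>6 * \<alpha> + 1\<close>.\<close>

lemma mse_bound:
  assumes n: "n \<ge> 1" and h: "h > 0" and \<rho>: "\<rho> > 0" and c3: "c3 \<ge> 0" "\<rho>\<^sup>2 \<le> c3 / real n"
    and T: "T = c / h" and tail: "\<And>t. \<bar>t\<bar> \<le> T \<Longrightarrow> tail_term n \<rho> (psi t) \<le> 1 / real n"
    and \<gamma>: "\<gamma> > 0" "2 * \<alpha> - \<beta> \<le> \<gamma> - 1"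
  shows "(\<integral>\<^sup>+\<omega>. ennreal ((cmod (fX_hat K N n h \<rho> (obs X U \<omega>) x - fX_tilde K N n h fU (obs X U \<omega>) x))\<^sup>2) \<partial>P)
    \<le> ennreal (k0\<^sup>2 * (C2\<^sup>2 * (16 * C1 ^ 6 + 16 * c3 + 73) * B1 ^ 4) * (4 / \<gamma>\<^sup>2) * ((1 + T) powr (2 * \<gamma>) / real n)
      + k0\<^sup>2 * (C1 * C2 * (8 * C1 ^ 6 + 8 * c3 + 1) * B1 ^ 6) * (8 / (\<beta> - 1)) * ((1 + T) powr (6 * \<alpha> + 1) / (real n)\<^sup>2))"
proof -
  define W where "W s \<omega> = cis (- (s * x)) * FT K (h * s) * (emp_cf n s \<omega> * of_real (inv_err n \<rho> s (errs \<omega>)))" for s \<omega>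
  \<comment> \<open>The 73 is \<open>18 * 4\<close> from the fluctuation of the block average plus 1
    for the tail term, which also accounts for the 1 in \<open>Cr\<close>.\<close>
  define Ca where "Ca = 16 * C1 ^ 6 + 16 * c3 + 73"
  define Cr where "Cr = 8 * C1 ^ 6 + 8 * c3 + 1"
  define L where "L t = B1 * (1 + \<bar>t\<bar>) powr \<alpha>" for t
  have Tpos: "T > 0" using T h c_pos by simp
  have Ca: "Ca > 0" and Cr: "Cr > 0" using C1 c3 by (auto simp: Ca_def Cr_def intro!: add_nonneg_pos)
  have n0: "real n > 0" using n by simp
  have L: "L t \<ge> 1" "1 / psi t \<le> L t" for t
  proof -
    show "1 / psi t \<le> L t" unfolding L_def by (rule inverse_psi_le)
    moreover have "1 \<le> 1 / psi t" using psi_pos[of t] psi_le_1[of t] by simp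
    ultimately show "L t \<ge> 1" by linarith
  qed
  have ipow: "1 / psi t ^ k \<le> L t ^ m" if "k \<le> m" for t k m
  proof -
    have "1 / psi t ^ k = (1 / psi t) ^ k" by (simp add: power_one_over)
    also have "\<dots> \<le> L t ^ k" using L psi_pos[of t] by (intro power_mono) auto
    also have "\<dots> \<le> L t ^ m" using L that by (intro power_increasing) auto
    finally show ?thesis .
  qed
  have R2: "(\<integral>\<omega>. (inv_err n \<rho> t (errs \<omega>))\<^sup>2 \<partial>P) \<le> Cr / real n * L t ^ 6" if t: "\<bar>t\<bar> \<le> T" for t
  proof -
    have "(\<integral>\<omega>. (inv_err n \<rho> t (errs \<omega>))\<^sup>2 \<partial>P)
      \<le> 8 * (C1 ^ 6 / real n) * (1 / psi t ^ 6) + 8 * \<rho>\<^sup>2 * (1 / psi t ^ 4) + tail_term n \<rho> (psi t)"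
      using second_moment_inv_err_le[OF n \<rho>, of t] by simp
    also have "\<dots> \<le> 8 * (C1 ^ 6 / real n) * L t ^ 6 + 8 * (c3 / real n) * L t ^ 6 + 1 / real n * L t ^ 6"
    proof (intro add_mono mult_mono ipow)
      have "1 / real n * 1 \<le> 1 / real n * L t ^ 6" using L[of t] by (intro mult_left_mono one_le_power) auto
      then show "tail_term n \<rho> (psi t) \<le> 1 / real n * L t ^ 6" using tail[OF t] by simp
    qed (use C1 c3 psi_pos[of t] in auto)
    also have "\<dots> = Cr / real n * L t ^ 6" by (simp add: Cr_def add_divide_distrib distrib_right)
    finally show ?thesis .
  qed
  have A2: "(\<integral>\<omega>. (cmod (block_avg n t (errs \<omega>) * of_real (inv_err n \<rho> t (errs \<omega>))))\<^sup>2 \<partial>P) \<le> Ca / real n * L t ^ 4"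
    if t: "\<bar>t\<bar> \<le> T" for t
  proof -
    have "(\<integral>\<omega>. (cmod (block_avg n t (errs \<omega>) * of_real (inv_err n \<rho> t (errs \<omega>))))\<^sup>2 \<partial>P)
      \<le> 16 * (C1 ^ 6 / real n) * (1 / psi t ^ 4) + 16 * \<rho>\<^sup>2 * (1 / psi t ^ 2) + 72 / real n * (1 / psi t ^ 2) + tail_term n \<rho> (psi t)"
      using second_moment_avg_inv_err_le[OF n \<rho>, of t] by simp
    also have "\<dots> \<le> 16 * (C1 ^ 6 / real n) * L t ^ 4 + 16 * (c3 / real n) * L t ^ 4 + 72 / real n * L t ^ 4 + 1 / real n * L t ^ 4"
    proof (intro add_mono mult_mono ipow)
      have "1 / real n * 1 \<le> 1 / real n * L t ^ 4" using L[of t] by (intro mult_left_mono one_le_power) auto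
      then show "tail_term n \<rho> (psi t) \<le> 1 / real n * L t ^ 4" using tail[OF t] by simp
    qed (use C1 c3 psi_pos[of t] in auto)
    also have "\<dots> = Ca / real n * L t ^ 4" by (simp add: Ca_def add_divide_distrib distrib_right)
    finally show ?thesis .
  qed
  define r where "r = sqrt (Cr / real n) * L T ^ 3"
  define a where "a t = sqrt (Ca / real n) * (L t)\<^sup>2" for t
  have r: "r > 0" unfolding r_def using Cr n0 L(1)[of T] by (intro mult_pos_pos zero_less_power) auto
  have apos: "a t > 0" for t unfolding a_def using Ca n0 L(1)[of t] by (intro mult_pos_pos zero_less_power) auto
  have r2: "r\<^sup>2 = Cr / real n * L T ^ 6"
    unfolding r_def power_mult_distrib using Cr n0 by simp
  have a2: "(a t)\<^sup>2 = Ca / real n * L t ^ 4" for t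
    unfolding a_def power_mult_distrib using Ca n0 by simp
  have L_mono: "L t \<le> L T" if "\<bar>t\<bar> \<le> T" for t
    unfolding L_def using that B1 \<alpha>_pos Tpos by (intro mult_left_mono powr_mono2) auto
  have rt: "(\<integral>\<omega>. (inv_err n \<rho> t (errs \<omega>))\<^sup>2 \<partial>P) \<le> r\<^sup>2" if "\<bar>t\<bar> \<le> T" for t
  proof -
    have "Cr / real n * L t ^ 6 \<le> Cr / real n * L T ^ 6"
      using L_mono[OF that] L(1)[of t] Cr by (intro mult_left_mono power_mono) auto
    then show ?thesis using R2[OF that] r2 by linarith
  qed
  let ?kap = "\<lambda>t s. k0\<^sup>2 * (C2\<^sup>2 * (Ca / real n) * B1 ^ 4) * ((1 + \<bar>t\<bar>) powr (\<gamma> - 1) * (1 + \<bar>s\<bar>) powr (\<gamma> - 1))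
     + k0\<^sup>2 * (C1 / real n * C2 * r\<^sup>2) * ((1 + \<bar>t - s\<bar>) powr - \<beta> + (1 + \<bar>s\<bar>) powr - \<beta>)"
  have fa: "cmod (FT fX t) * a t \<le> C2 * sqrt (Ca / real n) * B1\<^sup>2 * (1 + \<bar>t\<bar>) powr (\<gamma> - 1)" for t
  proof -
    have "cmod (FT fX t) * a t \<le> C2 * (1 + \<bar>t\<bar>) powr - \<beta> * a t"
      using apos[of t] by (intro mult_right_mono cmod_FT_fX_le) auto
    also have "\<dots> = C2 * sqrt (Ca / real n) * B1\<^sup>2 * ((1 + \<bar>t\<bar>) powr - \<beta> * ((1 + \<bar>t\<bar>) powr \<alpha>)\<^sup>2)"
      by (simp add: a_def L_def power_mult_distrib mult_ac)
    also have "(1 + \<bar>t\<bar>) powr - \<beta> * ((1 + \<bar>t\<bar>) powr \<alpha>)\<^sup>2 = (1 + \<bar>t\<bar>) powr (2 * \<alpha> - \<beta>)"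
      by (simp add: power2_eq_square powr_add[symmetric])
    also have "C2 * sqrt (Ca / real n) * B1\<^sup>2 * \<dots> \<le> C2 * sqrt (Ca / real n) * B1\<^sup>2 * (1 + \<bar>t\<bar>) powr (\<gamma> - 1)"
      using \<gamma> C2 Ca n0 by (intro mult_left_mono powr_mono) auto
    finally show ?thesis .
  qed
  have cov: "cmod (\<integral>\<omega>. W t \<omega> * cnj (W s \<omega>) \<partial>P) \<le> ?kap t s" if ts: "\<bar>t\<bar> \<le> T" "\<bar>s\<bar> \<le> T" for t s
  proof -
    let ?I = "\<integral>\<omega>. (emp_cf n t \<omega> * of_real (inv_err n \<rho> t (errs \<omega>))) * cnj (emp_cf n s \<omega> * of_real (inv_err n \<rho> s (errs \<omega>))) \<partial>P"
    let ?C = "(cis (- (t * x)) * FT K (h * t)) * cnj (cis (- (s * x)) * FT K (h * s))"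
    have "W t \<omega> * cnj (W s \<omega>) = ?C * ((emp_cf n t \<omega> * of_real (inv_err n \<rho> t (errs \<omega>))) * cnj (emp_cf n s \<omega> * of_real (inv_err n \<rho> s (errs \<omega>))))" for \<omega>
      by (simp add: W_def mult_ac)
    then have "(\<integral>\<omega>. W t \<omega> * cnj (W s \<omega>) \<partial>P) = ?C * ?I" by (simp only: integral_mult_right_zero)
    then have "cmod (\<integral>\<omega>. W t \<omega> * cnj (W s \<omega>) \<partial>P) = cmod (FT K (h * t)) * cmod (FT K (h * s)) * cmod ?I"
      by (simp add: norm_mult)
    also have "\<dots> \<le> k0\<^sup>2 * cmod ?I"
      unfolding power2_eq_square using k0_nonneg by (intro mult_right_mono mult_mono FT_K_le) auto
    also have "cmod ?I \<le> cmod (FT fX t) * cmod (FT fX s) * (a t * a s)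
      + C1 / real n * (cmod (FT fX (t - s)) + cmod (FT fX t) * cmod (FT fX s)) * (r * r)"
      using A2[OF ts(1)] A2[OF ts(2)] rt[OF ts(1)] rt[OF ts(2)]
      by (intro covariance_bound n \<rho> apos r) (simp_all add: a2)
    also have "\<dots> \<le> (C2\<^sup>2 * (Ca / real n) * B1 ^ 4) * ((1 + \<bar>t\<bar>) powr (\<gamma> - 1) * (1 + \<bar>s\<bar>) powr (\<gamma> - 1))
      + (C1 / real n * C2 * r\<^sup>2) * ((1 + \<bar>t - s\<bar>) powr - \<beta> + (1 + \<bar>s\<bar>) powr - \<beta>)"
    proof (rule add_mono)
      have "cmod (FT fX t) * cmod (FT fX s) * (a t * a s) = (cmod (FT fX t) * a t) * (cmod (FT fX s) * a s)" by simp
      also have "\<dots> \<le> (C2 * sqrt (Ca / real n) * B1\<^sup>2 * (1 + \<bar>t\<bar>) powr (\<gamma> - 1)) * (C2 * sqrt (Ca / real n) * B1\<^sup>2 * (1 + \<bar>s\<bar>) powr (\<gamma> - 1))"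
        using C2 Ca n0 apos[of s] by (intro mult_mono fa) (auto intro!: mult_nonneg_nonneg less_imp_le[OF apos])
      also have "\<dots> = (C2\<^sup>2 * (sqrt (Ca / real n))\<^sup>2 * B1 ^ 4) * ((1 + \<bar>t\<bar>) powr (\<gamma> - 1) * (1 + \<bar>s\<bar>) powr (\<gamma> - 1))"
        by (simp only: power2_eq_square power4_eq_xxxx mult_ac)
      finally show "cmod (FT fX t) * cmod (FT fX s) * (a t * a s)
        \<le> (C2\<^sup>2 * (Ca / real n) * B1 ^ 4) * ((1 + \<bar>t\<bar>) powr (\<gamma> - 1) * (1 + \<bar>s\<bar>) powr (\<gamma> - 1))"
        using Ca n0 by simp
      \<comment> \<open>One transform is bounded by 1; the decay of the other in \<open>s\<close> is
        what the kernel lemma integrates.\<close>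
      have "cmod (FT fX t) * cmod (FT fX s) \<le> 1 * (C2 * (1 + \<bar>s\<bar>) powr - \<beta>)"
        by (intro mult_mono cmod_FT_fX_le cmod_FT_fX_le_1) auto
      then have "cmod (FT fX (t - s)) + cmod (FT fX t) * cmod (FT fX s)
        \<le> C2 * (1 + \<bar>t - s\<bar>) powr - \<beta> + C2 * (1 + \<bar>s\<bar>) powr - \<beta>"
        using cmod_FT_fX_le[of "t - s"] by simp
      then have "C1 / real n * (cmod (FT fX (t - s)) + cmod (FT fX t) * cmod (FT fX s)) * (r * r)
        \<le> C1 / real n * (C2 * (1 + \<bar>t - s\<bar>) powr - \<beta> + C2 * (1 + \<bar>s\<bar>) powr - \<beta>) * (r * r)"
        using C1 r by (intro mult_right_mono mult_left_mono) auto
      then show "C1 / real n * (cmod (FT fX (t - s)) + cmod (FT fX t) * cmod (FT fX s)) * (r * r)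
        \<le> (C1 / real n * C2 * r\<^sup>2) * ((1 + \<bar>t - s\<bar>) powr - \<beta> + (1 + \<bar>s\<bar>) powr - \<beta>)"
        by (simp only: distrib_left[symmetric] power2_eq_square mult_ac)
    qed
    finally show ?thesis using k0_nonneg by (simp add: mult_left_mono distrib_left mult.assoc)
  qed
  have meas: "(\<lambda>(t, \<omega>). W t \<omega>) \<in> borel_measurable (lborel \<Otimes>\<^sub>M P)"
  proof -
    note [measurable] = measurable_emp_cf_pair measurable_inv_err_pair
    have "(\<lambda>p. W (fst p) (snd p)) \<in> borel_measurable (lborel \<Otimes>\<^sub>M P)"
      unfolding W_def by measurable
    then show ?thesis by (simp add: case_prod_beta)
  qed
  have Wbd: "cmod (W t \<omega>) \<le> (k0 * (1 / \<rho> + L T)) * indicator {-T..T} t" for t \<omega>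
  proof (cases "\<bar>t\<bar> \<le> T")
    case True
    have "\<bar>inv_err n \<rho> t (errs \<omega>)\<bar> \<le> 1 / \<rho> + L T"
      using abs_inv_err_le[OF \<rho>, of n t "errs \<omega>"] L(2)[of t] L_mono[OF True] by linarith
    then have "cmod (FT K (h * t)) * (cmod (emp_cf n t \<omega>) * \<bar>inv_err n \<rho> t (errs \<omega>)\<bar>) \<le> k0 * (1 * (1 / \<rho> + L T))"
      using k0_nonneg by (intro mult_mono FT_K_le cmod_emp_cf_le_1 n) auto
    then show ?thesis using True by (simp add: W_def norm_mult abs_le_iff)
  next
    case False
    then have "\<bar>h * t\<bar> > c" using h by (simp add: T abs_mult field_simps)
    then show ?thesis using FT_K_support[of "h * t"] False by (auto simp: W_def indicator_def)
  qed
  have sq: "(cmod (complex_of_real (1 / (2 * pi)) * z))\<^sup>2 \<le> (cmod z)\<^sup>2" for z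
  proof (rule power_mono)
    have "2 * pi \<ge> 1" using pi_ge_two by linarith
    then have "cmod z / (2 * pi) \<le> cmod z / 1" by (intro divide_left_mono) auto
    then show "cmod (complex_of_real (1 / (2 * pi)) * z) \<le> cmod z"
      by (simp add: norm_mult norm_divide)
  qed simp
  have "(\<integral>\<^sup>+\<omega>. ennreal ((cmod (fX_hat K N n h \<rho> (obs X U \<omega>) x - fX_tilde K N n h fU (obs X U \<omega>) x))\<^sup>2) \<partial>P)
     \<le> (\<integral>\<^sup>+\<omega>. ennreal ((cmod (\<integral>s. W s \<omega> \<partial>lborel))\<^sup>2) \<partial>P)"
    unfolding fX_hat_minus_tilde[OF h \<rho>] W_def by (intro nn_integral_mono ennreal_leI sq)
  also have "\<dots> \<le> (\<integral>\<^sup>+t. (\<integral>\<^sup>+s. ennreal (?kap t s) * indicator {-T..T} s \<partial>lborel) * indicator {-T..T} t \<partial>lborel)"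
    using k0_nonneg \<rho> L(1)[of T] Tpos
    by (intro second_moment_integral_le[OF meas Wbd] cov mult_nonneg_nonneg add_nonneg_nonneg) auto
  also have "\<dots> \<le> ennreal (k0\<^sup>2 * (C2\<^sup>2 * (Ca / real n) * B1 ^ 4) * (2 * ((1 + T) powr \<gamma> / \<gamma>))\<^sup>2
      + k0\<^sup>2 * (C1 / real n * C2 * r\<^sup>2) * (4 / (\<beta> - 1)) * (2 * T))"
    using Ca n0 C1 C2 Tpos \<gamma> \<beta> B1 by (intro nn_integral_two_point_kernel_le) auto
  also have "\<dots> \<le> ennreal (k0\<^sup>2 * (C2\<^sup>2 * Ca * B1 ^ 4) * (4 / \<gamma>\<^sup>2) * ((1 + T) powr (2 * \<gamma>) / real n)
      + k0\<^sup>2 * (C1 * C2 * Cr * B1 ^ 6) * (8 / (\<beta> - 1)) * ((1 + T) powr (6 * \<alpha> + 1) / (real n)\<^sup>2))"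
  proof (intro ennreal_leI add_mono)
    have "((1 + T) powr \<gamma>)\<^sup>2 = (1 + T) powr (2 * \<gamma>)"
      by (simp add: power2_eq_square powr_add[symmetric])
    then show "k0\<^sup>2 * (C2\<^sup>2 * (Ca / real n) * B1 ^ 4) * (2 * ((1 + T) powr \<gamma> / \<gamma>))\<^sup>2
      \<le> k0\<^sup>2 * (C2\<^sup>2 * Ca * B1 ^ 4) * (4 / \<gamma>\<^sup>2) * ((1 + T) powr (2 * \<gamma>) / real n)"
      by (simp add: power_mult_distrib power_divide mult_ac)
    have "L T ^ 6 * T \<le> L T ^ 6 * (1 + T)" using L(1)[of T] by (intro mult_left_mono) auto
    also have "L T ^ 6 * (1 + T) = B1 ^ 6 * (1 + T) powr (6 * \<alpha> + 1)"
    proof -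
      have "((1 + T) powr \<alpha>) ^ 6 = (1 + T) powr (6 * \<alpha>)"
        using Tpos by (simp add: powr_power mult.commute)
      then show ?thesis using Tpos by (simp add: L_def power_mult_distrib powr_add)
    qed
    finally have "L T ^ 6 * T \<le> B1 ^ 6 * (1 + T) powr (6 * \<alpha> + 1)" .
    then have "(k0\<^sup>2 * (C1 / real n * C2 * (Cr / real n)) * (8 / (\<beta> - 1))) * (L T ^ 6 * T)
      \<le> (k0\<^sup>2 * (C1 / real n * C2 * (Cr / real n)) * (8 / (\<beta> - 1))) * (B1 ^ 6 * (1 + T) powr (6 * \<alpha> + 1))"
      using C1 C2 Cr \<beta> by (intro mult_left_mono) auto
    then show "k0\<^sup>2 * (C1 / real n * C2 * r\<^sup>2) * (4 / (\<beta> - 1)) * (2 * T)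
      \<le> k0\<^sup>2 * (C1 * C2 * Cr * B1 ^ 6) * (8 / (\<beta> - 1)) * ((1 + T) powr (6 * \<alpha> + 1) / (real n)\<^sup>2)"
      unfolding r2 by (simp add: power2_eq_square mult_ac)
  qed
  finally show ?thesis unfolding Ca_def Cr_def .
qed

end

section \<open>Negative moments of the pair average\<close>

lemma nn_integral_PiM_update_measurable:
  assumes D: "sigma_finite_measure D" and f: "f \<in> borel_measurable (PiM (insert i I) (\<lambda>_. D))"
  shows "(\<lambda>x. \<integral>\<^sup>+y. f (x(i := y)) \<partial>D) \<in> borel_measurable (PiM I (\<lambda>_. D))"
proof -
  interpret sigma_finite_measure D by fact
  have "(\<lambda>(x, y). x(i := y)) \<in> measurable (PiM I (\<lambda>_. D) \<Otimes>\<^sub>M D) (PiM (insert i I) (\<lambda>_. D))"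
    by (rule measurable_add_dim)
  from measurable_compose[OF this f]
  have "(\<lambda>(x, y). f (x(i := y))) \<in> borel_measurable (PiM I (\<lambda>_. D) \<Otimes>\<^sub>M D)"
    by (simp add: case_prod_beta)
  then show ?thesis by (rule borel_measurable_nn_integral)
qed

text \<open>The coordinate \<open>i1\<close> is split off first and thus belongs to the innermost
  integral. The bound holds for every value of the remaining coordinates, over which a probability
  measure is integrated.\<close>

lemma nn_integral_PiM_insert4_le:
  fixes D :: "real measure"
  assumes D: "prob_space D" and I: "finite I" "distinct [i1, i2, i3, i4]" "set [i1, i2, i3, i4] \<inter> I = {}"
    and f: "f \<in> borel_measurable (PiM (insert i1 (insert i2 (insert i3 (insert i4 I)))) (\<lambda>_. D))"
    and le: "\<And>x. (\<integral>\<^sup>+y4. \<integral>\<^sup>+y3. \<integral>\<^sup>+y2. \<integral>\<^sup>+y1. f (x(i4 := y4, i3 := y3, i2 := y2, i1 := y1)) \<partial>D \<partial>D \<partial>D \<partial>D) \<le> B"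
  shows "(\<integral>\<^sup>+x. f x \<partial>PiM (insert i1 (insert i2 (insert i3 (insert i4 I)))) (\<lambda>_. D)) \<le> B"
proof -
  interpret prob_space D by fact
  interpret product_prob_space "\<lambda>_. D" ..
  have D': "sigma_finite_measure D" ..
  note m1 = nn_integral_PiM_update_measurable[OF D' f]
  note m2 = nn_integral_PiM_update_measurable[OF D' m1]
  note m3 = nn_integral_PiM_update_measurable[OF D' m2]
  have "(\<integral>\<^sup>+x. f x \<partial>PiM (insert i1 (insert i2 (insert i3 (insert i4 I)))) (\<lambda>_. D))
     = (\<integral>\<^sup>+x. \<integral>\<^sup>+y1. f (x(i1 := y1)) \<partial>D \<partial>PiM (insert i2 (insert i3 (insert i4 I))) (\<lambda>_. D))"
    using I by (intro product_nn_integral_insert f) auto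
  also have "\<dots> = (\<integral>\<^sup>+x. \<integral>\<^sup>+y2. \<integral>\<^sup>+y1. f (x(i2 := y2, i1 := y1)) \<partial>D \<partial>D \<partial>PiM (insert i3 (insert i4 I)) (\<lambda>_. D))"
    using I by (intro product_nn_integral_insert m1) auto
  also have "\<dots> = (\<integral>\<^sup>+x. \<integral>\<^sup>+y3. \<integral>\<^sup>+y2. \<integral>\<^sup>+y1. f (x(i3 := y3, i2 := y2, i1 := y1)) \<partial>D \<partial>D \<partial>D \<partial>PiM (insert i4 I) (\<lambda>_. D))"
    using I by (intro product_nn_integral_insert m2) auto
  also have "\<dots> = (\<integral>\<^sup>+x. \<integral>\<^sup>+y4. \<integral>\<^sup>+y3. \<integral>\<^sup>+y2. \<integral>\<^sup>+y1. f (x(i4 := y4, i3 := y3, i2 := y2, i1 := y1)) \<partial>D \<partial>D \<partial>D \<partial>D \<partial>PiM I (\<lambda>_. D))"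
    using I by (intro product_nn_integral_insert m3) auto
  also have "\<dots> \<le> (\<integral>\<^sup>+x. B \<partial>PiM I (\<lambda>_. D))"
    by (intro nn_integral_mono le)
  also have "\<dots> = B"
    using prob_space.emeasure_space_1[OF prob_space_PiM[of I "\<lambda>_. D"]] D by simp
  finally show ?thesis .
qed

context bounded_replications
begin

text \<open>With at most one replicated block, \<open>num_pairs N n\<close> would not exceed
  \<open>C1^2 / 2\<close>, against its growth of at least \<open>n / C1\<close>.\<close>

lemma two_replicated_blocks:
  assumes "real n > C1 ^ 3"
  obtains j1 j2 where "j1 \<in> {1..n}" "j2 \<in> {1..n}" "j1 \<noteq> j2" "N j1 \<ge> 2" "N j2 \<ge> 2"
proof (rule ccontr)
  assume "\<not> thesis"
  with that have uniq: "j1 = j2" if "j1 \<in> {1..n}" "j2 \<in> {1..n}" "N j1 \<ge> 2" "N j2 \<ge> 2" for j1 j2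
    using that by blast
  have n: "n \<ge> 1" using assms C1 by (cases n) auto
  let ?f = "\<lambda>j. real (N j) * (real (N j) - 1)"
  have f0: "?f j = 0" if "j \<in> {1..n}" "\<not> N j \<ge> 2" for j
    using N_bounds[of j] that by (cases "N j = 1") auto
  have "(\<Sum>j=1..n. ?f j) \<le> C1\<^sup>2"
  proof (cases "\<exists>j0\<in>{1..n}. N j0 \<ge> 2")
    case True
    then obtain j0 where j0: "j0 \<in> {1..n}" "N j0 \<ge> 2" by auto
    have "?f j = 0" if "j \<in> {1..n} - {j0}" for j
      using f0[of j] uniq[of j j0] j0 that by auto
    then have "sum ?f ({1..n} - {j0}) = 0" by (intro sum.neutral) auto
    then have "(\<Sum>j=1..n. ?f j) = ?f j0"
      using j0 sum.remove[of "{1..n}" j0 ?f] by simp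
    also have "\<dots> \<le> C1 * C1" using N_bounds[of j0] j0 by (intro mult_mono) auto
    finally show ?thesis by (simp add: power2_eq_square)
  next
    case False
    then have "(\<Sum>j=1..n. ?f j) = 0" using f0 by (intro sum.neutral) auto
    then show ?thesis by simp
  qed
  then have "num_pairs N n \<le> C1\<^sup>2 / 2" by (simp add: num_pairs_def)
  then have "real n / C1 \<le> C1\<^sup>2" using num_pairs_ge[OF n] zero_le_power2[of C1] by linarith
  then have "real n \<le> C1 ^ 3" using C1 by (simp add: field_simps power2_eq_square power3_eq_cube)
  then show False using assms by simp
qed

abbreviation err_dist :: "real measure" where
  "err_dist \<equiv> density lborel (\<lambda>x. ennreal (fU x))"

lemma measurable_Z: "i \<in> Index \<Longrightarrow> Z i \<in> borel_measurable P"
  using indep_Z by (auto simp: indep_vars_def)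

lemma distr_errs:
  assumes "n \<ge> 1"
  shows "distr P (PiM (err_index n) (\<lambda>_. borel)) (\<lambda>\<omega>. restrict (\<lambda>i. Z i \<omega>) (err_index n))
    = PiM (err_index n) (\<lambda>_. err_dist)"
proof -
  \<comment> \<open>The product formula for the joint law asks for a nonempty index set.\<close>
  have "Inr (1, 1) \<in> err_index n" using assms N_bounds[of 1] by auto
  then have ne: "err_index n \<noteq> {}" by blast
  have "indep_vars (\<lambda>_. borel) Z (err_index n)"
    by (rule indep_vars_subset[OF indep_Z]) auto
  then have "distr P (PiM (err_index n) (\<lambda>_. borel)) (\<lambda>\<omega>. restrict (\<lambda>i. Z i \<omega>) (err_index n))
    = PiM (err_index n) (\<lambda>i. distr P borel (Z i))"
    by (subst (asm) indep_vars_iff_distr_eq_PiM'[OF ne]) (auto intro!: measurable_Z)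
  also have "\<dots> = PiM (err_index n) (\<lambda>_. err_dist)"
    by (intro PiM_cong refl) (auto simp: distr_U)
  finally show ?thesis .
qed

lemma negative_moment_pair_avg:
  assumes n: "real n > C1 ^ 3" and p: "p > 0"
    and moment: "\<And>a. (\<integral>\<^sup>+u. inv_powr p (sin ((t * u - a) / 2)) \<partial>err_dist) \<le> C"
  shows "(\<integral>\<^sup>+\<omega>. inv_powr p (pair_avg N n t (errs \<omega>)) \<partial>P) \<le> inv_powr p (1 / num_pairs N n) * (2 * (2 * C) ^ 4)"
proof -
  obtain j1 j2 where j: "j1 \<in> {1..n}" "j2 \<in> {1..n}" "j1 \<noteq> j2" "N j1 \<ge> 2" "N j2 \<ge> 2"
    using two_replicated_blocks[OF n] .
  have n1: "n \<ge> 1" using j by auto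
  interpret sin_moment err_dist p t C by unfold_locales (use p moment in auto)
  define S where "S w = (\<Sum>j=1..n. ((cmod (block_sum N j t w))\<^sup>2 - real (N j)) / 2)" for w
  define f where "f y = inv_powr p (S (\<lambda>j k. y (Inr (j, k))))" for y :: "nat + nat \<times> nat \<Rightarrow> real"
  define I where "I = err_index n - {Inr (j1, 1), Inr (j2, 1), Inr (j1, 2), Inr (j2, 2)}"
  \<comment> \<open>The order of insertion is the order of integration in
    \<open>two_block_moment\<close>, from inside out: \<open>u1\<close>, \<open>v1\<close>,
    \<open>u2\<close>, \<open>v2\<close>.\<close>
  have ins: "err_index n = insert (Inr (j1, 1)) (insert (Inr (j2, 1)) (insert (Inr (j1, 2)) (insert (Inr (j2, 2)) I)))"
    using j by (auto simp: I_def)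
  have f_meas: "f \<in> borel_measurable (PiM (err_index n) (\<lambda>_. borel))"
  proof -
    have "(\<lambda>y. S (\<lambda>j k. y (Inr (j, k)))) \<in> borel_measurable (PiM (err_index n) (\<lambda>_. borel :: real measure))"
      unfolding S_def
    proof (intro borel_measurable_sum)
      fix j assume "j \<in> {1..n}"
      then have [measurable]: "(\<lambda>y. block_sum N j t (\<lambda>j k. y (Inr (j, k)))) \<in> borel_measurable (PiM (err_index n) (\<lambda>_. borel :: real measure))"
        by (intro measurable_block_sum measurable_component_singleton) auto
      show "(\<lambda>y. ((cmod (block_sum N j t (\<lambda>j k. y (Inr (j, k)))))\<^sup>2 - real (N j)) / 2) \<in> borel_measurable (PiM (err_index n) (\<lambda>_. borel :: real measure))"
        by measurable
    qed
    then show ?thesis unfolding f_def by measurable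
  qed
  have sets_eq: "sets (PiM (err_index n) (\<lambda>_. err_dist)) = sets (PiM (err_index n) (\<lambda>_. borel :: real measure))"
    by (intro sets_PiM_cong) auto
  have "(\<integral>\<^sup>+\<omega>. inv_powr p (S (errs \<omega>)) \<partial>P) = (\<integral>\<^sup>+\<omega>. f (restrict (\<lambda>i. Z i \<omega>) (err_index n)) \<partial>P)"
  proof (intro nn_integral_cong)
    fix \<omega>
    have "block_sum N j t (errs \<omega>) = block_sum N j t (\<lambda>j k. restrict (\<lambda>i. Z i \<omega>) (err_index n) (Inr (j, k)))" if "j \<in> {1..n}" for j
      using that by (intro block_sum_cong) auto
    then show "inv_powr p (S (errs \<omega>)) = f (restrict (\<lambda>i. Z i \<omega>) (err_index n))"
      by (simp add: f_def S_def)
  qed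
  also have "\<dots> = (\<integral>\<^sup>+y. f y \<partial>distr P (PiM (err_index n) (\<lambda>_. borel)) (\<lambda>\<omega>. restrict (\<lambda>i. Z i \<omega>) (err_index n)))"
  proof (rule nn_integral_distr[symmetric])
    show "(\<lambda>\<omega>. restrict (\<lambda>i. Z i \<omega>) (err_index n)) \<in> measurable P (PiM (err_index n) (\<lambda>_. borel))"
      by (intro measurable_restrict measurable_Z) auto
  qed (use f_meas in simp)
  also have "\<dots> = (\<integral>\<^sup>+y. f y \<partial>PiM (err_index n) (\<lambda>_. err_dist))"
    by (simp only: distr_errs[OF n1])
  also have "\<dots> \<le> 2 * (2 * C) ^ 4"
    unfolding ins
  proof (rule nn_integral_PiM_insert4_le)
    show "prob_space err_dist"
      using prob_density_real_distribution[OF fU] by (simp add: real_distribution_def)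
    show "finite I" by (simp add: I_def)
    show "distinct [Inr (j1, 1) :: nat + nat \<times> nat, Inr (j2, 1), Inr (j1, 2), Inr (j2, 2)]" using j by simp
    show "set [Inr (j1, 1), Inr (j2, 1), Inr (j1, 2), Inr (j2, 2)] \<inter> I = {}" by (auto simp: I_def)
    show "f \<in> borel_measurable (PiM (insert (Inr (j1, 1)) (insert (Inr (j2, 1)) (insert (Inr (j1, 2)) (insert (Inr (j2, 2)) I)))) (\<lambda>_. err_dist))"
      using f_meas unfolding ins[symmetric] measurable_cong_sets[OF sets_eq refl] .
    fix x :: "nat + nat \<times> nat \<Rightarrow> real"
    define w where "w j = (\<Sum>k=3..N j. cis (t * x (Inr (j, k))))" for j
    define c where "c = (\<Sum>j\<in>{1..n} - {j1, j2}. ((cmod (block_sum N j t (\<lambda>j k. x (Inr (j, k)))))\<^sup>2 - real (N j)) / 2)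
        - real (N j1) / 2 - real (N j2) / 2"
    have "f (x(Inr (j2, 2) := v2, Inr (j1, 2) := u2, Inr (j2, 1) := v1, Inr (j1, 1) := u1))
      = inv_powr p ((cmod (cis (t * u1) + (cis (t * u2) + w j1)))\<^sup>2 / 2 + (cmod (cis (t * v1) + (cis (t * v2) + w j2)))\<^sup>2 / 2 + c)"
      for v2 u2 v1 u1
    proof -
      define y where "y = x(Inr (j2, 2) := v2, Inr (j1, 2) := u2, Inr (j2, 1) := v1, Inr (j1, 1) := u1)"
      let ?w = "\<lambda>j k. y (Inr (j, k))"
      have block: "block_sum N j t ?w = cis (t * y (Inr (j, 1))) + (cis (t * y (Inr (j, 2))) + w j)" if "N j \<ge> 2" for j
      proof -
        have "{1..N j} = insert 1 (insert 2 {3..N j})" using that by auto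
        then show ?thesis by (simp add: block_sum_def w_def y_def)
      qed
      have b1: "block_sum N j1 t ?w = cis (t * u1) + (cis (t * u2) + w j1)"
        using block[OF j(4)] j by (simp add: y_def)
      have b2: "block_sum N j2 t ?w = cis (t * v1) + (cis (t * v2) + w j2)"
        using block[OF j(5)] j by (simp add: y_def)
      have bo: "block_sum N j t ?w = block_sum N j t (\<lambda>j k. x (Inr (j, k)))" if "j \<in> {1..n} - {j1, j2}" for j
        using that by (intro block_sum_cong) (auto simp: y_def)
      let ?g = "\<lambda>j. ((cmod (block_sum N j t ?w))\<^sup>2 - real (N j)) / 2"
      have "S ?w = ?g j1 + (?g j2 + sum ?g ({1..n} - {j1, j2}))"
        unfolding S_def using j sum.remove[of "{1..n}" j1 ?g] sum.remove[of "{1..n} - {j1}" j2 ?g]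
        by (simp add: Diff_insert2[symmetric] insert_commute)
      also have "sum ?g ({1..n} - {j1, j2}) = (\<Sum>j\<in>{1..n} - {j1, j2}. ((cmod (block_sum N j t (\<lambda>j k. x (Inr (j, k)))))\<^sup>2 - real (N j)) / 2)"
        by (intro sum.cong refl) (simp only: bo)
      finally have "S ?w = (cmod (cis (t * u1) + (cis (t * u2) + w j1)))\<^sup>2 / 2 + (cmod (cis (t * v1) + (cis (t * v2) + w j2)))\<^sup>2 / 2 + c"
        unfolding b1 b2 c_def by (simp add: diff_divide_distrib)
      then show ?thesis unfolding f_def y_def[symmetric] by (rule arg_cong)
    qed
    then show "(\<integral>\<^sup>+y4. \<integral>\<^sup>+y3. \<integral>\<^sup>+y2. \<integral>\<^sup>+y1. f (x(Inr (j2, 2) := y4, Inr (j1, 2) := y3, Inr (j2, 1) := y2, Inr (j1, 1) := y1))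
        \<partial>err_dist \<partial>err_dist \<partial>err_dist \<partial>err_dist) \<le> 2 * (2 * C) ^ 4"
      by (simp only: two_block_moment)
  qed
  finally have le: "(\<integral>\<^sup>+\<omega>. inv_powr p (S (errs \<omega>)) \<partial>P) \<le> 2 * (2 * C) ^ 4" .
  have S_meas: "(\<lambda>\<omega>. S (errs \<omega>)) \<in> borel_measurable P"
  proof -
    have "(\<lambda>\<omega>. num_pairs N n * pair_avg N n t (errs \<omega>)) \<in> borel_measurable P" by measurable
    moreover have "num_pairs N n * pair_avg N n t w = S w" for w
      using num_pairs_pos[OF n1] by (simp add: pair_avg_def S_def)
    ultimately show ?thesis by simp
  qed
  have "(\<integral>\<^sup>+\<omega>. inv_powr p (pair_avg N n t (errs \<omega>)) \<partial>P) = (\<integral>\<^sup>+\<omega>. inv_powr p (1 / num_pairs N n) * inv_powr p (S (errs \<omega>)) \<partial>P)"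
    unfolding pair_avg_def S_def inv_powr_mult ..
  also have "\<dots> = inv_powr p (1 / num_pairs N n) * (\<integral>\<^sup>+\<omega>. inv_powr p (S (errs \<omega>)) \<partial>P)"
    using S_meas by (intro nn_integral_cmult) measurable
  also have "\<dots> \<le> inv_powr p (1 / num_pairs N n) * (2 * (2 * C) ^ 4)"
    by (intro mult_left_mono le) auto
  finally show ?thesis .
qed

section \<open>Frequencies near the origin\<close>

text \<open>A bound on \<open>1 - V(t)\<close> for \<open>|t| \<le> 1/n\<close> whose expectation tends to \<open>0\<close> without any moment
  assumption on the errors.\<close>

definition spread :: "nat \<Rightarrow> (nat \<Rightarrow> nat \<Rightarrow> real) \<Rightarrow> real" where
  "spread n w = (1 / num_pairs N n) * (\<Sum>j=1..n. \<Sum>(k1, k2)\<in>pair_set N j.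
     2 * (min 1 ((w j k1 / real n)\<^sup>2) + min 1 ((w j k2 / real n)\<^sup>2)))"

text \<open>The pairs are counted by evaluating the cosine identity at frequency 0, where every
  cosine is 1.\<close>

lemma sum_card_pair_set: "(\<Sum>j=1..n. \<Sum>p\<in>pair_set N j. 1) = num_pairs N n"
proof -
  have "real (card (pair_set N j)) = real (N j) * (real (N j) - 1) / 2" for j
    using sum_pair_set_cos[where N=N and j=j and t=0 and w="\<lambda>_ _. 0"]
    by (simp add: block_sum_def case_prod_beta power2_eq_square algebra_simps)
  then show ?thesis unfolding num_pairs_def sum_distrib_left by (intro sum.cong) auto
qed

text \<open>In \<open>1 - cos z = 2 * (sin (z / 2))^2\<close> the square is bounded both by 1 and by
  \<open>(z / 2)^2\<close>; the two bounds account for the two arguments of each minimum in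
  \<open>spread\<close>.\<close>

lemma pair_avg_near_zero:
  assumes n: "n \<ge> 1" and t: "\<bar>t\<bar> \<le> 1 / real n"
  shows "pair_avg N n t w \<ge> 1 - spread n w"
proof -
  have np: "num_pairs N n > 0" using n by (rule num_pairs_pos)
  have cos_ge: "1 - 2 * (min 1 ((a / real n)\<^sup>2) + min 1 ((b / real n)\<^sup>2)) \<le> cos (t * (a - b))" for a b :: real
  proof -
    define z where "z = t * (a - b)"
    have "cos z = 1 - 2 * (sin (z / 2))\<^sup>2" using cos_double_sin[of "z / 2"] by simp
    moreover have "(sin (z / 2))\<^sup>2 \<le> min 1 ((a / real n)\<^sup>2) + min 1 ((b / real n)\<^sup>2)"
    proof (cases "(a / real n)\<^sup>2 \<ge> 1 \<or> (b / real n)\<^sup>2 \<ge> 1")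
      case True
      have "(sin (z / 2))\<^sup>2 \<le> 1" by (simp add: abs_square_le_1)
      moreover have "0 \<le> min 1 ((a / real n)\<^sup>2)" "0 \<le> min 1 ((b / real n)\<^sup>2)" by auto
      ultimately show ?thesis using True by linarith
    next
      case False
      have "\<bar>sin (z / 2)\<bar> \<le> \<bar>z / 2\<bar>" by (rule abs_sin_x_le_abs_x)
      then have "\<bar>sin (z / 2)\<bar>\<^sup>2 \<le> \<bar>z / 2\<bar>\<^sup>2" by (intro power_mono) auto
      then have "(sin (z / 2))\<^sup>2 \<le> (z / 2)\<^sup>2" by (simp only: power2_abs)
      also have "\<dots> = \<bar>t\<bar>\<^sup>2 * (a - b)\<^sup>2 / 4" by (simp add: z_def power_mult_distrib power_divide)
      also have "\<dots> \<le> (1 / real n)\<^sup>2 * (2 * (a\<^sup>2 + b\<^sup>2)) / 4"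
      proof (intro divide_right_mono mult_mono power_mono t)
        show "(a - b)\<^sup>2 \<le> 2 * (a\<^sup>2 + b\<^sup>2)"
          using zero_le_power2[of "a + b"] by (simp add: power2_eq_square algebra_simps)
      qed auto
      also have "\<dots> = ((a / real n)\<^sup>2 + (b / real n)\<^sup>2) / 2" by (simp add: power_divide add_divide_distrib)
      also have "\<dots> \<le> (a / real n)\<^sup>2 + (b / real n)\<^sup>2" by simp
      finally show ?thesis using False by simp
    qed
    ultimately show ?thesis by (simp add: z_def)
  qed
  have "(1 - spread n w) * num_pairs N n = (\<Sum>j=1..n. \<Sum>(k1, k2)\<in>pair_set N j.
     1 - 2 * (min 1 ((w j k1 / real n)\<^sup>2) + min 1 ((w j k2 / real n)\<^sup>2)))"
    using np sum_card_pair_set[of n]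
    by (simp add: spread_def left_diff_distrib case_prod_beta sum_subtractf)
  also have "\<dots> \<le> (\<Sum>j=1..n. \<Sum>(k1, k2)\<in>pair_set N j. cos (t * (w j k1 - w j k2)))"
    using cos_ge by (intro sum_mono) auto
  also have "\<dots> = pair_avg N n t w * num_pairs N n"
    unfolding sum_pair_set_cos pair_avg_def using np by simp
  finally show ?thesis using np by simp
qed

definition err_tail :: "nat \<Rightarrow> real" where
  "err_tail n = (\<integral>u. min 1 ((u / real n)\<^sup>2) \<partial>err_dist)"

text \<open>Dominated convergence with majorant 1, which the truncation provides whatever the tails
  of the errors are.\<close>

lemma err_tail_tendsto_0: "err_tail \<longlonglongrightarrow> 0"
proof -
  interpret D: real_distribution err_dist by (rule prob_density_real_distribution[OF fU])
  have "(\<lambda>n. \<integral>u. min 1 ((u / real n)\<^sup>2) \<partial>err_dist) \<longlonglongrightarrow> (\<integral>u. 0 \<partial>err_dist)"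
  proof (rule integral_dominated_convergence[where w="\<lambda>_. 1"])
    have "(\<lambda>n. min 1 ((u / real n)\<^sup>2)) \<longlonglongrightarrow> min 1 (0\<^sup>2)" for u :: real
      by (intro tendsto_intros tendsto_divide_0[OF tendsto_const] filterlim_at_top_imp_at_infinity filterlim_real_sequentially)
    then show "AE u in err_dist. (\<lambda>n. min 1 ((u / real n)\<^sup>2)) \<longlonglongrightarrow> 0" by simp
  qed auto
  then show ?thesis by (simp add: err_tail_def [abs_def])
qed

lemma measurable_spread [measurable]: "(\<lambda>\<omega>. spread n (errs \<omega>)) \<in> borel_measurable P"
  unfolding spread_def
proof (intro borel_measurable_times borel_measurable_const borel_measurable_sum)
  fix j p assume "j \<in> {1..n}" "p \<in> pair_set N j"
  then have [measurable]: "U j (fst p) \<in> borel_measurable P" "U j (snd p) \<in> borel_measurable P"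
    by (auto simp: pair_set_def intro!: measurable_U)
  show "(\<lambda>\<omega>. case p of (k1, k2) \<Rightarrow> 2 * (min 1 ((errs \<omega> j k1 / real n)\<^sup>2) + min 1 ((errs \<omega> j k2 / real n)\<^sup>2))) \<in> borel_measurable P"
    unfolding case_prod_beta by measurable
qed

text \<open>Markov's inequality: every pair contributes mean \<open>4 * err_tail n\<close>, and the
  threshold 1/2 doubles it.\<close>

lemma prob_spread_le:
  assumes n: "n \<ge> 1"
  shows "prob {\<omega> \<in> space P. spread n (errs \<omega>) \<ge> 1 / 2} \<le> 8 * err_tail n"
proof -
  have np: "num_pairs N n > 0" using n by (rule num_pairs_pos)
  let ?m = "\<lambda>j k \<omega>. min 1 ((U j k \<omega> / real n)\<^sup>2)"
  have m_int: "integrable P (?m j k)" and m_exp: "expectation (?m j k) = err_tail n"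
    if "j \<ge> 1" "k \<in> {1..N j}" for j k
  proof -
    have [measurable]: "U j k \<in> borel_measurable P" using that by (rule measurable_U)
    show "integrable P (?m j k)" by (rule integrable_bounded[where B=1]) auto
    have "expectation (?m j k) = (\<integral>u. min 1 ((u / real n)\<^sup>2) \<partial>distr P borel (U j k))"
      by (subst integral_distr) auto
    then show "expectation (?m j k) = err_tail n" by (simp add: distr_U[OF that] err_tail_def)
  qed
  have pr: "1 \<le> j \<and> fst p \<in> {1..N j} \<and> snd p \<in> {1..N j}" if "j \<in> {1..n}" "p \<in> pair_set N j" for j p
    using that by (auto simp: pair_set_def)
  have int: "integrable P (\<lambda>\<omega>. 2 * (?m j (fst p) \<omega> + ?m j (snd p) \<omega>))" if "j \<in> {1..n}" "p \<in> pair_set N j" for j p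
    using pr[OF that] by (intro integrable_mult_right Bochner_Integration.integrable_add m_int) auto
  have e1: "(\<integral>\<omega>. 2 * (?m j (fst p) \<omega> + ?m j (snd p) \<omega>) \<partial>P) = 4 * err_tail n" if "j \<in> {1..n}" "p \<in> pair_set N j" for j p
    using pr[OF that] m_int m_exp by simp
  have s_int: "integrable P (\<lambda>\<omega>. spread n (errs \<omega>))"
    unfolding spread_def case_prod_beta
    by (intro integrable_mult_right Bochner_Integration.integrable_sum int)
  have "expectation (\<lambda>\<omega>. spread n (errs \<omega>)) = (1 / num_pairs N n) * (\<Sum>j=1..n. \<Sum>p\<in>pair_set N j. 4 * err_tail n)"
    unfolding spread_def case_prod_beta integral_mult_right_zero
    by (simp only: Bochner_Integration.integral_sum Bochner_Integration.integrable_sum int e1 cong: sum.cong)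
  also have "\<dots> = (1 / num_pairs N n) * (4 * err_tail n * (\<Sum>j=1..n. \<Sum>p\<in>pair_set N j. 1))"
    unfolding sum_distrib_left by simp
  also have "\<dots> = 4 * err_tail n" unfolding sum_card_pair_set using np by simp
  finally have E: "expectation (\<lambda>\<omega>. spread n (errs \<omega>)) = 4 * err_tail n" .
  have nonneg: "spread n w \<ge> 0" for w
    unfolding spread_def using np by (intro mult_nonneg_nonneg sum_nonneg) auto
  have "prob {\<omega> \<in> space P. spread n (errs \<omega>) \<ge> 1 / 2} \<le> expectation (\<lambda>\<omega>. spread n (errs \<omega>)) / (1 / 2)"
    by (intro integral_Markov_inequality_measure[OF s_int, of "{}"]) (auto simp: nonneg)
  then show ?thesis by (simp add: E)
qed

end

section \<open>Removing the ridge\<close>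

text \<open>With \<open>x = sqrt \<bar>v\<bar>\<close> the gap is \<open>z / x\<close> for
  \<open>z = \<rho> / (x + \<rho>)\<close>. As \<open>z\<close> is at most 1, it is at most
  \<open>z powr \<sigma>\<close>, hence at most \<open>(\<rho> / x) powr \<sigma>\<close>: a small
  power of the ridge is bought with a slightly larger negative power of \<open>x\<close>. At
  \<open>v = 0\<close> the right-hand side is infinite.\<close>

lemma ridge_gap_le:
  fixes v \<rho> \<sigma> :: real
  assumes \<rho>: "\<rho> > 0" and \<sigma>: "0 < \<sigma>" "\<sigma> < 1"
  shows "ennreal \<bar>1 / sqrt \<bar>v\<bar> - 1 / (sqrt \<bar>v\<bar> + \<rho>)\<bar> \<le> ennreal (\<rho> powr \<sigma>) * inv_powr ((1 + \<sigma>) / 2) v"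
proof (cases "v = 0")
  case True
  then show ?thesis using \<rho> by (simp add: inv_powr_def ennreal_mult_top)
next
  case False
  define x where "x = sqrt \<bar>v\<bar>"
  have x: "x > 0" using False by (simp add: x_def)
  have xp: "\<bar>v\<bar> powr ((1 + \<sigma>) / 2) = x powr (1 + \<sigma>)"
  proof -
    have "x = \<bar>v\<bar> powr (1 / 2)" by (simp add: x_def powr_half_sqrt)
    then show ?thesis by (simp add: powr_powr)
  qed
  let ?z = "\<rho> / (x + \<rho>)"
  have z: "0 < ?z" "?z \<le> 1" using x \<rho> by auto
  have "?z powr 1 \<le> ?z powr \<sigma>" using z \<sigma> by (intro powr_mono') auto
  also have "\<dots> \<le> (\<rho> / x) powr \<sigma>"
    using x \<rho> \<sigma> by (intro powr_mono2 divide_left_mono) auto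
  finally have z_le: "?z \<le> \<rho> powr \<sigma> / x powr \<sigma>" using z x \<rho> by (simp add: powr_divide)
  have "\<bar>1 / x - 1 / (x + \<rho>)\<bar> = ?z / x"
  proof -
    have "1 / x - 1 / (x + \<rho>) = ?z / x" using x \<rho> by (simp add: field_simps)
    then show ?thesis using x \<rho> by simp
  qed
  also have "\<dots> \<le> (\<rho> powr \<sigma> / x powr \<sigma>) / x" using x z_le by (intro divide_right_mono) auto
  also have "\<dots> = \<rho> powr \<sigma> * (1 / x powr (1 + \<sigma>))" using x by (simp add: powr_add)
  finally have "ennreal \<bar>1 / x - 1 / (x + \<rho>)\<bar> \<le> ennreal (\<rho> powr \<sigma> * (1 / x powr (1 + \<sigma>)))"
    by (rule ennreal_leI)
  also have "\<dots> = ennreal (\<rho> powr \<sigma>) * inv_powr ((1 + \<sigma>) / 2) v"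
  proof -
    have "inv_powr ((1 + \<sigma>) / 2) v = ennreal (1 / x powr (1 + \<sigma>))"
      unfolding inv_powr_def xp using x by (simp only: inverse_ennreal powr_gt_zero inverse_eq_divide)
    then show ?thesis by (simp only: ennreal_mult powr_ge_zero divide_nonneg_nonneg zero_le_one)
  qed
  finally show ?thesis by (simp only: x_def)
qed

text \<open>Lets the same negative moment yield integrability of the ridge-free integrand. The
  summand 1 covers \<open>\<bar>v\<bar> \<ge> 1\<close>, where a larger exponent gives a smaller
  value.\<close>

lemma inverse_sqrt_le_inv_powr:
  fixes v p :: real
  assumes "p \<ge> 1 / 2"
  shows "ennreal (1 / sqrt \<bar>v\<bar>) \<le> 1 + inv_powr p v"
proof -
  consider "v = 0" | "\<bar>v\<bar> \<ge> 1" | "v \<noteq> 0" "\<bar>v\<bar> < 1" by linarith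
  then show ?thesis
  proof cases
    case 1
    then show ?thesis by simp
  next
    case 2
    then have "1 / sqrt \<bar>v\<bar> \<le> 1" by simp
    then have "ennreal (1 / sqrt \<bar>v\<bar>) \<le> 1" using ennreal_leI by fastforce
    then show ?thesis by (simp add: add_increasing2)
  next
    case 3
    have "\<bar>v\<bar> powr p \<le> \<bar>v\<bar> powr (1 / 2)" using 3 assms by (intro powr_mono') auto
    then have "inverse (\<bar>v\<bar> powr (1 / 2)) \<le> inverse (\<bar>v\<bar> powr p)"
      using 3 by (intro le_imp_inverse_le) auto
    moreover have "\<bar>v\<bar> powr (1 / 2) = sqrt \<bar>v\<bar>" by (rule powr_half_sqrt) simp
    ultimately have "1 / sqrt \<bar>v\<bar> \<le> inverse (\<bar>v\<bar> powr p)"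
      by (simp only: inverse_eq_divide)
    moreover have "inv_powr p v = ennreal (inverse (\<bar>v\<bar> powr p))"
      unfolding inv_powr_def using 3 by (intro inverse_ennreal) auto
    ultimately have "ennreal (1 / sqrt \<bar>v\<bar>) \<le> inv_powr p v"
      by (simp only: ennreal_leI)
    then show ?thesis by (simp add: add_increasing)
  qed
qed

context deconvolution
begin

lemma sin_moment_err_dist:
  assumes \<alpha>: "\<alpha> > 1 / 2" and psi_upper: "\<And>t. psi t \<le> B1 * (1 + \<bar>t\<bar>) powr - \<alpha>"
  obtains Kc p where "Kc > 0" "1 / 2 < p" "p < 1"
    "\<And>t a. t \<noteq> 0 \<Longrightarrow> (\<integral>\<^sup>+u. inv_powr p (sin ((t * u - a) / 2)) \<partial>err_dist) \<le> ennreal (Kc * (1 + 1 / \<bar>t\<bar>))"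
proof -
  interpret D: real_distribution err_dist by (rule prob_density_real_distribution[OF fU])
  \<comment> \<open>The small-ball bound requires a decay exponent below 1, so \<alpha> is capped at
    3/4; \<open>b\<close> stays above 1/2, and \<open>p\<close> is the midpoint of 1/2 and
    \<open>b\<close>.\<close>
  define b where "b = min \<alpha> (3 / 4)"
  define p where "p = (1 / 2 + b) / 2"
  have b: "1 / 2 < b" "b < 1" "b \<le> \<alpha>" using \<alpha> by (auto simp: b_def)
  have p: "1 / 2 < p" "p < b" using b by (auto simp: p_def)
  have ch: "cmod (char err_dist s) \<le> B1 * (1 + \<bar>s\<bar>) powr - b" for s
  proof -
    have "cmod (char err_dist s) = psi s"
      using psi_pos[of s] by (simp add: char_density_eq_FT[OF fU] FT_fU_eq)
    also have "\<dots> \<le> B1 * (1 + \<bar>s\<bar>) powr - \<alpha>" by (rule psi_upper)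
    also have "\<dots> \<le> B1 * (1 + \<bar>s\<bar>) powr - b"
      using b B1 by (intro mult_left_mono powr_mono) auto
    finally show ?thesis .
  qed
  let ?K = "4 powr p + 8 * (1 + B1 / (1 - b)) * (8 powr p / (1 - 2 powr (p - b)))"
  have "2 powr (p - b) < (2 :: real) powr 0" using p by (intro powr_less_mono) auto
  then have "?K > 0" using b B1 by (intro add_pos_nonneg mult_nonneg_nonneg) auto
  moreover have "(\<integral>\<^sup>+u. inv_powr p (sin ((t * u - a) / 2)) \<partial>err_dist) \<le> ennreal (?K * (1 + 1 / \<bar>t\<bar>))"
    if "t \<noteq> 0" for t a
    using p b B1 ch that by (intro D.sin_inverse_moment_le) auto
  ultimately show thesis using p b by (intro that[of ?K p]) auto
qed

text \<open>Already integrated over the frequencies and free of \<open>x\<close>, so that a single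
  exceptional event serves all points \<open>x\<close>.\<close>

definition far_moment :: "nat \<Rightarrow> real \<Rightarrow> real \<Rightarrow> 'w \<Rightarrow> ennreal" where
  "far_moment n p T \<omega> = (\<integral>\<^sup>+s. inv_powr p (pair_avg N n s (errs \<omega>)) * indicator ({-T..T} - {-(1 / real n)..1 / real n}) s \<partial>lborel)"

lemma measurable_pair_avg_pair: "(\<lambda>q. pair_avg N n (snd q) (errs (fst q))) \<in> borel_measurable (P \<Otimes>\<^sub>M lborel)"
  by (intro measurable_pair_avg measurable_compose[OF measurable_fst] measurable_U) auto

lemma measurable_pair_avg_t [measurable]: "(\<lambda>s. pair_avg N n s w) \<in> borel_measurable borel"
  by (intro measurable_pair_avg) auto

lemma measurable_far_moment [measurable]: "far_moment n p T \<in> borel_measurable P"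
proof -
  note [measurable] = measurable_pair_avg_pair
  have "(\<lambda>q. inv_powr p (pair_avg N n (snd q) (errs (fst q))) * indicator ({-T..T} - {-(1 / real n)..1 / real n}) (snd q)) \<in> borel_measurable (P \<Otimes>\<^sub>M lborel)"
    by measurable
  then have "(\<lambda>(\<omega>, s). inv_powr p (pair_avg N n s (errs \<omega>)) * indicator ({-T..T} - {-(1 / real n)..1 / real n}) s) \<in> borel_measurable (P \<Otimes>\<^sub>M lborel)"
    by (simp add: case_prod_beta)
  then show ?thesis unfolding far_moment_def [abs_def] by (rule lborel.borel_measurable_nn_integral)
qed

lemma num_pairs_le: "num_pairs N n \<le> real n * C1\<^sup>2"
proof -
  have "(\<Sum>j=1..n. real (N j) * (real (N j) - 1)) \<le> (\<Sum>j=1..n. C1 * C1)"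
  proof (rule sum_mono)
    fix j assume "j \<in> {1..n}"
    then have "1 \<le> N j \<and> real (N j) \<le> C1" by (intro N_bounds) auto
    then show "real (N j) * (real (N j) - 1) \<le> C1 * C1" using C1 by (intro mult_mono) auto
  qed
  also have "\<dots> = real n * C1\<^sup>2" by (simp add: power2_eq_square)
  finally have "num_pairs N n \<le> real n * C1\<^sup>2 / 2" by (simp add: num_pairs_def)
  moreover have "0 \<le> real n * C1\<^sup>2" by simp
  ultimately show ?thesis by linarith
qed

text \<open>Outside the small interval \<open>1 / \<bar>s\<bar>\<close> is at most \<open>n\<close>,
  which makes the moment bound polynomial in \<open>n\<close>. Its degree is immaterial, because the
  auxiliary ridge may be any negative power of \<open>n\<close>; this is why the estimates are
  crude.\<close>

lemma expectation_far_moment_le: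
  assumes n: "real n > C1 ^ 3" and T: "T \<ge> 0" and p: "0 < p" "p < 1" and Kc: "Kc > 0"
    and moment: "\<And>t a. t \<noteq> 0 \<Longrightarrow> (\<integral>\<^sup>+u. inv_powr p (sin ((t * u - a) / 2)) \<partial>err_dist) \<le> ennreal (Kc * (1 + 1 / \<bar>t\<bar>))"
  shows "(\<integral>\<^sup>+\<omega>. far_moment n p T \<omega> \<partial>P) \<le> ennreal (2 * T * (real n * C1\<^sup>2 * (2 * (2 * (Kc * (1 + real n))) ^ 4)))"
proof -
  interpret pair_sigma_finite P lborel ..
  note [measurable] = measurable_pair_avg_pair
  have "1 < C1 ^ 3" using C1 by simp
  then have n1: "n \<ge> 1" using n by (cases n) auto
  let ?A = "{-T..T} - {-(1 / real n)..1 / real n}"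
  let ?f = "\<lambda>\<omega> s. inv_powr p (pair_avg N n s (errs \<omega>)) * indicator ?A s"
  let ?B = "real n * C1\<^sup>2 * (2 * (2 * (Kc * (1 + real n))) ^ 4)"
  have "(\<lambda>q. ?f (fst q) (snd q)) \<in> borel_measurable (P \<Otimes>\<^sub>M lborel)" by measurable
  then have m: "(\<lambda>(\<omega>, s). ?f \<omega> s) \<in> borel_measurable (P \<Otimes>\<^sub>M lborel)" by (simp add: case_prod_beta)
  have np: "inv_powr p (1 / num_pairs N n) \<le> ennreal (real n * C1\<^sup>2)"
  proof -
    have pos: "num_pairs N n > 0" using n1 by (rule num_pairs_pos)
    have C: "real n * C1\<^sup>2 \<ge> 1" using n1 C1 mult_mono[of 1 "real n" 1 "C1\<^sup>2"] by simp
    have "inv_powr p (1 / num_pairs N n) = ennreal (num_pairs N n powr p)"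
      using pos by (simp add: inv_powr_def inverse_ennreal powr_divide)
    also have "num_pairs N n powr p \<le> (real n * C1\<^sup>2) powr p"
      using pos p num_pairs_le by (intro powr_mono2) auto
    also have "\<dots> \<le> (real n * C1\<^sup>2) powr 1" using C p by (intro powr_mono) auto
    finally show ?thesis using C by (simp add: ennreal_leI)
  qed
  have inner: "(\<integral>\<^sup>+\<omega>. ?f \<omega> s \<partial>P) \<le> ennreal ?B * indicator {-T..T} s" for s
  proof (cases "s \<in> ?A")
    case True
    then have "\<not> \<bar>s\<bar> \<le> 1 / real n" by (auto simp: abs_le_iff)
    then have s0: "\<bar>s\<bar> > 1 / real n" by simp
    moreover have "1 / real n > 0" using n1 by simp
    ultimately have "\<bar>s\<bar> > 0" by linarith
    then have s: "s \<noteq> 0" "1 / \<bar>s\<bar> \<le> real n" using n1 s0 by (auto simp: field_simps)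
    have "(\<integral>\<^sup>+\<omega>. ?f \<omega> s \<partial>P) = (\<integral>\<^sup>+\<omega>. inv_powr p (pair_avg N n s (errs \<omega>)) \<partial>P)"
      using True by (intro nn_integral_cong) simp
    also have "\<dots> \<le> inv_powr p (1 / num_pairs N n) * (2 * (2 * ennreal (Kc * (1 + real n))) ^ 4)"
    proof (rule negative_moment_pair_avg[OF n p(1)])
      fix a
      have "(\<integral>\<^sup>+u. inv_powr p (sin ((s * u - a) / 2)) \<partial>err_dist) \<le> ennreal (Kc * (1 + 1 / \<bar>s\<bar>))"
        using s(1) by (rule moment)
      also have "\<dots> \<le> ennreal (Kc * (1 + real n))" using s Kc by (intro ennreal_leI mult_left_mono) auto
      finally show "(\<integral>\<^sup>+u. inv_powr p (sin ((s * u - a) / 2)) \<partial>err_dist) \<le> ennreal (Kc * (1 + real n))" .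
    qed
    also have "\<dots> \<le> ennreal (real n * C1\<^sup>2) * (2 * (2 * ennreal (Kc * (1 + real n))) ^ 4)"
      by (intro mult_right_mono np) auto
    also have "\<dots> = ennreal ?B"
      using Kc by (simp add: ennreal_mult'[symmetric] ennreal_power ennreal_mult[symmetric] flip: ennreal_numeral)
    finally show ?thesis using True by simp
  qed simp
  have "(\<integral>\<^sup>+\<omega>. far_moment n p T \<omega> \<partial>P) = (\<integral>\<^sup>+s. (\<integral>\<^sup>+\<omega>. ?f \<omega> s \<partial>P) \<partial>lborel)"
    unfolding far_moment_def by (rule Fubini'[OF m, symmetric])
  also have "\<dots> \<le> (\<integral>\<^sup>+s. ennreal ?B * indicator {-T..T} s \<partial>lborel)"
    by (intro nn_integral_mono inner)
  also have "\<dots> = ennreal ?B * ennreal (2 * T)" using T by (simp add: nn_integral_cmult emeasure_lborel_Icc_eq)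
  also have "\<dots> = ennreal (2 * T * ?B)" using T by (simp add: ennreal_mult'[symmetric] mult_ac)
  finally show ?thesis .
qed

section \<open>Deterministic estimates at an outcome in the good event\<close>

context
  fixes n :: nat and h p \<rho> :: real and \<omega> :: 'w
  assumes n: "n \<ge> 1" and h: "h > 0" and p: "1 / 2 < p" "p < 1" and \<rho>: "\<rho> > 0"
    and spread: "spread n (errs \<omega>) < 1 / 2" and finite_moment: "far_moment n p (c / h) \<omega> < \<infinity>"
begin

text \<open>Near the origin the pair average is at least 1/2 and its negative power at most 2, over
  an interval of length \<open>2 / n\<close>; this contributes at most 4.\<close>

lemma total_moment_le:
  "(\<integral>\<^sup>+s. inv_powr p (pair_avg N n s (errs \<omega>)) * indicator {-(c / h)..c / h} s \<partial>lborel) \<le> 4 + far_moment n p (c / h) \<omega>"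
proof -
  let ?I = "{-(1 / real n)..1 / real n}" and ?T = "{-(c / h)..c / h}"
  let ?v = "\<lambda>s. inv_powr p (pair_avg N n s (errs \<omega>))"
  have near: "?v s \<le> 2" if "s \<in> ?I" for s
  proof -
    have "pair_avg N n s (errs \<omega>) \<ge> 1 / 2"
      using pair_avg_near_zero[OF n, of s "errs \<omega>"] spread that by (auto simp: abs_le_iff)
    then have "?v s \<le> inv_powr p (1 / 2)" using p by (intro inv_powr_antimono) auto
    also have "\<dots> = ennreal (2 powr p)" by (simp add: inv_powr_def inverse_ennreal powr_divide)
    also have "\<dots> \<le> ennreal (2 powr 1)" using p by (intro ennreal_leI powr_mono) auto
    finally show ?thesis by simp
  qed
  have "(\<integral>\<^sup>+s. ?v s * indicator ?T s \<partial>lborel) \<le> (\<integral>\<^sup>+s. 2 * indicator ?I s + ?v s * indicator (?T - ?I) s \<partial>lborel)"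
    using near by (intro nn_integral_mono) (auto simp: indicator_def)
  also have "\<dots> = (\<integral>\<^sup>+s. 2 * indicator ?I s \<partial>lborel) + far_moment n p (c / h) \<omega>"
    unfolding far_moment_def by (rule nn_integral_add) measurable
  also have "(\<integral>\<^sup>+s. 2 * indicator ?I s \<partial>lborel) = ennreal (4 / real n)"
    by (simp add: nn_integral_cmult emeasure_lborel_Icc_eq ennreal_mult'[symmetric] flip: ennreal_numeral)
  also have "\<dots> \<le> 4"
  proof -
    have "4 / real n \<le> 4" using n by (simp add: field_simps)
    then show ?thesis using ennreal_leI by fastforce
  qed
  finally show ?thesis by (simp add: add_mono)
qed

lemma FT_K_scaled_le: "cmod (FT K (h * s)) \<le> k0 * indicator {-(c / h)..c / h} s"
proof (cases "\<bar>s\<bar> \<le> c / h")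
  case True
  then show ?thesis using FT_K_le[of "h * s"] by (simp add: abs_le_iff)
next
  case False
  then have "\<bar>h * s\<bar> > c" using h by (simp add: abs_mult field_simps)
  then show ?thesis using FT_K_support[of "h * s"] False by (auto simp: indicator_def)
qed

text \<open>The summand 0 keeps the shape of the estimator with ridge, to which
  \<open>fX_hat_fourier\<close> refers.\<close>

lemma integrable_no_ridge: "integrable lborel (\<lambda>t. FT K t * (1 / of_real (fU_Ft_hat N n (errs \<omega>) (t / h) + 0)))"
proof -
  let ?F = "\<lambda>t. FT K t * (1 / of_real (fU_Ft_hat N n (errs \<omega>) (t / h) + 0))"
  let ?v = "\<lambda>s. pair_avg N n s (errs \<omega>)" and ?T = "{-(c / h)..c / h}"
  have "integrable lborel (\<lambda>s. ?F (0 + h * s))"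
  proof (rule integrableI_bounded)
    have [measurable]: "fU_Ft_hat N n (errs \<omega>) \<in> borel_measurable borel"
      by (intro measurable_fU_Ft_hat) auto
    show "(\<lambda>s. ?F (0 + h * s)) \<in> borel_measurable lborel" by measurable
    have "(\<integral>\<^sup>+s. ennreal (norm (?F (0 + h * s))) \<partial>lborel)
       \<le> (\<integral>\<^sup>+s. ennreal k0 * (indicator ?T s + inv_powr p (?v s) * indicator ?T s) \<partial>lborel)"
    proof (intro nn_integral_mono)
      fix s
      have "norm (?F (0 + h * s)) = cmod (FT K (h * s)) * (1 / sqrt \<bar>?v s\<bar>)"
        using h by (simp add: norm_mult norm_divide fU_Ft_hat_eq)
      also have "\<dots> \<le> k0 * indicator ?T s * (1 / sqrt \<bar>?v s\<bar>)" by (intro mult_right_mono FT_K_scaled_le) auto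
      finally have "ennreal (norm (?F (0 + h * s))) \<le> ennreal (k0 * indicator ?T s * (1 / sqrt \<bar>?v s\<bar>))" by (rule ennreal_leI)
      also have "\<dots> = ennreal k0 * (indicator ?T s * ennreal (1 / sqrt \<bar>?v s\<bar>))"
      proof -
        have *: "ennreal (k0 * indicator ?T s * y) = ennreal k0 * (indicator ?T s * ennreal y)" if "0 \<le> y" for y
          using that k0_nonneg ennreal_mult[of k0 y] by (cases "s \<in> ?T") auto
        show ?thesis by (rule *) simp
      qed
      also have "\<dots> \<le> ennreal k0 * (indicator ?T s * (1 + inv_powr p (?v s)))"
        using p by (intro mult_left_mono inverse_sqrt_le_inv_powr) auto
      finally show "ennreal (norm (?F (0 + h * s))) \<le> ennreal k0 * (indicator ?T s + inv_powr p (?v s) * indicator ?T s)"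
        by (simp add: distrib_left mult.commute)
    qed
    also have "\<dots> = ennreal k0 * (emeasure lborel ?T + (\<integral>\<^sup>+s. inv_powr p (?v s) * indicator ?T s \<partial>lborel))"
      by (subst nn_integral_cmult, measurable, subst nn_integral_add) auto
    also have "\<dots> \<le> ennreal k0 * (emeasure lborel ?T + (4 + far_moment n p (c / h) \<omega>))"
      by (intro mult_left_mono add_left_mono total_moment_le) auto
    also have "\<dots> < \<infinity>"
      using finite_moment by (simp add: ennreal_mult_less_top emeasure_lborel_Icc_eq)
    finally show "(\<integral>\<^sup>+s. ennreal (norm (?F (0 + h * s))) \<partial>lborel) < \<infinity>" .
  qed
  then show ?thesis
    using lborel_integrable_real_affine_iff[of h ?F 0] h by simp
qed

text \<open>\<open>ridge_gap_le\<close> with \<sigma> equal to \<open>2 * p - 1\<close>, so that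
  \<open>(1 + \<sigma>) / 2 = p\<close>. The empirical characteristic function has modulus at most
  1, which frees the bound from \<open>x\<close> and from the signals.\<close>

lemma ridge_effect_le:
  "ennreal (cmod (fX_hat K N n h 0 (obs X U \<omega>) x - fX_hat K N n h \<rho> (obs X U \<omega>) x))
    \<le> ennreal (k0 * \<rho> powr (2 * p - 1)) * (4 + far_moment n p (c / h) \<omega>)"
proof -
  note f0 = fX_hat_fourier[OF h integrable_no_ridge, of x] and fr = fX_hat_fourier[where n=n and \<omega>=\<omega> and x=x and \<rho>=\<rho>, OF h integrable_hat[OF \<rho>]]
  let ?v = "\<lambda>s. pair_avg N n s (errs \<omega>)" and ?T = "{-(c / h)..c / h}"
  let ?g = "\<lambda>s. 1 / sqrt \<bar>?v s\<bar> - 1 / (sqrt \<bar>?v s\<bar> + \<rho>)"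
  let ?D = "\<lambda>s. cis (- (s * x)) * (FT K (h * s) * of_real (?g s)) * emp_cf n s \<omega>"
  have "fX_hat K N n h 0 (obs X U \<omega>) x - fX_hat K N n h \<rho> (obs X U \<omega>) x
      = complex_of_real (1 / (2 * pi)) * (\<integral>s. ?D s \<partial>lborel)"
    unfolding f0(1) fr(1) right_diff_distrib[symmetric] Bochner_Integration.integral_diff[OF f0(2) fr(2), symmetric]
    by (intro arg_cong2[where f="(*)"] refl Bochner_Integration.integral_cong)
      (simp add: fU_Ft_hat_eq algebra_simps)
  then have "cmod (fX_hat K N n h 0 (obs X U \<omega>) x - fX_hat K N n h \<rho> (obs X U \<omega>) x)
      = cmod (\<integral>s. ?D s \<partial>lborel) / (2 * pi)"
    by (simp add: norm_mult norm_divide)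
  also have "\<dots> \<le> cmod (\<integral>s. ?D s \<partial>lborel) / 1"
  proof -
    have "2 * pi \<ge> 1" using pi_ge_two by linarith
    then show ?thesis by (intro divide_left_mono) auto
  qed
  finally have "ennreal (cmod (fX_hat K N n h 0 (obs X U \<omega>) x - fX_hat K N n h \<rho> (obs X U \<omega>) x))
      \<le> ennreal (cmod (\<integral>s. ?D s \<partial>lborel))" by (simp add: ennreal_leI)
  also have "\<dots> \<le> (\<integral>\<^sup>+s. ennreal (cmod (?D s)) \<partial>lborel)" by (rule ennreal_norm_integral_le)
  also have "\<dots> \<le> (\<integral>\<^sup>+s. ennreal (k0 * \<rho> powr (2 * p - 1)) * (inv_powr p (?v s) * indicator ?T s) \<partial>lborel)"
  proof (intro nn_integral_mono)
    fix s
    have "cmod (?D s) = cmod (FT K (h * s)) * \<bar>?g s\<bar> * cmod (emp_cf n s \<omega>)"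
      unfolding norm_mult norm_of_real by simp
    also have "\<dots> \<le> (k0 * indicator ?T s) * \<bar>?g s\<bar> * 1"
      using k0_nonneg by (intro mult_mono FT_K_scaled_le cmod_emp_cf_le_1 n) (auto intro!: mult_nonneg_nonneg)
    finally have "ennreal (cmod (?D s)) \<le> ennreal ((k0 * indicator ?T s) * \<bar>?g s\<bar>)" by (simp add: ennreal_leI)
    also have "\<dots> = ennreal k0 * (indicator ?T s * ennreal \<bar>?g s\<bar>)"
      using k0_nonneg by (simp add: ennreal_mult indicator_def)
    also have "\<dots> \<le> ennreal k0 * (indicator ?T s * (ennreal (\<rho> powr (2 * p - 1)) * inv_powr p (?v s)))"
    proof -
      have "(1 + (2 * p - 1)) / 2 = p" by simp
      then show ?thesis using ridge_gap_le[OF \<rho>, of "2 * p - 1" "?v s"] p by (intro mult_left_mono) auto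
    qed
    finally show "ennreal (cmod (?D s)) \<le> ennreal (k0 * \<rho> powr (2 * p - 1)) * (inv_powr p (?v s) * indicator ?T s)"
      using k0_nonneg by (simp add: ennreal_mult mult_ac)
  qed
  also have "\<dots> = ennreal (k0 * \<rho> powr (2 * p - 1)) * (\<integral>\<^sup>+s. inv_powr p (?v s) * indicator ?T s \<partial>lborel)"
    by (rule nn_integral_cmult) measurable
  also have "\<dots> \<le> ennreal (k0 * \<rho> powr (2 * p - 1)) * (4 + far_moment n p (c / h) \<omega>)"
    by (intro mult_left_mono total_moment_le) auto
  finally show ?thesis .
qed

lemma fX_hat0_eq: "fX_hat0 a K N n h (obs X U \<omega>) x = fX_hat K N n h 0 (obs X U \<omega>) x"
  using integrable_no_ridge by (simp add: fX_hat0_def fU_Ft_hat_obs)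

end

text \<open>\<open>Q\<close> is \<open>n\<close> times the bound on the mean of
  \<open>far_moment\<close>, so by Markov's inequality it is exceeded with probability at most
  \<open>1 / n\<close>; the other part of the exceptional event is that of
  \<open>prob_spread_le\<close>. \<open>A\<close> is chosen before \<open>x\<close>, as the
  integrated error requires.\<close>

lemma ridge_free_event:
  assumes n: "real n > C1 ^ 3" and h: "h > 0" and p: "1 / 2 < p" "p < 1" and Kc: "Kc > 0" and \<rho>: "\<rho> > 0"
    and moment: "\<And>t a. t \<noteq> 0 \<Longrightarrow> (\<integral>\<^sup>+u. inv_powr p (sin ((t * u - a) / 2)) \<partial>err_dist) \<le> ennreal (Kc * (1 + 1 / \<bar>t\<bar>))"
    and Q: "Q = real n * (2 * (c / h) * (real n * C1\<^sup>2 * (2 * (2 * (Kc * (1 + real n))) ^ 4)))"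
  obtains A where "A \<in> sets P" "prob (space P - A) \<le> 8 * err_tail n + 1 / real n"
    "\<And>\<omega> x a. \<omega> \<in> A \<Longrightarrow> cmod (fX_hat0 a K N n h (obs X U \<omega>) x - fX_hat K N n h \<rho> (obs X U \<omega>) x) \<le> k0 * \<rho> powr (2 * p - 1) * (4 + Q)"
proof -
  have "1 < C1 ^ 3" using C1 by simp
  then have n1: "n \<ge> 1" using n by (cases n) auto
  have Q0: "Q > 0" unfolding Q using n1 c_pos h C1 Kc by (intro mult_pos_pos zero_less_power divide_pos_pos add_pos_pos) auto
  let ?H = "far_moment n p (c / h)"
  define S where "S = {\<omega> \<in> space P. spread n (errs \<omega>) \<ge> 1 / 2}"
  define G where "G = {\<omega> \<in> space P. ?H \<omega> \<ge> ennreal Q}"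
  have [measurable]: "S \<in> sets P" "G \<in> sets P" unfolding S_def G_def by measurable
  have "emeasure P G \<le> (1 / ennreal Q) * (\<integral>\<^sup>+\<omega>. ?H \<omega> \<partial>P)"
  proof -
    have "emeasure P {\<omega> \<in> space P. 1 \<le> (1 / ennreal Q) * ?H \<omega>} \<le> (1 / ennreal Q) * (\<integral>\<^sup>+\<omega>. ?H \<omega> * indicator (space P) \<omega> \<partial>P)"
      by (intro nn_integral_Markov_inequality) measurable
    moreover have "G \<subseteq> {\<omega> \<in> space P. 1 \<le> (1 / ennreal Q) * ?H \<omega>}"
    proof -
      have "1 \<le> (1 / ennreal Q) * y" if "ennreal Q \<le> y" for y
      proof -
        have "(1 / ennreal Q) * ennreal Q = 1" using Q0 by (simp add: ennreal_1[symmetric] divide_ennreal ennreal_mult'[symmetric] del: ennreal_1)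
        then show ?thesis using mult_left_mono[OF that, of "1 / ennreal Q"] by simp
      qed
      then show ?thesis by (auto simp: G_def)
    qed
    moreover have "(\<integral>\<^sup>+\<omega>. ?H \<omega> * indicator (space P) \<omega> \<partial>P) = (\<integral>\<^sup>+\<omega>. ?H \<omega> \<partial>P)"
      by (intro nn_integral_cong) simp
    ultimately show ?thesis using emeasure_mono[of G "{\<omega> \<in> space P. 1 \<le> (1 / ennreal Q) * ?H \<omega>}" P] by auto
  qed
  also have "\<dots> \<le> (1 / ennreal Q) * ennreal (Q / real n)"
  proof (intro mult_left_mono)
    have "(\<integral>\<^sup>+\<omega>. ?H \<omega> \<partial>P) \<le> ennreal (2 * (c / h) * (real n * C1\<^sup>2 * (2 * (2 * (Kc * (1 + real n))) ^ 4)))"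
      using n p c_pos h Kc moment by (intro expectation_far_moment_le) auto
    then show "(\<integral>\<^sup>+\<omega>. ?H \<omega> \<partial>P) \<le> ennreal (Q / real n)" unfolding Q using n1 by simp
  qed simp
  also have "\<dots> = ennreal (1 / real n)"
    using Q0 n1 by (simp add: ennreal_1[symmetric] divide_ennreal ennreal_mult'[symmetric] del: ennreal_1)
  finally have G: "prob G \<le> 1 / real n" by (simp add: emeasure_eq_measure)
  define A where "A = space P - (S \<union> G)"
  show thesis
  proof (rule that)
    show "A \<in> sets P" unfolding A_def by measurable
    have "space P - A = S \<union> G" by (auto simp: A_def S_def G_def)
    then have "prob (space P - A) \<le> prob S + prob G" by (simp add: measure_Un_le)
    also have "prob S \<le> 8 * err_tail n" unfolding S_def by (rule prob_spread_le[OF n1])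
    finally show "prob (space P - A) \<le> 8 * err_tail n + 1 / real n" using G by simp
    fix \<omega> x a assume "\<omega> \<in> A"
    then have s: "spread n (errs \<omega>) < 1 / 2" and H: "?H \<omega> < ennreal Q"
      by (auto simp: A_def S_def G_def not_le)
    then have fin: "?H \<omega> < \<infinity>" using order.strict_trans by fastforce
    have "ennreal (cmod (fX_hat0 a K N n h (obs X U \<omega>) x - fX_hat K N n h \<rho> (obs X U \<omega>) x))
       \<le> ennreal (k0 * \<rho> powr (2 * p - 1)) * (4 + ?H \<omega>)"
      unfolding fX_hat0_eq[OF n1 h p \<rho> s fin] by (rule ridge_effect_le[OF n1 h p \<rho> s fin])
    also have "\<dots> \<le> ennreal (k0 * \<rho> powr (2 * p - 1)) * (4 + ennreal Q)"
      using H by (intro mult_left_mono add_left_mono) auto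
    also have "\<dots> = ennreal (k0 * \<rho> powr (2 * p - 1) * (4 + Q))"
      using Q0 k0_nonneg by (simp add: ennreal_mult ennreal_plus flip: ennreal_numeral)
    finally show "cmod (fX_hat0 a K N n h (obs X U \<omega>) x - fX_hat K N n h \<rho> (obs X U \<omega>) x) \<le> k0 * \<rho> powr (2 * p - 1) * (4 + Q)"
      using Q0 k0_nonneg by (subst (asm) ennreal_le_iff) auto
  qed
qed

end

text \<open>Off an event of vanishing probability, \<open>Z\<close> is a negligible deterministic
  amount plus a term controlled in mean. Each is allotted half of \<epsilon>, and the second is
  handled by Markov's inequality.\<close>

lemma (in prob_space) small_o_pI:
  fixes Z Y :: "nat \<Rightarrow> 'a \<Rightarrow> ennreal" and r a b e :: "nat \<Rightarrow> real"
  assumes Z [measurable]: "\<And>n. Z n \<in> borel_measurable M" and Y [measurable]: "\<And>n. Y n \<in> borel_measurable M"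
    and nonneg: "\<And>n. 0 \<le> a n" "\<And>n. 0 \<le> b n"
    and r: "eventually (\<lambda>n. r n > 0) sequentially"
    and ev: "eventually (\<lambda>n. \<exists>A\<in>sets M. prob (space M - A) \<le> e n \<and> (\<forall>\<omega>\<in>A. Z n \<omega> \<le> ennreal (a n) + Y n \<omega>)) sequentially"
    and Yb: "eventually (\<lambda>n. (\<integral>\<^sup>+\<omega>. Y n \<omega> \<partial>M) \<le> ennreal (b n)) sequentially"
    and e: "e \<longlonglongrightarrow> 0" and a: "(\<lambda>n. a n / r n) \<longlonglongrightarrow> 0" and b: "(\<lambda>n. b n / r n) \<longlonglongrightarrow> 0"
  shows "small_o_p M Z r"
  unfolding small_o_p_def
proof (intro conjI allI impI)
  fix \<epsilon> :: real assume \<epsilon>: "\<epsilon> > 0"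
  have lim: "(\<lambda>n. e n + (2 / \<epsilon>) * (b n / r n)) \<longlonglongrightarrow> 0 + (2 / \<epsilon>) * 0"
    by (intro tendsto_intros e b)
  have a_small: "eventually (\<lambda>n. a n / r n < \<epsilon> / 2) sequentially"
    using a \<epsilon> by (intro order_tendstoD) auto
  have "eventually (\<lambda>n. prob {\<omega> \<in> space M. Z n \<omega> > ennreal (\<epsilon> * r n)} \<le> e n + (2 / \<epsilon>) * (b n / r n)) sequentially"
    using r ev Yb a_small
  proof eventually_elim
    case (elim n)
    then obtain A where A [measurable]: "A \<in> sets M" and pA: "prob (space M - A) \<le> e n"
      and ZA: "\<And>\<omega>. \<omega> \<in> A \<Longrightarrow> Z n \<omega> \<le> ennreal (a n) + Y n \<omega>" by auto
    have rn: "r n > 0" by fact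
    define k where "k = \<epsilon> / 2 * r n"
    have k: "k > 0" using \<epsilon> rn by (simp add: k_def)
    have an: "a n \<le> k" using \<open>a n / r n < \<epsilon> / 2\<close> rn by (simp add: k_def field_simps)
    let ?B = "{\<omega> \<in> space M. 1 \<le> ennreal (1 / k) * Y n \<omega>}"
    have sub: "{\<omega> \<in> space M. Z n \<omega> > ennreal (\<epsilon> * r n)} \<subseteq> (space M - A) \<union> ?B"
    proof
      fix \<omega> assume w: "\<omega> \<in> {\<omega> \<in> space M. Z n \<omega> > ennreal (\<epsilon> * r n)}"
      show "\<omega> \<in> (space M - A) \<union> ?B"
      proof (cases "\<omega> \<in> A")
        case True
        have "ennreal k \<le> Y n \<omega>"
        proof (rule ccontr)
          assume "\<not> ennreal k \<le> Y n \<omega>"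
          then have "Y n \<omega> \<le> ennreal k" by simp
          then have "Z n \<omega> \<le> ennreal k + ennreal k"
            using ZA[OF True] an by (meson add_mono ennreal_leI order_trans)
          also have "\<dots> = ennreal (\<epsilon> * r n)" using k by (simp add: k_def flip: ennreal_plus)
          finally show False using w by (auto dest: leD)
        qed
        then have "ennreal (1 / k) * ennreal k \<le> ennreal (1 / k) * Y n \<omega>" by (intro mult_left_mono) auto
        moreover have "ennreal (1 / k) * ennreal k = 1" using k by (simp add: ennreal_mult[symmetric])
        ultimately show ?thesis using w by auto
      qed (use w in auto)
    qed
    have "emeasure M ?B \<le> ennreal (1 / k) * (\<integral>\<^sup>+\<omega>. Y n \<omega> * indicator (space M) \<omega> \<partial>M)"
      by (rule nn_integral_Markov_inequality) measurable
    also have "(\<integral>\<^sup>+\<omega>. Y n \<omega> * indicator (space M) \<omega> \<partial>M) = (\<integral>\<^sup>+\<omega>. Y n \<omega> \<partial>M)"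
      by (intro nn_integral_cong) simp
    also have "ennreal (1 / k) * (\<integral>\<^sup>+\<omega>. Y n \<omega> \<partial>M) \<le> ennreal (1 / k) * ennreal (b n)"
      using elim by (intro mult_left_mono) auto
    also have "\<dots> = ennreal (b n / k)" using k nonneg by (simp add: ennreal_mult[symmetric])
    finally have "prob ?B \<le> b n / k" using k nonneg by (simp add: emeasure_eq_measure)
    have "prob {\<omega> \<in> space M. Z n \<omega> > ennreal (\<epsilon> * r n)} \<le> prob ((space M - A) \<union> ?B)"
      by (intro finite_measure_mono sub) measurable
    also have "\<dots> \<le> prob (space M - A) + prob ?B" by (intro measure_Un_le) measurable
    also have "\<dots> \<le> e n + b n / k" using pA \<open>prob ?B \<le> b n / k\<close> by simp
    also have "b n / k = (2 / \<epsilon>) * (b n / r n)" by (simp add: k_def)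
    finally show ?case .
  qed
  moreover have "eventually (\<lambda>n. 0 \<le> prob {\<omega> \<in> space M. Z n \<omega> > ennreal (\<epsilon> * r n)}) sequentially"
    by (intro always_eventually allI measure_nonneg)
  moreover have "(\<lambda>n. e n + (2 / \<epsilon>) * (b n / r n)) \<longlonglongrightarrow> 0" using lim by (simp only: mult_zero_right add_0_right)
  ultimately show "(\<lambda>n. prob {\<omega> \<in> space M. Z n \<omega> > ennreal (\<epsilon> * r n)}) \<longlonglongrightarrow> 0"
    using tendsto_sandwich[OF _ _ tendsto_const] by fast
qed (rule Z)

text \<open>Exceeding \<epsilon> times the root of \<open>q\<close> is the same event as the square
  exceeding \<open>\<epsilon>^2\<close> times \<open>q\<close>.\<close>

lemma small_o_p_sqrtI:
  fixes f :: "nat \<Rightarrow> 'w \<Rightarrow> real"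
  assumes f: "\<And>n. f n \<in> borel_measurable M" "\<And>n \<omega>. 0 \<le> f n \<omega>" and q: "\<And>n. 0 \<le> q n"
    and sq: "small_o_p M (\<lambda>n \<omega>. ennreal ((f n \<omega>)\<^sup>2)) q"
  shows "small_o_p M (\<lambda>n \<omega>. ennreal (f n \<omega>)) (\<lambda>n. q n powr (1 / 2))"
  unfolding small_o_p_def
proof (intro conjI allI impI)
  fix n show "(\<lambda>\<omega>. ennreal (f n \<omega>)) \<in> borel_measurable M" using f(1)[of n] by measurable
next
  fix \<epsilon> :: real assume \<epsilon>: "\<epsilon> > 0"
  have "ennreal (f n \<omega>) > ennreal (\<epsilon> * q n powr (1 / 2)) \<longleftrightarrow> ennreal ((f n \<omega>)\<^sup>2) > ennreal (\<epsilon>\<^sup>2 * q n)" for n \<omega>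
  proof -
    have "(\<epsilon> * q n powr (1 / 2))\<^sup>2 = \<epsilon>\<^sup>2 * q n" using q[of n] by (simp add: powr_half_sqrt power_mult_distrib)
    moreover have "(f n \<omega>)\<^sup>2 \<le> (\<epsilon> * q n powr (1 / 2))\<^sup>2 \<longleftrightarrow> f n \<omega> \<le> \<epsilon> * q n powr (1 / 2)"
      using \<epsilon> f(2)[of n \<omega>] by (intro power_mono_iff) auto
    ultimately have "f n \<omega> \<le> \<epsilon> * q n powr (1 / 2) \<longleftrightarrow> (f n \<omega>)\<^sup>2 \<le> \<epsilon>\<^sup>2 * q n" by simp
    then have "\<epsilon> * q n powr (1 / 2) < f n \<omega> \<longleftrightarrow> \<epsilon>\<^sup>2 * q n < (f n \<omega>)\<^sup>2" by linarith
    moreover have "ennreal x < ennreal y \<longleftrightarrow> x < y" if "0 \<le> x" for x y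
      using that by (rule ennreal_less_iff)
    moreover have "0 \<le> \<epsilon> * q n powr (1 / 2)" "0 \<le> \<epsilon>\<^sup>2 * q n" using \<epsilon> q[of n] by simp_all
    ultimately show ?thesis by (simp only:)
  qed
  then have eq: "{\<omega> \<in> space M. ennreal (f n \<omega>) > ennreal (\<epsilon> * q n powr (1 / 2))} = {\<omega> \<in> space M. ennreal ((f n \<omega>)\<^sup>2) > ennreal (\<epsilon>\<^sup>2 * q n)}" for n
    by (simp only:)
  have "\<epsilon>\<^sup>2 > 0" using \<epsilon> by simp
  then show "(\<lambda>n. measure M {\<omega> \<in> space M. ennreal (f n \<omega>) > ennreal (\<epsilon> * q n powr (1 / 2))}) \<longlonglongrightarrow> 0"
    unfolding eq using sq unfolding small_o_p_def by blast
qed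

section \<open>Joint measurability of the estimators\<close>

context deconvolution
begin

lemma measurable_obs_fst:
  assumes "j \<in> {1..n}" "k \<in> {1..N j}"
  shows "(\<lambda>q. obs X U (fst q) j k) \<in> borel_measurable (P \<Otimes>\<^sub>M M')"
proof -
  have [measurable]: "X j \<in> borel_measurable P" "U j k \<in> borel_measurable P"
    using assms measurable_X measurable_U by auto
  show ?thesis unfolding obs_def by measurable
qed

lemma measurable_obs_fst_fst:
  assumes "j \<in> {1..n}" "k \<in> {1..N j}"
  shows "(\<lambda>q. obs X U (fst (fst q)) j k) \<in> borel_measurable ((P \<Otimes>\<^sub>M M') \<Otimes>\<^sub>M M'')"
  by (rule measurable_compose[OF measurable_fst measurable_obs_fst[OF assms]])

text \<open>Joint in the outcome and in \<open>x\<close>: Fubini over the interval needs this, and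
  sections give measurability at a fixed \<open>x\<close>.\<close>

lemma measurable_fX_hat_pair:
  "(\<lambda>q. fX_hat K N n h \<rho> (obs X U (fst q)) (snd q)) \<in> borel_measurable (P \<Otimes>\<^sub>M lborel)"
  unfolding fX_hat_def L_hat_def
proof (intro borel_measurable_times borel_measurable_const borel_measurable_sum)
  fix j k assume jk: "j \<in> {1..n}" "k \<in> {1..N j}"
  have [measurable]: "(\<lambda>q. obs X U (fst (fst q)) j k) \<in> borel_measurable ((P \<Otimes>\<^sub>M lborel) \<Otimes>\<^sub>M lborel)"
    by (rule measurable_obs_fst_fst[OF jk])
  have [measurable]: "(\<lambda>q. fU_Ft_hat N n (obs X U (fst (fst q))) (snd q / h)) \<in> borel_measurable ((P \<Otimes>\<^sub>M lborel) \<Otimes>\<^sub>M lborel)"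
    by (intro measurable_fU_Ft_hat measurable_obs_fst_fst) auto
  have "(\<lambda>q. iexp (- (snd q * ((snd (fst q) - obs X U (fst (fst q)) j k) / h))) *
      (FT K (snd q) / complex_of_real (fU_Ft_hat N n (obs X U (fst (fst q))) (snd q / h) + \<rho>)))
    \<in> borel_measurable ((P \<Otimes>\<^sub>M lborel) \<Otimes>\<^sub>M lborel)"
    by measurable
  then show "(\<lambda>q. \<integral>t. iexp (- (t * ((snd q - obs X U (fst q) j k) / h))) *
      (FT K t / complex_of_real (fU_Ft_hat N n (obs X U (fst q)) (t / h) + \<rho>)) \<partial>lborel) \<in> borel_measurable (P \<Otimes>\<^sub>M lborel)"
    by (intro lborel.borel_measurable_lebesgue_integral) (simp add: case_prod_beta)
qed

lemma measurable_fX_tilde_pair: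
  "(\<lambda>q. fX_tilde K N n h fU (obs X U (fst q)) (snd q)) \<in> borel_measurable (P \<Otimes>\<^sub>M lborel)"
  unfolding fX_tilde_def L_fun_def
proof (intro borel_measurable_times borel_measurable_const borel_measurable_sum)
  fix j k assume jk: "j \<in> {1..n}" "k \<in> {1..N j}"
  have [measurable]: "FT fU \<in> borel_measurable borel"
    using fU by (intro measurable_FT) (simp add: prob_density_def)
  have [measurable]: "(\<lambda>q. obs X U (fst (fst q)) j k) \<in> borel_measurable ((P \<Otimes>\<^sub>M lborel) \<Otimes>\<^sub>M lborel)"
    by (rule measurable_obs_fst_fst[OF jk])
  have "(\<lambda>q. iexp (- (snd q * ((snd (fst q) - obs X U (fst (fst q)) j k) / h))) * (FT K (snd q) / FT fU (snd q / h)))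
    \<in> borel_measurable ((P \<Otimes>\<^sub>M lborel) \<Otimes>\<^sub>M lborel)"
    by measurable
  then show "(\<lambda>q. \<integral>t. iexp (- (t * ((snd q - obs X U (fst q) j k) / h))) * (FT K t / FT fU (t / h)) \<partial>lborel) \<in> borel_measurable (P \<Otimes>\<^sub>M lborel)"
    by (intro lborel.borel_measurable_lebesgue_integral) (simp add: case_prod_beta)
qed

text \<open>Integrability of the sections of a jointly measurable function is a measurable event, so
  the case distinction preserves measurability.\<close>

lemma measurable_fX_hat0_pair:
  "(\<lambda>q. fX_hat0 a K N n h (obs X U (fst q)) (snd q)) \<in> borel_measurable (P \<Otimes>\<^sub>M lborel)"
  unfolding fX_hat0_def
proof (intro measurable_If measurable_fX_hat_pair measurable_const)
  have [measurable]: "(\<lambda>q. fU_Ft_hat N n (obs X U (fst (fst q))) (snd q / h)) \<in> borel_measurable ((P \<Otimes>\<^sub>M lborel) \<Otimes>\<^sub>M lborel)"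
    by (intro measurable_fU_Ft_hat measurable_obs_fst_fst) auto
  have "(\<lambda>q. FT K (snd q) / complex_of_real (fU_Ft_hat N n (obs X U (fst (fst q))) (snd q / h)))
    \<in> borel_measurable ((P \<Otimes>\<^sub>M lborel) \<Otimes>\<^sub>M lborel)"
    by measurable
  then have "Measurable.pred (P \<Otimes>\<^sub>M lborel) (\<lambda>q. integrable lborel (\<lambda>t. FT K t / complex_of_real (fU_Ft_hat N n (obs X U (fst q)) (t / h))))"
    by (intro lborel.borel_measurable_lebesgue_integrable) (simp add: case_prod_beta)
  then show "{q \<in> space (P \<Otimes>\<^sub>M lborel). integrable lborel (\<lambda>t. FT K t / complex_of_real (fU_Ft_hat N n (obs X U (fst q)) (t / h)))} \<in> sets (P \<Otimes>\<^sub>M lborel)"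
    by (simp only: pred_def)
qed auto

end

section \<open>Rates\<close>

text \<open>Each density of the class comes with its own probability space. Uniformity over the
  class can therefore only arise from bounds that do not mention \<open>fX\<close>.\<close>

locale deconvolution_rates =
  fixes \<alpha> \<beta> B1 C1 C2 k0 c :: real
    and N :: "nat \<Rightarrow> nat"
    and fU K :: "real \<Rightarrow> real"
    and h :: "nat \<Rightarrow> real"
    and P :: "(real \<Rightarrow> real) \<Rightarrow> 'w measure"
    and X :: "(real \<Rightarrow> real) \<Rightarrow> nat \<Rightarrow> 'w \<Rightarrow> real"
    and U :: "(real \<Rightarrow> real) \<Rightarrow> nat \<Rightarrow> nat \<Rightarrow> 'w \<Rightarrow> real"
  assumes pars: "B1 > 1" "C1 > 1" "C2 > 0"
    and fU: "prob_density fU" "\<forall>t. FT fU t \<in> \<real>" "\<forall>t. FT fU t \<noteq> 0"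
    and K: "integrable lborel K" "\<And>t. cmod (FT K t) \<le> k0" "\<And>t. \<bar>t\<bar> > c \<Longrightarrow> FT K t = 0" "c > 0"
    and model: "\<forall>fX\<in>density_class \<beta> C2. replicated_model (P fX) N fX fU (X fX) (U fX)"
    and N_le: "\<forall>j\<ge>1. 1 \<le> N j \<and> real (N j) \<le> C1"
    and pairs_ge: "\<forall>n\<ge>1. num_pairs N n \<ge> real n / C1"
    and fU_decay: "\<forall>t. (1 + \<bar>t\<bar>) powr (- \<alpha>) / B1 \<le> cmod (FT fU t)
                 \<and> cmod (FT fU t) \<le> B1 * (1 + \<bar>t\<bar>) powr (- \<alpha>)"
    and alpha: "\<alpha> > 1/2" and beta: "\<beta> > \<alpha> + 1/2"
    and h_pos: "\<And>n. n \<ge> 1 \<Longrightarrow> 0 < h n"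
    and h_order: "h \<in> \<Theta>(\<lambda>n. real n powr (- 1 / (2 * (\<alpha> + \<beta>) - 1)))"
begin

abbreviation ridge_error :: "nat \<Rightarrow> real \<Rightarrow> (real \<Rightarrow> real) \<Rightarrow> 'w \<Rightarrow> real \<Rightarrow> real" where
  "ridge_error n \<rho> fX \<omega> x \<equiv> cmod (fX_hat K N n (h n) \<rho> (obs (X fX) (U fX) \<omega>) x
     - fX_tilde K N n (h n) fU (obs (X fX) (U fX) \<omega>) x)"

abbreviation free_error :: "complex \<Rightarrow> nat \<Rightarrow> (real \<Rightarrow> real) \<Rightarrow> 'w \<Rightarrow> real \<Rightarrow> real" where
  "free_error a n fX \<omega> x \<equiv> cmod (fX_hat0 a K N n (h n) (obs (X fX) (U fX) \<omega>) x
     - fX_tilde K N n (h n) fU (obs (X fX) (U fX) \<omega>) x)"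

abbreviation ridge_gap :: "complex \<Rightarrow> nat \<Rightarrow> real \<Rightarrow> (real \<Rightarrow> real) \<Rightarrow> 'w \<Rightarrow> real \<Rightarrow> real" where
  "ridge_gap a n \<rho> fX \<omega> x \<equiv> cmod (fX_hat0 a K N n (h n) (obs (X fX) (U fX) \<omega>) x
     - fX_hat K N n (h n) \<rho> (obs (X fX) (U fX) \<omega>) x)"

definition r0 :: real where "r0 = 1 / (2 * (\<alpha> + \<beta>) - 1)"

text \<open>The third fact clears the denominator, turning every comparison of exponents below into
  a linear inequality in \<alpha> and \<beta>.\<close>

lemma r0: "0 < r0" "r0 < 1" "r0 * x < y \<longleftrightarrow> x < y * (2 * (\<alpha> + \<beta>) - 1)"
  using alpha beta by (auto simp: r0_def field_simps)

lemma q_rate_eq: "q_rate \<alpha> \<beta> n = real n powr (- (2 * (\<beta> - 1) * r0))"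
proof -
  have "- 2 * (\<beta> - 1) / (2 * (\<alpha> + \<beta>) - 1) = - (2 * (\<beta> - 1) * r0)"
    using alpha beta by (simp add: r0_def field_simps)
  then show ?thesis by (simp only: q_rate_def)
qed

lemma bandwidth:
  obtains CT where "CT \<ge> 1" "eventually (\<lambda>n. 1 + c / h n \<le> CT * real n powr r0) sequentially"
proof -
  have "h \<in> \<Omega>(\<lambda>n. real n powr (- 1 / (2 * (\<alpha> + \<beta>) - 1)))"
    using h_order by (rule bigthetaD2)
  then obtain cl where cl: "cl > 0" "eventually (\<lambda>n. norm (h n) \<ge> cl * norm (real n powr (- 1 / (2 * (\<alpha> + \<beta>) - 1)))) sequentially"
    by (rule landau_omega.bigE)
  have "eventually (\<lambda>n. 1 + c / h n \<le> (1 + c / cl) * real n powr r0) sequentially"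
    using cl(2) eventually_ge_at_top[of 1]
  proof eventually_elim
    case (elim n)
    have e: "- 1 / (2 * (\<alpha> + \<beta>) - 1) = - r0" by (simp add: r0_def)
    have h: "h n \<ge> cl * real n powr - r0" using elim h_pos[of n] unfolding e by simp
    have "c / h n \<le> c / (cl * real n powr - r0)"
      using h cl K(4) elim h_pos[of n] by (intro divide_left_mono mult_pos_pos) auto
    also have "\<dots> = c / cl * real n powr r0" by (simp add: powr_minus divide_inverse)
    finally have "c / h n \<le> c / cl * real n powr r0" .
    moreover have "1 \<le> real n powr r0" using elim r0 by (intro ge_one_powr_ge_zero) auto
    ultimately show ?case by (simp add: distrib_right)
  qed
  moreover have "1 + c / cl \<ge> 1" using cl K(4) by simp
  ultimately show thesis by (intro that)
qed

text \<open>The upper bound on \<open>psi\<close> is stated apart: it feeds the small-ball estimate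
  behind the negative moments.\<close>

lemma deconvolution:
  assumes fX: "fX \<in> density_class \<beta> C2"
  shows "deconvolution (P fX) N fX fU (X fX) (U fX) C1 K \<alpha> B1 \<beta> C2 k0 c"
    and "\<And>t. replicated_observations.psi fU t \<le> B1 * (1 + \<bar>t\<bar>) powr - \<alpha>"
proof -
  have m: "replicated_model (P fX) N fX fU (X fX) (U fX)" using model fX by blast
  then have "prob_space (P fX)" by (simp add: replicated_model_def)
  moreover have fXd: "prob_density fX" using fX by (simp add: density_class_def)
  ultimately have ro: "replicated_observations (P fX) N fX fU (X fX) (U fX)"
    using m fU by (intro replicated_observations.intro replicated_observations_axioms.intro) auto
  have psi: "cmod (FT fU t) = replicated_observations.psi fU t" for t
    using replicated_observations.FT_fU_eq[OF ro, of t] replicated_observations.psi_pos[OF ro, of t] by simp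
  show "deconvolution (P fX) N fX fU (X fX) (U fX) C1 K \<alpha> B1 \<beta> C2 k0 c"
  proof (intro deconvolution.intro bounded_replications.intro ro bounded_replications_axioms.intro deconvolution_axioms.intro)
    show "(1 + \<bar>t\<bar>) powr - \<alpha> / B1 \<le> replicated_observations.psi fU t" for t
      using fU_decay psi[of t] by (metis (no_types))
    show "(1 + \<bar>t\<bar>) powr \<beta> * cmod (FT fX t) \<le> C2" for t
      using fX by (simp add: density_class_def)
  qed (use pars K N_le pairs_ge alpha beta in auto)
  show "replicated_observations.psi fU t \<le> B1 * (1 + \<bar>t\<bar>) powr - \<alpha>" for t
    using fU_decay psi[of t] by (metis (no_types))
qed

text \<open>\<open>E\<close> is chosen before \<open>fX\<close> and \<open>x\<close>, which is the
  uniformity asked for in (a). The same statement is applied to the auxiliary ridge in (b).\<close>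

lemma mse_rate:
  fixes \<rho> :: "nat \<Rightarrow> real"
  assumes cpos: "c1 > 0" "c2 > 0" "c3 > 0"
    and \<rho>: "\<And>n. n \<ge> 1 \<Longrightarrow> c1 * real n powr (- c2) \<le> \<rho> n \<and> \<rho> n \<le> c3 / real n"
  shows "\<exists>E. (\<forall>n. E n \<ge> 0) \<and> (\<lambda>n. E n / q_rate \<alpha> \<beta> n) \<longlonglongrightarrow> 0 \<and>
    eventually (\<lambda>n. \<forall>fX\<in>density_class \<beta> C2. \<forall>x.
       (\<integral>\<^sup>+\<omega>. ennreal ((ridge_error n (\<rho> n) fX \<omega> x)\<^sup>2) \<partial>P fX) \<le> ennreal (E n)) sequentially"
proof -
  obtain CT where CT: "CT \<ge> 1" "eventually (\<lambda>n. 1 + c / h n \<le> CT * real n powr r0) sequentially"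
    by (rule bandwidth)
  \<comment> \<open>The midpoint of the admissible range. The lower end is what
    \<open>mse_bound\<close> requires; at the upper end \<alpha> + 1/2 the product term is exactly
    of the order of \<open>q_rate\<close>. The range is nonempty because \<beta> > \<alpha> +
    1/2.\<close>
  define \<gamma> where "\<gamma> = (max (2 * \<alpha> - \<beta> + 1) 0 + (\<alpha> + 1 / 2)) / 2"
  have \<gamma>: "\<gamma> > 0" "2 * \<alpha> - \<beta> \<le> \<gamma> - 1" "\<gamma> < \<alpha> + 1 / 2"
    using alpha beta by (auto simp: \<gamma>_def max_def field_simps)
  define A1 where "A1 = k0\<^sup>2 * (C2\<^sup>2 * (16 * C1 ^ 6 + 16 * c3\<^sup>2 + 73) * B1 ^ 4) * (4 / \<gamma>\<^sup>2)"
  define A2 where "A2 = k0\<^sup>2 * (C1 * C2 * (8 * C1 ^ 6 + 8 * c3\<^sup>2 + 1) * B1 ^ 6) * (8 / (\<beta> - 1))"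
  have A: "A1 \<ge> 0" "A2 \<ge> 0"
    unfolding A1_def A2_def using pars alpha beta by (auto intro!: mult_nonneg_nonneg add_nonneg_nonneg)
  define E where "E n = A1 * ((CT * real n powr r0) powr (2 * \<gamma>) / real n)
      + A2 * ((CT * real n powr r0) powr (6 * \<alpha> + 1) / (real n)\<^sup>2)" for n
  \<comment> \<open>\<open>g * n powr (- (\<alpha> * r0))\<close> will bound \<open>psi\<close> from
    below on the range of integration.\<close>
  define g where "g = CT powr - \<alpha> / B1"
  have g: "g > 0" using CT pars by (simp add: g_def)
  define m where "m = max c2 (\<alpha> * r0)"
  \<comment> \<open>The exponent in Hoeffding's bound is at least of order
    \<open>n * (n powr (- (\<alpha> * r0)))^4 = n powr \<delta>\<close>, and \<open>\<delta>\<close>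
    is positive because \<beta> > \<alpha> + 1/2.\<close>
  define \<delta> where "\<delta> = 1 - 4 * (\<alpha> * r0)"
  have \<delta>: "\<delta> > 0" using r0(3)[of "4 * \<alpha>" 1] beta by (simp add: \<delta>_def mult_ac)
  define D where "D = 1 / c1 + 1 / g"
  define G where "G = g ^ 4 / (2 * C1 ^ 6)"
  have G: "G > 0" using g pars by (simp add: G_def)
  \<comment> \<open>The power \<open>2 * m\<close> stems from the squared inverse ridge and inverse
    \<open>psi\<close>; one more power of \<open>n\<close> ensures a tail term of at most
    \<open>1 / n\<close>.\<close>
  have "(\<lambda>n. 2 * D\<^sup>2 * (real n powr (2 * m + 1) * exp (- (G * real n powr \<delta>)))) \<longlonglongrightarrow> 2 * D\<^sup>2 * 0"
  proof (intro tendsto_intros)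
    show "(\<lambda>n. real n powr (2 * m + 1) * exp (- (G * real n powr \<delta>))) \<longlonglongrightarrow> 0"
      using G \<delta> by real_asymp
  qed
  then have tail_ev: "eventually (\<lambda>n. 2 * D\<^sup>2 * (real n powr (2 * m + 1) * exp (- (G * real n powr \<delta>))) < 1) sequentially"
    by (intro order_tendstoD) auto
  have bound_ev: "eventually (\<lambda>n. \<forall>fX\<in>density_class \<beta> C2. \<forall>x.
       (\<integral>\<^sup>+\<omega>. ennreal ((ridge_error n (\<rho> n) fX \<omega> x)\<^sup>2) \<partial>P fX) \<le> ennreal (E n)) sequentially"
    using CT(2) tail_ev eventually_ge_at_top[of 1]
  proof eventually_elim
    case (elim n)
    show ?case
    proof (intro ballI allI)
      fix fX x assume cls: "fX \<in> density_class \<beta> C2"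
      interpret deconvolution "P fX" N fX fU "X fX" "U fX" C1 K \<alpha> B1 \<beta> C2 k0 c
        using cls by (rule deconvolution)
      have n: "n \<ge> 1" and n0: "real n \<ge> 1" using elim by auto
      have hn: "h n > 0" using n by (rule h_pos)
      have \<rho>pos: "\<rho> n > 0"
      proof -
        have "0 < c1 * real n powr (- c2)" using cpos n by simp
        then show ?thesis using \<rho>[OF n] by linarith
      qed
      have \<rho>sq: "(\<rho> n)\<^sup>2 \<le> c3\<^sup>2 / real n"
      proof -
        have "(\<rho> n)\<^sup>2 \<le> (c3 / real n)\<^sup>2" using \<rho>[OF n] \<rho>pos by (intro power_mono) auto
        also have "\<dots> = c3\<^sup>2 / real n * (1 / real n)" by (simp add: power_divide power2_eq_square)
        also have "\<dots> \<le> c3\<^sup>2 / real n * 1" using n0 by (intro mult_left_mono) auto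
        finally show ?thesis by simp
      qed
      define pn where "pn = g * real n powr (- (\<alpha> * r0))"
      have pn: "pn > 0" using g n by (simp add: pn_def)
      have psi_ge: "psi t \<ge> pn" if t: "\<bar>t\<bar> \<le> c / h n" for t
      proof -
        have "1 + \<bar>t\<bar> \<le> CT * real n powr r0" using t elim by linarith
        then have "(CT * real n powr r0) powr - \<alpha> \<le> (1 + \<bar>t\<bar>) powr - \<alpha>"
          using alpha by (intro powr_mono2') auto
        moreover have "(CT * real n powr r0) powr - \<alpha> = CT powr - \<alpha> * real n powr (- (\<alpha> * r0))"
          using CT n by (simp add: powr_mult powr_powr mult.commute)
        ultimately have "pn \<le> (1 + \<bar>t\<bar>) powr - \<alpha> / B1"
          using pars by (simp add: pn_def g_def divide_right_mono)
        then show ?thesis using psi_lower[of t] by linarith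
      qed
      have tail: "tail_term n (\<rho> n) (psi t) \<le> 1 / real n" if t: "\<bar>t\<bar> \<le> c / h n" for t
      proof -
        have le1: "1 / \<rho> n + 1 / psi t \<le> D * real n powr m"
        proof -
          have "1 / \<rho> n \<le> 1 / (c1 * real n powr (- c2))"
            using \<rho>[OF n] \<rho>pos cpos n by (intro divide_left_mono) auto
          also have "\<dots> = 1 / c1 * real n powr c2" by (simp add: powr_minus field_simps)
          also have "\<dots> \<le> 1 / c1 * real n powr m"
            using n0 cpos by (intro mult_left_mono powr_mono) (auto simp: m_def)
          finally have 1: "1 / \<rho> n \<le> 1 / c1 * real n powr m" .
          have "1 / psi t \<le> 1 / pn" using psi_ge[OF t] pn by (intro divide_left_mono mult_pos_pos) (auto simp: psi_pos)
          also have "\<dots> = 1 / g * real n powr (\<alpha> * r0)" by (simp add: pn_def powr_minus field_simps)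
          also have "\<dots> \<le> 1 / g * real n powr m"
            using n0 g by (intro mult_left_mono powr_mono) (auto simp: m_def)
          finally show ?thesis using 1 by (simp add: D_def distrib_right)
        qed
        have "tail_term n (\<rho> n) (psi t) \<le> (D * real n powr m)\<^sup>2 * (2 * exp (- (G * real n powr \<delta>)))"
          unfolding tail_term_def
        proof (rule mult_mono)
          show "(1 / \<rho> n + 1 / psi t)\<^sup>2 \<le> (D * real n powr m)\<^sup>2"
            using \<rho>pos psi_pos[of t] by (intro power_mono le1) auto
          have "pn ^ 4 \<le> psi t ^ 4" using psi_ge[OF t] pn by (intro power_mono) auto
          then have "real n * pn ^ 4 / (2 * C1 ^ 6) \<le> real n * psi t ^ 4 / (2 * C1 ^ 6)"
            using pars by (intro divide_right_mono mult_left_mono) auto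
          moreover have "real n * pn ^ 4 / (2 * C1 ^ 6) = G * real n powr \<delta>"
          proof -
            have "(real n powr (- (\<alpha> * r0))) ^ 4 = real n powr (- (4 * (\<alpha> * r0)))"
              using n by (simp add: powr_power mult_ac)
            then have "real n * pn ^ 4 = g ^ 4 * (real n powr 1 * real n powr (- (4 * (\<alpha> * r0))))"
              using n by (simp add: pn_def power_mult_distrib)
            also have "real n powr 1 * real n powr (- (4 * (\<alpha> * r0))) = real n powr \<delta>"
              unfolding powr_add[symmetric] by (simp add: \<delta>_def)
            finally show ?thesis by (simp add: G_def)
          qed
          ultimately show "2 * exp (- real n * psi t ^ 4 / (2 * C1 ^ 6)) \<le> 2 * exp (- (G * real n powr \<delta>))" by simp
        qed auto
        also have "\<dots> = 2 * D\<^sup>2 * (real n powr (2 * m + 1) * exp (- (G * real n powr \<delta>))) / real n"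
        proof -
          have "(real n powr m)\<^sup>2 * real n = real n powr (2 * m + 1)"
          proof -
            have "(real n powr m)\<^sup>2 = real n powr (2 * m)"
              by (simp add: power2_eq_square powr_add[symmetric])
            then show ?thesis using n by (simp add: powr_add)
          qed
          then show ?thesis using n by (simp add: power_mult_distrib field_simps)
        qed
        also have "\<dots> \<le> 1 / real n" using elim n by (intro divide_right_mono) auto
        finally show ?thesis .
      qed
      have T1: "1 + c / h n \<ge> 0" using hn c_pos by simp
      have "(\<integral>\<^sup>+\<omega>. ennreal ((ridge_error n (\<rho> n) fX \<omega> x)\<^sup>2) \<partial>P fX)
         \<le> ennreal (A1 * ((1 + c / h n) powr (2 * \<gamma>) / real n) + A2 * ((1 + c / h n) powr (6 * \<alpha> + 1) / (real n)\<^sup>2))"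
        unfolding A1_def A2_def
        by (rule mse_bound[OF n hn \<rho>pos _ \<rho>sq refl tail \<gamma>(1,2)]) auto
      also have "\<dots> \<le> ennreal (E n)"
        unfolding E_def using elim A T1 \<gamma> alpha
        by (intro ennreal_leI add_mono mult_left_mono divide_right_mono powr_mono2) auto
      finally show "(\<integral>\<^sup>+\<omega>. ennreal ((ridge_error n (\<rho> n) fX \<omega> x)\<^sup>2) \<partial>P fX) \<le> ennreal (E n)" .
    qed
  qed
  have lim: "(\<lambda>n. E n / q_rate \<alpha> \<beta> n) \<longlonglongrightarrow> 0"
  proof -
    define e1 where "e1 = r0 * (2 * \<gamma>) - 1 + 2 * (\<beta> - 1) * r0"
    define e2 where "e2 = r0 * (6 * \<alpha> + 1) - 2 + 2 * (\<beta> - 1) * r0"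
    have e1: "e1 < 0"
    proof -
      have "r0 * (2 * \<gamma> + 2 * (\<beta> - 1)) < 1" using r0(3)[of "2 * \<gamma> + 2 * (\<beta> - 1)" 1] \<gamma> by simp
      then show ?thesis by (simp add: e1_def algebra_simps)
    qed
    \<comment> \<open>By \<open>r0\<close> this is \<open>6 * \<alpha> + 2 * \<beta> - 1 < 2 * (2 *
      (\<alpha> + \<beta>) - 1)\<close>, once more equivalent to \<beta> > \<alpha> + 1/2.\<close>
    have e2: "e2 < 0"
    proof -
      have "r0 * (6 * \<alpha> + 1 + 2 * (\<beta> - 1)) < 2" using r0(3)[of "6 * \<alpha> + 1 + 2 * (\<beta> - 1)" 2] beta by simp
      then show ?thesis by (simp add: e2_def algebra_simps)
    qed
    have "(\<lambda>n. A1 * CT powr (2 * \<gamma>) * real n powr e1 + A2 * CT powr (6 * \<alpha> + 1) * real n powr e2) \<longlonglongrightarrow>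
        A1 * CT powr (2 * \<gamma>) * 0 + A2 * CT powr (6 * \<alpha> + 1) * 0"
      using e1 e2 by (intro tendsto_intros tendsto_neg_powr filterlim_real_sequentially)
    moreover have "eventually (\<lambda>n. A1 * CT powr (2 * \<gamma>) * real n powr e1 + A2 * CT powr (6 * \<alpha> + 1) * real n powr e2 = E n / q_rate \<alpha> \<beta> n) sequentially"
      using eventually_ge_at_top[of 1]
    proof eventually_elim
      case (elim n)
      have n: "real n > 0" using elim by simp
      have p1: "(CT * real n powr r0) powr y = CT powr y * real n powr (r0 * y)" for y
        using CT by (simp add: powr_mult powr_powr)
      have i1: "1 / real n = real n powr - 1" and i2: "1 / (real n)\<^sup>2 = real n powr - 2"
        using n by (simp_all add: powr_minus divide_inverse powr_numeral)
      have iq: "1 / q_rate \<alpha> \<beta> n = real n powr (2 * (\<beta> - 1) * r0)"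
        unfolding q_rate_eq powr_minus
        by (simp only: inverse_eq_divide divide_divide_eq_right mult_1_left div_by_1)
      have "E n / q_rate \<alpha> \<beta> n = A1 * (CT powr (2 * \<gamma>) * real n powr (r0 * (2 * \<gamma>)) * (1 / real n)) * (1 / q_rate \<alpha> \<beta> n)
          + A2 * (CT powr (6 * \<alpha> + 1) * real n powr (r0 * (6 * \<alpha> + 1)) * (1 / (real n)\<^sup>2)) * (1 / q_rate \<alpha> \<beta> n)"
        unfolding E_def p1 by (simp add: add_divide_distrib)
      also have "\<dots> = A1 * CT powr (2 * \<gamma>) * (real n powr (r0 * (2 * \<gamma>)) * real n powr - 1 * real n powr (2 * (\<beta> - 1) * r0))
          + A2 * CT powr (6 * \<alpha> + 1) * (real n powr (r0 * (6 * \<alpha> + 1)) * real n powr - 2 * real n powr (2 * (\<beta> - 1) * r0))"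
        unfolding i1 i2 iq by (simp only: mult.assoc)
      also have "\<dots> = A1 * CT powr (2 * \<gamma>) * real n powr e1 + A2 * CT powr (6 * \<alpha> + 1) * real n powr e2"
        unfolding powr_add[symmetric] by (simp add: e1_def e2_def)
      finally show ?case by simp
    qed
    ultimately show ?thesis by (auto intro: Lim_transform_eventually)
  qed
  have "E n \<ge> 0" for n unfolding E_def using A by (intro add_nonneg_nonneg mult_nonneg_nonneg) auto
  then show ?thesis using lim bound_ev by blast
qed

text \<open>Both claims rest on one squared comparison: off a small event, the squared ridge-free
  error is at most \<open>2 * (a0 n)^2\<close> plus twice the squared error with the auxiliary
  ridge, whose mean is covered by \<open>mse_rate\<close>.\<close>

lemma ridge_free_rates:
  fixes fX :: "real \<Rightarrow> real"
  assumes cls: "fX \<in> density_class \<beta> C2"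
  shows "small_o_p (P fX)
         (\<lambda>n \<omega>. ennreal (free_error a n fX \<omega> x))
         (\<lambda>n. q_rate \<alpha> \<beta> n powr (1/2))"
    and "x1 < x2 \<Longrightarrow> small_o_p (P fX)
         (\<lambda>n \<omega>. \<integral>\<^sup>+x\<in>{x1..x2}.
            ennreal ((free_error a n fX \<omega> x)\<^sup>2) \<partial>lborel)
         (q_rate \<alpha> \<beta>)"
proof -
  note psi_upper = deconvolution(2)[OF cls]
  interpret deconvolution "P fX" N fX fU "X fX" "U fX" C1 K \<alpha> B1 \<beta> C2 k0 c
    using cls by (rule deconvolution)
  obtain Kc p where Kc: "Kc > 0" and p: "1 / 2 < p" "p < 1"
    and moment: "\<And>t a. t \<noteq> 0 \<Longrightarrow> (\<integral>\<^sup>+u. inv_powr p (sin ((t * u - a) / 2)) \<partial>err_dist) \<le> ennreal (Kc * (1 + 1 / \<bar>t\<bar>))"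
    using sin_moment_err_dist[OF alpha psi_upper] by blast
  obtain CT where CT: "CT \<ge> 1" "eventually (\<lambda>n. 1 + c / h n \<le> CT * real n powr r0) sequentially"
    by (rule bandwidth)
  \<comment> \<open>\<open>Q\<close> is of order at most \<open>n^7\<close>: one power from Markov's
    inequality, one from \<open>c / h n\<close>, five from the moment bound. The choice makes
    \<open>\<rho> n powr (2 * p - 1)\<close> equal to \<open>n powr - 9\<close> and leaves a gap of
    order \<open>n powr - 2\<close>. As \<open>2 * p - 1 < 1\<close>, the exponent \<open>c2\<close>
    is at least 9, so the ridge is at most \<open>1 / n\<close>.\<close>
  define c2 where "c2 = 9 / (2 * p - 1)"
  have c2: "c2 \<ge> 9" "c2 * (2 * p - 1) = 9" using p by (auto simp: c2_def field_simps)
  define \<rho> where "\<rho> n = real n powr (- c2)" for n :: nat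
  have \<rho>: "1 * real n powr (- c2) \<le> \<rho> n \<and> \<rho> n \<le> 1 / real n" if "n \<ge> 1" for n
  proof -
    have "real n powr (- c2) \<le> real n powr - 1" using that c2 by (intro powr_mono) auto
    then show ?thesis using that by (simp add: \<rho>_def powr_minus divide_inverse)
  qed
  obtain E where E0: "\<And>n. E n \<ge> 0" and E_lim: "(\<lambda>n. E n / q_rate \<alpha> \<beta> n) \<longlonglongrightarrow> 0"
    and E_ev: "eventually (\<lambda>n. \<forall>fX\<in>density_class \<beta> C2. \<forall>x.
       (\<integral>\<^sup>+\<omega>. ennreal ((ridge_error n (\<rho> n) fX \<omega> x)\<^sup>2) \<partial>P fX) \<le> ennreal (E n)) sequentially"
    using mse_rate[of 1 c2 1 \<rho>] c2 \<rho> by force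
  define D0 where "D0 = 2 * CT * (C1\<^sup>2 * (2 * (4 * Kc) ^ 4))"
  have D0: "D0 \<ge> 0" unfolding D0_def using CT C1 Kc by auto
  define a0 where "a0 n = k0 * (4 + D0) * real n powr - 2" for n :: nat
  have a0: "a0 n \<ge> 0" for n unfolding a0_def using k0_nonneg D0 by simp
  define e where "e n = 8 * err_tail n + 1 / real n" for n
  have e_lim: "e \<longlonglongrightarrow> 0"
  proof -
    have "(\<lambda>n. 8 * err_tail n + 1 / real n) \<longlonglongrightarrow> 8 * 0 + 0"
      by (intro tendsto_intros err_tail_tendsto_0 lim_1_over_n)
    then show ?thesis by (simp add: e_def [abs_def])
  qed
  have close: "eventually (\<lambda>n. \<exists>A\<in>sets (P fX). prob (space (P fX) - A) \<le> e n \<and>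
      (\<forall>\<omega>\<in>A. \<forall>x. ridge_gap a n (\<rho> n) fX \<omega> x \<le> a0 n)) sequentially"
  proof -
    have big: "eventually (\<lambda>n. real n > C1 ^ 3) sequentially"
      using filterlim_real_sequentially by (simp add: filterlim_at_top_dense)
    show ?thesis using big CT(2) eventually_ge_at_top[of 1]
    proof eventually_elim
      case (elim n)
      have n: "n \<ge> 1" "real n \<ge> 1" using elim by auto
      have hn: "h n > 0" using n by (intro h_pos)
      have \<rho>pos: "\<rho> n > 0" using n by (simp add: \<rho>_def)
      define Q where "Q = real n * (2 * (c / h n) * (real n * C1\<^sup>2 * (2 * (2 * (Kc * (1 + real n))) ^ 4)))"
      obtain A where A: "A \<in> sets (P fX)" "prob (space (P fX) - A) \<le> 8 * err_tail n + 1 / real n"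
        and close: "\<And>\<omega> x a. \<omega> \<in> A \<Longrightarrow> ridge_gap a n (\<rho> n) fX \<omega> x \<le> k0 * \<rho> n powr (2 * p - 1) * (4 + Q)"
        using ridge_free_event[OF elim(1) hn p Kc \<rho>pos moment Q_def] by blast
      have "k0 * \<rho> n powr (2 * p - 1) * (4 + Q) \<le> a0 n"
      proof -
        have "c / h n \<le> CT * real n powr r0" using elim by linarith
        also have "\<dots> \<le> CT * real n powr 1" using r0 n CT by (intro mult_left_mono powr_mono) auto
        finally have ch: "c / h n \<le> CT * real n" using n by simp
        have "Q \<le> real n * (2 * (CT * real n) * (real n * C1\<^sup>2 * (2 * (2 * (Kc * (2 * real n))) ^ 4)))"
          unfolding Q_def using n CT Kc C1 ch hn c_pos
          by (intro mult_left_mono mult_mono power_mono) auto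
        also have "\<dots> = D0 * real n ^ 7" unfolding D0_def by (simp add: power_mult_distrib eval_nat_numeral)
        finally have "Q \<le> D0 * real n ^ 7" .
        moreover have "4 * 1 \<le> 4 * real n ^ 7" using n by (intro mult_left_mono one_le_power) auto
        ultimately have Q: "4 + Q \<le> (4 + D0) * real n ^ 7" by (simp add: distrib_right)
        have "\<rho> n powr (2 * p - 1) = real n powr - 9"
          unfolding \<rho>_def powr_powr using c2(2) by simp
        then have "k0 * \<rho> n powr (2 * p - 1) * (4 + Q) \<le> k0 * real n powr - 9 * ((4 + D0) * real n ^ 7)"
          using Q k0_nonneg by (simp add: mult_left_mono)
        also have "\<dots> = k0 * (4 + D0) * (real n powr - 9 * real n powr 7)"
          using n by (simp add: powr_numeral)
        also have "real n powr - 9 * real n powr 7 = real n powr - 2"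
          unfolding powr_add[symmetric] by simp
        finally show ?thesis by (simp add: a0_def)
      qed
      with close have "ridge_gap a n (\<rho> n) fX \<omega> x \<le> a0 n"
        if "\<omega> \<in> A" for \<omega> x using that order_trans by blast
      then show ?case using A unfolding e_def by blast
    qed
  qed
  have q_pos: "eventually (\<lambda>n. q_rate \<alpha> \<beta> n > 0) sequentially"
    using eventually_ge_at_top[of 1] by eventually_elim (simp add: q_rate_def)
  \<comment> \<open>\<open>(a0 n)^2\<close> is of order \<open>n powr - 4\<close>, whereas the
    exponent of \<open>q_rate\<close> is above \<open>- 1\<close>.\<close>
  have a0_lim: "(\<lambda>n. (a0 n)\<^sup>2 / q_rate \<alpha> \<beta> n) \<longlonglongrightarrow> 0"
  proof -
    have ex: "2 * (\<beta> - 1) * r0 - 4 < 0"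
      using r0(3)[of "2 * (\<beta> - 1)" 4] alpha beta by (simp add: mult.commute)
    have "(\<lambda>n. (k0 * (4 + D0))\<^sup>2 * real n powr (2 * (\<beta> - 1) * r0 - 4)) \<longlonglongrightarrow> (k0 * (4 + D0))\<^sup>2 * 0"
      using ex by (intro tendsto_intros tendsto_neg_powr filterlim_real_sequentially)
    moreover have "eventually (\<lambda>n. (k0 * (4 + D0))\<^sup>2 * real n powr (2 * (\<beta> - 1) * r0 - 4) = (a0 n)\<^sup>2 / q_rate \<alpha> \<beta> n) sequentially"
      using eventually_ge_at_top[of 1]
    proof eventually_elim
      case (elim n)
      have "(real n powr - 2)\<^sup>2 / real n powr (- (2 * (\<beta> - 1) * r0)) = real n powr (2 * (\<beta> - 1) * r0 - 4)"
        unfolding power2_eq_square powr_add[symmetric] powr_diff[symmetric] by simp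
      then show ?case unfolding a0_def q_rate_eq power_mult_distrib by (metis times_divide_eq_right)
    qed
    ultimately show ?thesis by (auto intro: Lim_transform_eventually)
  qed
  let ?free = "\<lambda>n \<omega> x. free_error a n fX \<omega> x"
  let ?ridge = "\<lambda>n \<omega> x. ridge_error n (\<rho> n) fX \<omega> x"
  have d0_pair: "(\<lambda>q. ?free n (fst q) (snd q)) \<in> borel_measurable (P fX \<Otimes>\<^sub>M lborel)" for n
    by (rule measurable_compose[OF borel_measurable_diff[OF measurable_fX_hat0_pair measurable_fX_tilde_pair] borel_measurable_norm])
  have d_pair: "(\<lambda>q. ?ridge n (fst q) (snd q)) \<in> borel_measurable (P fX \<Otimes>\<^sub>M lborel)" for n
    by (rule measurable_compose[OF borel_measurable_diff[OF measurable_fX_hat_pair measurable_fX_tilde_pair] borel_measurable_norm])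
  have d0_meas: "(\<lambda>\<omega>. ?free n \<omega> x) \<in> borel_measurable (P fX)" for n x
    using measurable_compose[OF measurable_Pair2'[of x lborel "P fX"] d0_pair[of n]] by simp
  have d_meas: "(\<lambda>\<omega>. ?ridge n \<omega> x) \<in> borel_measurable (P fX)" for n x
    using measurable_compose[OF measurable_Pair2'[of x lborel "P fX"] d_pair[of n]] by simp
  have sq_le: "ennreal ((?free n \<omega> x)\<^sup>2) \<le> ennreal (2 * (a0 n)\<^sup>2) + 2 * ennreal ((?ridge n \<omega> x)\<^sup>2)"
    if "ridge_gap a n (\<rho> n) fX \<omega> x \<le> a0 n" for n \<omega> x
  proof -
    have "?free n \<omega> x \<le> a0 n + ?ridge n \<omega> x"
      using that norm_triangle_ineq[of "fX_hat0 a K N n (h n) (obs (X fX) (U fX) \<omega>) x - fX_hat K N n (h n) (\<rho> n) (obs (X fX) (U fX) \<omega>) x"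
        "fX_hat K N n (h n) (\<rho> n) (obs (X fX) (U fX) \<omega>) x - fX_tilde K N n (h n) fU (obs (X fX) (U fX) \<omega>) x"] by simp
    then have "(?free n \<omega> x)\<^sup>2 \<le> (a0 n + ?ridge n \<omega> x)\<^sup>2" by (intro power_mono) auto
    also have "\<dots> \<le> 2 * (a0 n)\<^sup>2 + 2 * (?ridge n \<omega> x)\<^sup>2"
      using zero_le_power2[of "a0 n - ?ridge n \<omega> x"] by (simp add: power2_eq_square algebra_simps)
    finally have "ennreal ((?free n \<omega> x)\<^sup>2) \<le> ennreal (2 * (a0 n)\<^sup>2 + 2 * (?ridge n \<omega> x)\<^sup>2)" by (rule ennreal_leI)
    also have "\<dots> = ennreal (2 * (a0 n)\<^sup>2) + 2 * ennreal ((?ridge n \<omega> x)\<^sup>2)"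
      by (simp add: ennreal_mult)
    finally show ?thesis .
  qed
  have E_fX: "eventually (\<lambda>n. \<forall>x. (\<integral>\<^sup>+\<omega>. ennreal ((?ridge n \<omega> x)\<^sup>2) \<partial>P fX) \<le> ennreal (E n)) sequentially"
    using E_ev by eventually_elim (use cls in blast)
  have sq_meas: "(\<lambda>\<omega>. ennreal ((?ridge n \<omega> x)\<^sup>2)) \<in> borel_measurable (P fX)" for n x
    using d_meas[of n x] by measurable
  have two_lim: "(\<lambda>n. C * u n / q_rate \<alpha> \<beta> n) \<longlonglongrightarrow> 0" if "(\<lambda>n. u n / q_rate \<alpha> \<beta> n) \<longlonglongrightarrow> 0" for C and u :: "nat \<Rightarrow> real"
    using tendsto_mult_right_zero[OF that, of C] by simp
  show "small_o_p (P fX) (\<lambda>n \<omega>. ennreal (?free n \<omega> x)) (\<lambda>n. q_rate \<alpha> \<beta> n powr (1/2))"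
  proof (rule small_o_p_sqrtI)
    show "small_o_p (P fX) (\<lambda>n \<omega>. ennreal ((?free n \<omega> x)\<^sup>2)) (q_rate \<alpha> \<beta>)"
    proof (rule small_o_pI)
      show "(\<lambda>\<omega>. ennreal ((?free n \<omega> x)\<^sup>2)) \<in> borel_measurable (P fX)" for n
        using d0_meas[of n x] by measurable
      show "(\<lambda>\<omega>. 2 * ennreal ((?ridge n \<omega> x)\<^sup>2)) \<in> borel_measurable (P fX)" for n
        using sq_meas[of n x] by measurable
      show "0 \<le> 2 * (a0 n)\<^sup>2" for n by simp
      show "0 \<le> 2 * E n" for n using E0[of n] by simp
      show "eventually (\<lambda>n. \<exists>A\<in>sets (P fX). prob (space (P fX) - A) \<le> e n \<and>
         (\<forall>\<omega>\<in>A. ennreal ((?free n \<omega> x)\<^sup>2) \<le> ennreal (2 * (a0 n)\<^sup>2) + 2 * ennreal ((?ridge n \<omega> x)\<^sup>2))) sequentially"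
        using close by eventually_elim (use sq_le in blast)
      show "eventually (\<lambda>n. (\<integral>\<^sup>+\<omega>. 2 * ennreal ((?ridge n \<omega> x)\<^sup>2) \<partial>P fX) \<le> ennreal (2 * E n)) sequentially"
        using E_fX
      proof eventually_elim
        case (elim n)
        have "(\<integral>\<^sup>+\<omega>. 2 * ennreal ((?ridge n \<omega> x)\<^sup>2) \<partial>P fX) = 2 * (\<integral>\<^sup>+\<omega>. ennreal ((?ridge n \<omega> x)\<^sup>2) \<partial>P fX)"
          by (rule nn_integral_cmult[OF sq_meas])
        also have "\<dots> \<le> 2 * ennreal (E n)" using elim by (intro mult_left_mono) auto
        also have "\<dots> = ennreal (2 * E n)" by (simp add: ennreal_mult'' E0)
        finally show ?case .
      qed
    qed (use q_pos e_lim a0_lim E_lim two_lim in auto)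
    show "(\<lambda>\<omega>. ?free n \<omega> x) \<in> borel_measurable (P fX)" for n by (rule d0_meas)
    show "0 \<le> q_rate \<alpha> \<beta> n" for n by (simp add: q_rate_def)
  qed simp
  show "small_o_p (P fX) (\<lambda>n \<omega>. \<integral>\<^sup>+x\<in>{x1..x2}. ennreal ((?free n \<omega> x)\<^sup>2) \<partial>lborel) (q_rate \<alpha> \<beta>)" if x12: "x1 < x2"
  proof (rule small_o_pI)
    interpret pair_sigma_finite "P fX" lborel ..
    let ?l = "x2 - x1"
    have m0: "(\<lambda>(\<omega>, x). ennreal ((?free n \<omega> x)\<^sup>2) * indicator {x1..x2} x) \<in> borel_measurable (P fX \<Otimes>\<^sub>M lborel)" for n
      using d0_pair[of n] unfolding case_prod_beta by measurable
    show "(\<lambda>\<omega>. \<integral>\<^sup>+x\<in>{x1..x2}. ennreal ((?free n \<omega> x)\<^sup>2) \<partial>lborel) \<in> borel_measurable (P fX)" for n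
      by (rule lborel.borel_measurable_nn_integral[OF m0])
    have m1: "(\<lambda>(\<omega>, x). 2 * ennreal ((?ridge n \<omega> x)\<^sup>2) * indicator {x1..x2} x) \<in> borel_measurable (P fX \<Otimes>\<^sub>M lborel)" for n
      using d_pair[of n] unfolding case_prod_beta by measurable
    show "(\<lambda>\<omega>. \<integral>\<^sup>+x\<in>{x1..x2}. 2 * ennreal ((?ridge n \<omega> x)\<^sup>2) \<partial>lborel) \<in> borel_measurable (P fX)" for n
      by (rule lborel.borel_measurable_nn_integral[OF m1])
    show "0 \<le> 2 * ?l * (a0 n)\<^sup>2" "0 \<le> 2 * ?l * E n" for n using E0[of n] x12 by simp_all
    have m2: "(\<lambda>x. 2 * ennreal ((?ridge n \<omega> x)\<^sup>2) * indicator {x1..x2} x) \<in> borel_measurable lborel" if "\<omega> \<in> space (P fX)" for n \<omega>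
      using measurable_compose[OF measurable_Pair1'[OF that, of lborel] m1[of n]] by simp
    \<comment> \<open>The exceptional event is the same for all \<open>x\<close>, so the pointwise
      comparison may be integrated over the interval.\<close>
    show "eventually (\<lambda>n. \<exists>A\<in>sets (P fX). prob (space (P fX) - A) \<le> e n \<and>
       (\<forall>\<omega>\<in>A. (\<integral>\<^sup>+x\<in>{x1..x2}. ennreal ((?free n \<omega> x)\<^sup>2) \<partial>lborel) \<le> ennreal (2 * ?l * (a0 n)\<^sup>2) + (\<integral>\<^sup>+x\<in>{x1..x2}. 2 * ennreal ((?ridge n \<omega> x)\<^sup>2) \<partial>lborel))) sequentially"
      using close
    proof eventually_elim
      case (elim n)
      then obtain A where A: "A \<in> sets (P fX)" "prob (space (P fX) - A) \<le> e n"
        and cl: "\<And>\<omega> x. \<omega> \<in> A \<Longrightarrow> ridge_gap a n (\<rho> n) fX \<omega> x \<le> a0 n"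
        by blast
      have "(\<integral>\<^sup>+x\<in>{x1..x2}. ennreal ((?free n \<omega> x)\<^sup>2) \<partial>lborel) \<le> ennreal (2 * ?l * (a0 n)\<^sup>2) + (\<integral>\<^sup>+x\<in>{x1..x2}. 2 * ennreal ((?ridge n \<omega> x)\<^sup>2) \<partial>lborel)"
        if w: "\<omega> \<in> A" for \<omega>
      proof -
        have wP: "\<omega> \<in> space (P fX)" using w A(1) sets.sets_into_space by blast
        have "(\<integral>\<^sup>+x\<in>{x1..x2}. ennreal ((?free n \<omega> x)\<^sup>2) \<partial>lborel)
           \<le> (\<integral>\<^sup>+x. ennreal (2 * (a0 n)\<^sup>2) * indicator {x1..x2} x + 2 * ennreal ((?ridge n \<omega> x)\<^sup>2) * indicator {x1..x2} x \<partial>lborel)"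
          using sq_le[OF cl[OF w]] by (intro nn_integral_mono) (auto simp: indicator_def)
        also have "\<dots> = (\<integral>\<^sup>+x. ennreal (2 * (a0 n)\<^sup>2) * indicator {x1..x2} x \<partial>lborel) + (\<integral>\<^sup>+x\<in>{x1..x2}. 2 * ennreal ((?ridge n \<omega> x)\<^sup>2) \<partial>lborel)"
          by (rule nn_integral_add) (use m2[OF wP] in auto)
        also have "(\<integral>\<^sup>+x. ennreal (2 * (a0 n)\<^sup>2) * indicator {x1..x2} x \<partial>lborel) = ennreal (2 * (a0 n)\<^sup>2) * ennreal ?l"
          using x12 by (simp add: nn_integral_cmult_indicator)
        also have "\<dots> = ennreal (2 * ?l * (a0 n)\<^sup>2)" using x12 by (simp add: ennreal_mult'[symmetric] mult_ac)
        finally show ?thesis .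
      qed
      then show ?case using A by blast
    qed
    show "eventually (\<lambda>n. (\<integral>\<^sup>+\<omega>. (\<integral>\<^sup>+x\<in>{x1..x2}. 2 * ennreal ((?ridge n \<omega> x)\<^sup>2) \<partial>lborel) \<partial>P fX) \<le> ennreal (2 * ?l * E n)) sequentially"
      using E_fX
    proof eventually_elim
      case (elim n)
      have "(\<integral>\<^sup>+\<omega>. (\<integral>\<^sup>+x\<in>{x1..x2}. 2 * ennreal ((?ridge n \<omega> x)\<^sup>2) \<partial>lborel) \<partial>P fX)
         = (\<integral>\<^sup>+x. (\<integral>\<^sup>+\<omega>. 2 * ennreal ((?ridge n \<omega> x)\<^sup>2) * indicator {x1..x2} x \<partial>P fX) \<partial>lborel)"
        by (rule Fubini'[OF m1, symmetric])
      also have "\<dots> \<le> (\<integral>\<^sup>+x. ennreal (2 * E n) * indicator {x1..x2} x \<partial>lborel)"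
      proof (intro nn_integral_mono)
        fix x
        have "(\<integral>\<^sup>+\<omega>. 2 * ennreal ((?ridge n \<omega> x)\<^sup>2) * indicator {x1..x2} x \<partial>P fX) = (\<integral>\<^sup>+\<omega>. (2 * indicator {x1..x2} x) * ennreal ((?ridge n \<omega> x)\<^sup>2) \<partial>P fX)"
          by (simp only: mult_ac)
        also have "\<dots> = (2 * indicator {x1..x2} x) * (\<integral>\<^sup>+\<omega>. ennreal ((?ridge n \<omega> x)\<^sup>2) \<partial>P fX)"
          by (rule nn_integral_cmult[OF sq_meas])
        also have "\<dots> \<le> (2 * indicator {x1..x2} x) * ennreal (E n)" using elim by (intro mult_left_mono) auto
        also have "\<dots> = ennreal (2 * E n) * indicator {x1..x2} x" by (simp add: ennreal_mult'' E0 mult_ac)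
        finally show "(\<integral>\<^sup>+\<omega>. 2 * ennreal ((?ridge n \<omega> x)\<^sup>2) * indicator {x1..x2} x \<partial>P fX) \<le> ennreal (2 * E n) * indicator {x1..x2} x" .
      qed
      also have "\<dots> = ennreal (2 * E n) * ennreal ?l" using x12 by (simp add: nn_integral_cmult_indicator)
      also have "\<dots> = ennreal (2 * ?l * E n)" using x12 E0[of n] by (simp add: ennreal_mult'[symmetric] mult_ac)
      finally show ?case .
    qed
    show "(\<lambda>n. 2 * ?l * (a0 n)\<^sup>2 / q_rate \<alpha> \<beta> n) \<longlonglongrightarrow> 0" by (rule two_lim[OF a0_lim])
    show "(\<lambda>n. 2 * ?l * E n / q_rate \<alpha> \<beta> n) \<longlonglongrightarrow> 0" by (rule two_lim[OF E_lim])
  qed (use q_pos e_lim in auto)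
qed

end

theorem mainTheorem3:
  fixes \<alpha> \<beta> B1 C1 C2 :: real
    and N :: "nat \<Rightarrow> nat"
    and fU K :: "real \<Rightarrow> real"
    and h h1 h2 :: "nat \<Rightarrow> real"
    and P :: "(real \<Rightarrow> real) \<Rightarrow> 'w measure"
    and X :: "(real \<Rightarrow> real) \<Rightarrow> nat \<Rightarrow> 'w \<Rightarrow> real"
    and U :: "(real \<Rightarrow> real) \<Rightarrow> nat \<Rightarrow> nat \<Rightarrow> 'w \<Rightarrow> real"
  assumes pars: "\<alpha> > 0" "B1 > 1" "C1 > 1" "C2 > 0" "\<beta> > 0"
    and fU: "prob_density fU" "\<forall>t. FT fU t \<in> \<real>" "\<forall>t. FT fU t \<noteq> 0"
    and K: "integrable lborel K" "(\<integral>x. K x \<partial>lborel) = 1" "\<forall>x. K (- x) = K x"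
    and model: "\<forall>fX\<in>density_class \<beta> C2. replicated_model (P fX) N fX fU (X fX) (U fX)"
    and i: "\<forall>j\<ge>1. 1 \<le> N j \<and> real (N j) \<le> C1"
    and ii: "\<forall>n\<ge>1. num_pairs N n \<ge> real n / C1"
    and iii: "\<forall>t. (1 + \<bar>t\<bar>) powr (- \<alpha>) / B1 \<le> cmod (FT fU t)
                 \<and> cmod (FT fU t) \<le> B1 * (1 + \<bar>t\<bar>) powr (- \<alpha>)"
    and iv: "\<alpha> > 1/2"
    and v: "bdd_above (range (\<lambda>t. cmod (FT K t)))" "\<exists>c>0. \<forall>t. \<bar>t\<bar> > c \<longrightarrow> FT K t = 0"
    and vi: "\<forall>n\<ge>1. 0 < h1 n \<and> h1 n \<le> h n \<and> h n \<le> h2 n" "h2 \<longlonglongrightarrow> 0"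
      "\<exists>\<delta>>0. \<exists>\<epsilon>>0. \<forall>n\<ge>1. \<epsilon> \<le> real n powr ((1 - \<delta>) / (4 * \<alpha>)) * h1 n"
    and beta: "\<beta> > \<alpha> + 1/2"
    and h0: "h \<in> \<Theta>(\<lambda>n. real n powr (- 1 / (2 * (\<alpha> + \<beta>) - 1)))"
  shows "(\<forall>\<rho> :: nat \<Rightarrow> real.
      (\<exists>c1>0. \<exists>c2>0. \<exists>c3>0. \<forall>n\<ge>1. c1 * real n powr (- c2) \<le> \<rho> n
          \<and> \<rho> n \<le> c3 * min (h1 n powr (4 * \<alpha> + 2)) (1 / real n)) \<longrightarrow>
      ((\<lambda>n. (SUP fX\<in>density_class \<beta> C2. SUP x :: real.
           \<integral>\<^sup>+\<omega>. ennreal ((cmod (fX_hat K N n (h n) (\<rho> n) (obs (X fX) (U fX) \<omega>) x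
                               - fX_tilde K N n (h n) fU (obs (X fX) (U fX) \<omega>) x))\<^sup>2) \<partial>P fX)
         / ennreal (q_rate \<alpha> \<beta> n)) \<longlonglongrightarrow> 0))
    \<and> (\<forall>a :: real. \<forall>fX\<in>density_class \<beta> C2.
      (\<forall>x. small_o_p (P fX)
         (\<lambda>n \<omega>. ennreal (cmod (fX_hat0 (complex_of_real a) K N n (h n) (obs (X fX) (U fX) \<omega>) x
                              - fX_tilde K N n (h n) fU (obs (X fX) (U fX) \<omega>) x)))
         (\<lambda>n. q_rate \<alpha> \<beta> n powr (1/2))) \<and>
      (\<forall>x1 x2. x1 < x2 \<longrightarrow> small_o_p (P fX)
         (\<lambda>n \<omega>. \<integral>\<^sup>+x\<in>{x1..x2}.
            ennreal ((cmod (fX_hat0 (complex_of_real a) K N n (h n) (obs (X fX) (U fX) \<omega>) x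
                            - fX_tilde K N n (h n) fU (obs (X fX) (U fX) \<omega>) x))\<^sup>2) \<partial>lborel)
         (q_rate \<alpha> \<beta>)))"
proof -
  obtain k0 where k0: "\<And>t. cmod (FT K t) \<le> k0" using v(1) by (auto simp: bdd_above_def)
  obtain c where c: "c > 0" "\<And>t. \<bar>t\<bar> > c \<Longrightarrow> FT K t = 0" using v(2) by blast
  have hpos: "0 < h n" if "n \<ge> 1" for n using vi(1) that by force
  interpret deconvolution_rates \<alpha> \<beta> B1 C1 C2 k0 c N fU K h P X U
    by (rule deconvolution_rates.intro[OF pars(2,3,4) fU K(1) k0 c(2) c(1) model i ii iii iv beta hpos h0])
  show ?thesis
  proof (intro conjI allI impI ballI)
    fix \<rho> :: "nat \<Rightarrow> real"
    assume "\<exists>c1>0. \<exists>c2>0. \<exists>c3>0. \<forall>n\<ge>1. c1 * real n powr (- c2) \<le> \<rho> n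
          \<and> \<rho> n \<le> c3 * min (h1 n powr (4 * \<alpha> + 2)) (1 / real n)"
    then obtain c1 c2 c3 where cs: "c1 > 0" "c2 > 0" "c3 > 0"
      and \<rho>: "\<And>n. n \<ge> 1 \<Longrightarrow> c1 * real n powr (- c2) \<le> \<rho> n
          \<and> \<rho> n \<le> c3 * min (h1 n powr (4 * \<alpha> + 2)) (1 / real n)" by blast
    have \<rho>': "c1 * real n powr (- c2) \<le> \<rho> n \<and> \<rho> n \<le> c3 / real n" if "n \<ge> 1" for n
    proof -
      have "c3 * min (h1 n powr (4 * \<alpha> + 2)) (1 / real n) \<le> c3 * (1 / real n)"
        using cs by (intro mult_left_mono) auto
      then show ?thesis using \<rho>[OF that] by auto
    qed
    obtain E where E0: "\<And>n. E n \<ge> 0" and E_lim: "(\<lambda>n. E n / q_rate \<alpha> \<beta> n) \<longlonglongrightarrow> 0"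
      and E_ev: "eventually (\<lambda>n. \<forall>fX\<in>density_class \<beta> C2. \<forall>x.
       (\<integral>\<^sup>+\<omega>. ennreal ((ridge_error n (\<rho> n) fX \<omega> x)\<^sup>2) \<partial>P fX) \<le> ennreal (E n)) sequentially"
      using mse_rate[OF cs \<rho>'] by blast
    let ?S = "\<lambda>n. SUP fX\<in>density_class \<beta> C2. SUP x :: real.
           \<integral>\<^sup>+\<omega>. ennreal ((ridge_error n (\<rho> n) fX \<omega> x)\<^sup>2) \<partial>P fX"
    have ev: "eventually (\<lambda>n. ?S n / ennreal (q_rate \<alpha> \<beta> n) \<le> ennreal (E n / q_rate \<alpha> \<beta> n)) sequentially"
      using E_ev eventually_ge_at_top[of 1]
    proof eventually_elim
      case (elim n)
      have q: "q_rate \<alpha> \<beta> n > 0" using elim by (simp add: q_rate_def)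
      \<comment> \<open>\<open>E n\<close> is free of \<open>fX\<close> and \<open>x\<close> and
        hence bounds both suprema.\<close>
      have "?S n \<le> ennreal (E n)" using elim by (intro SUP_least) auto
      then have "?S n / ennreal (q_rate \<alpha> \<beta> n) \<le> ennreal (E n) / ennreal (q_rate \<alpha> \<beta> n)"
        by (rule divide_right_mono_ennreal)
      then show ?case using q E0[of n] by (simp add: divide_ennreal)
    qed
    have "(\<lambda>n. ennreal (E n / q_rate \<alpha> \<beta> n)) \<longlonglongrightarrow> ennreal 0"
      using E_lim by (rule tendsto_ennrealI)
    then have "(\<lambda>n. ennreal (E n / q_rate \<alpha> \<beta> n)) \<longlonglongrightarrow> 0" by (simp only: ennreal_0)
    from tendsto_sandwich[OF always_eventually ev tendsto_const this]
    show "(\<lambda>n. ?S n / ennreal (q_rate \<alpha> \<beta> n)) \<longlonglongrightarrow> 0" by (simp only: zero_le simp_thms)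
  next
    fix a :: real and fX :: "real \<Rightarrow> real" and x :: real
    assume "fX \<in> density_class \<beta> C2"
    then show "small_o_p (P fX)
         (\<lambda>n \<omega>. ennreal (cmod (fX_hat0 (complex_of_real a) K N n (h n) (obs (X fX) (U fX) \<omega>) x
                              - fX_tilde K N n (h n) fU (obs (X fX) (U fX) \<omega>) x)))
         (\<lambda>n. q_rate \<alpha> \<beta> n powr (1/2))"
      by (rule ridge_free_rates(1))
  next
    fix a :: real and fX :: "real \<Rightarrow> real" and x1 x2 :: real
    assume "fX \<in> density_class \<beta> C2" "x1 < x2"
    then show "small_o_p (P fX)
         (\<lambda>n \<omega>. \<integral>\<^sup>+x\<in>{x1..x2}.
            ennreal ((cmod (fX_hat0 (complex_of_real a) K N n (h n) (obs (X fX) (U fX) \<omega>) x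
                            - fX_tilde K N n (h n) fU (obs (X fX) (U fX) \<omega>) x))\<^sup>2) \<partial>lborel)
         (q_rate \<alpha> \<beta>)"
      by (rule ridge_free_rates(2))
  qed
qed

end
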